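(* Let $d\ge1$, $0<\rho<1$, $W\in C^\omega_\rho(\mathbb{T},\mathrm{Mat}_d(\mathbb{R}))$, $R\in C^\omega_\rho(\mathbb{T},\mathrm{Sym}_d(\mathbb{R}))$, $D\in C^\omega_\rho(\mathbb{T},\mathrm{Sym}_d(\mathbb{R}))$. Assume that $\det[W(x)]\not\equiv0$ and that $D(x)$ has no constant eigenvalues. Then there are constants $\lambda_0=\lambda_0(W,R,D)$ and $c=c(W,R,D)$ (independent of the frequency $\omega\in\mathbb{R}\setminus\mathbb{Q}$) such that if $\lambda>\lambda_0$, then the $d$ largest Lyapunov exponents of the Schrödinger cocycle $A_{\lambda,E}$ associated with the equation $$-\big(W_{n+1}(x)\vec\psi_{n+1}+W_n^T(x)\vec\psi_{n-1}+R_n(x)\vec\psi_n\big)+\lambda D_n(x)\vec\psi_n=E\,\vec\psi_n ,\qquad \{\vec\psi_n\}_{n\in\mathbb{Z}}\subset\mathbb{R}^d,$$ satisfy $$L^{(k)}(A_{\lambda,E})\ge\log\lambda-c\qquad\text{for all }E\in\mathbb{R},\ 1\le k\le d .$$ Moreover, the other $d$ Lyapunov exponents are the additive inverses of the $d$ largest ones, i.e. $L^{(2d+1-k)}(A_{\lambda,E})=-L^{(k)}(A_{\lambda,E})$ for $1\le k\le d$.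
   Context: $\mathbb{T}=\mathbb{R}/\mathbb{Z}$; a function of $x\in\mathbb{T}$ is identified with a function of $z=e^{2\pi i x}$ on the unit circle. $\mathscr{A}_\rho=\{z\in\mathbb{C}:1-\rho\le|z|\le1+\rho\}$. For a real vector space $\mathscr{M}$ of matrices, $C^\omega_\rho(\mathbb{T},\mathscr{M})$ is the space of real analytic functions $V:\mathbb{T}\to\mathscr{M}$ having an extension with values in $\mathscr{M}\otimes\mathbb{C}$, holomorphic in the interior of $\mathscr{A}_\rho$ and continuous on $\mathscr{A}_\rho$. $\mathrm{Sym}_d(\mathbb{R})$: real symmetric $d\times d$ matrices; $W^T$: transpose. For $\omega\in\mathbb{R}\setminus\mathbb{Q}$: $W_n(x)=W(x+n\omega)$, $R_n(x)=R(x+n\omega)$, $D_n(x)=D(x+n\omega)$. A function $D$ has no constant eigenvalues if there is no number $e\in\mathbb{C}$ which is an eigenvalue of $D(x)$ for every $x\in\mathbb{T}$. The Schrödinger cocycle associated with the equation is the $2d$-dimensional cocycle (defined for a.e. $x$) $$A_{\lambda,E}(x)=\begin{bmatrix}W^{-1}(x+\omega)\,(\lambda D(x)-R(x)-E\cdot I) & -W^{-1}(x+\omega)W^T(x)\\ I&0\end{bmatrix},$$ so that the equation is equivalent to $\begin{bmatrix}\vec\psi_{n+1}\\ \vec\psi_n\end{bmatrix}=A_{\lambda,E}(x+n\omega)\begin{bmatrix}\vec\psi_{n}\\ \vec\psi_{n-1}\end{bmatrix}$. Lyapunov exponents: with $M_n(x)=A(x+(n-1)\omega)\cdots A(x+\omega)A(x)$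 having singular values $s_n^{(1)}(x)\ge\dots\ge s_n^{(2d)}(x)$, $L^{(i)}(A)=\lim_{n\to\infty}\frac1n\log s^{(i)}_n(x)$ for a.e. $x\in\mathbb{T}$. *)

theory Defs
  imports
    "HOL-Analysis.Analysis"
    "Jordan_Normal_Form.Char_Poly"
    "Jordan_Normal_Form.Gauss_Jordan_Elimination"
begin

text \<open>
  The matrices are those of Jordan_Normal_Form, so the dimension \<^term>\<open>d\<close> is an ordinary natural
  number. A function on the torus of reals modulo the integers is a 1-periodic function on the
  reals, and almost every point of the torus means almost every \<^term>\<open>x \<in> {0..<1::real}\<close>.
\<close>

definition sym_mats :: "nat \<Rightarrow> real mat set" where
  "sym_mats d = {A \<in> carrier_mat d d. transpose_mat A = A}"

definition annulus :: "real \<Rightarrow> complex set" where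
  "annulus \<rho> = {z. 1 - \<rho> \<le> norm z \<and> norm z \<le> 1 + \<rho>}"

abbreviation cmat :: "real mat \<Rightarrow> complex mat" where
  "cmat \<equiv> map_mat complex_of_real"

text \<open>The complexification of a real vector space of matrices.\<close>

definition complexification :: "real mat set \<Rightarrow> complex mat set" where
  "complexification M = {cmat A + \<i> \<cdot>\<^sub>m cmat B | A B. A \<in> M \<and> B \<in> M}"

text \<open>
  The space of real analytic functions on the torus with values in a real vector space
  \<^term>\<open>M \<subseteq> carrier_mat d d\<close> that extend to the annulus. Periodicity and real analyticity are not
  listed separately: both follow from the existence of the extension when \<^prop>\<open>\<rho> > 0\<close>.
\<close>

definition C_omega :: "nat \<Rightarrow> real \<Rightarrow> real mat set \<Rightarrow> (real \<Rightarrow> real mat) set" where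
  "C_omega d \<rho> M = {V. (\<forall>x. V x \<in> M) \<and>
     (\<exists>F :: complex \<Rightarrow> complex mat.
        (\<forall>z \<in> annulus \<rho>. F z \<in> complexification M) \<and>
        (\<forall>i<d. \<forall>j<d. (\<lambda>z. F z $$ (i, j)) holomorphic_on interior (annulus \<rho>)) \<and>
        (\<forall>i<d. \<forall>j<d. continuous_on (annulus \<rho>) (\<lambda>z. F z $$ (i, j))) \<and>
        (\<forall>x. F (cis (2 * pi * x)) = cmat (V x)))}"

definition no_constant_eigenvalues :: "(real \<Rightarrow> real mat) \<Rightarrow> bool" where
  "no_constant_eigenvalues D \<longleftrightarrow> \<not> (\<exists>e :: complex. \<forall>x. eigenvalue (cmat (D x)) e)"

text \<open>
  The inverse is only meaningful at those \<^term>\<open>x\<close> for which \<^term>\<open>W (x + \<omega>)\<close> is invertible;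
  elsewhere the value is arbitrary.
\<close>

definition schroedinger_cocycle ::
  "nat \<Rightarrow> real \<Rightarrow> (real \<Rightarrow> real mat) \<Rightarrow> (real \<Rightarrow> real mat) \<Rightarrow> (real \<Rightarrow> real mat) \<Rightarrow>
   real \<Rightarrow> real \<Rightarrow> real \<Rightarrow> real mat" where
  "schroedinger_cocycle d \<omega> W R D lam E x =
     (let Winv = the (mat_inverse (W (x + \<omega>))) in
      four_block_mat
        (Winv * (lam \<cdot>\<^sub>m D x - R x - E \<cdot>\<^sub>m 1\<^sub>m d)) (- (Winv * transpose_mat (W x)))
        (1\<^sub>m d) (0\<^sub>m d d))"

primrec cocycle_iterate :: "real \<Rightarrow> (real \<Rightarrow> real mat) \<Rightarrow> nat \<Rightarrow> real \<Rightarrow> real mat" where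
  "cocycle_iterate \<omega> A 0 x = 1\<^sub>m (dim_row (A x))"
| "cocycle_iterate \<omega> A (Suc n) x = A (x + real n * \<omega>) * cocycle_iterate \<omega> A n x"

text \<open>
  The singular values in nonincreasing order, repeated according to multiplicity, as the square
  roots of the roots of the characteristic polynomial of the Gram matrix; they are numbered
  from 1.
\<close>

definition singular_values :: "real mat \<Rightarrow> real list" where
  "singular_values M =
     rev (sorted_list_of_multiset
            (image_mset sqrt (proots (char_poly (transpose_mat M * M)))))"

definition singular_value :: "nat \<Rightarrow> real mat \<Rightarrow> real" where
  "singular_value i M = singular_values M ! (i - 1)"

text \<open>
  The \<open>i\<close>-th Lyapunov exponent of the cocycle exists and equals \<open>L\<close>.
\<close>

definition has_lyapunov_exponent ::
  "real \<Rightarrow> (real \<Rightarrow> real mat) \<Rightarrow> nat \<Rightarrow> real \<Rightarrow> bool" where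
  "has_lyapunov_exponent \<omega> A i L \<longleftrightarrow>
     (AE x in lebesgue_on {0..<1}.
        (\<lambda>n. 1 / real n * ln (singular_value i (cocycle_iterate \<omega> A n x))) \<longlonglongrightarrow> L)"

text \<open>
  The equation whose cocycle is studied, at the site \<^term>\<open>n\<close>, and its equivalence with the
  transfer relation of the cocycle.
\<close>

definition schroedinger_equation ::
  "real \<Rightarrow> (real \<Rightarrow> real mat) \<Rightarrow> (real \<Rightarrow> real mat) \<Rightarrow> (real \<Rightarrow> real mat) \<Rightarrow>
   real \<Rightarrow> real \<Rightarrow> real \<Rightarrow> (int \<Rightarrow> real vec) \<Rightarrow> int \<Rightarrow> bool" where
  "schroedinger_equation \<omega> W R D lam E x \<psi> n \<longleftrightarrow>
     - (W (x + of_int (n + 1) * \<omega>) *\<^sub>v \<psi> (n + 1)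
        + transpose_mat (W (x + of_int n * \<omega>)) *\<^sub>v \<psi> (n - 1)
        + R (x + of_int n * \<omega>) *\<^sub>v \<psi> n)
     + lam \<cdot>\<^sub>v (D (x + of_int n * \<omega>) *\<^sub>v \<psi> n) = E \<cdot>\<^sub>v \<psi> n"

lemma smult_mat_mult_vec:
  fixes A :: "real mat"
  assumes "A \<in> carrier_mat n m" "v \<in> carrier_vec m"
  shows "(c \<cdot>\<^sub>m A) *\<^sub>v v = c \<cdot>\<^sub>v (A *\<^sub>v v)"
  using assms by (intro eq_vecI) auto

lemma vec_rearrange:
  fixes a b c l e :: "real vec"
  assumes "a \<in> carrier_vec d" "b \<in> carrier_vec d" "c \<in> carrier_vec d" "l \<in> carrier_vec d"
    "e \<in> carrier_vec d"
  shows "- (a + b + c) + l = e \<longleftrightarrow> a = l - c - e - b"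
  using assms by (auto simp: vec_eq_iff algebra_simps)

lemma schroedinger_equation_iff_cocycle:
  fixes \<psi> :: "int \<Rightarrow> real vec"
  assumes W: "\<And>y. W y \<in> carrier_mat d d" and R: "\<And>y. R y \<in> carrier_mat d d"
    and D: "\<And>y. D y \<in> carrier_mat d d" and \<psi>: "\<And>m. \<psi> m \<in> carrier_vec d"
    and inv: "det (W (x + of_int (n + 1) * \<omega>)) \<noteq> 0"
  shows "schroedinger_equation \<omega> W R D lam E x \<psi> n \<longleftrightarrow>
    \<psi> (n + 1) @\<^sub>v \<psi> n =
      schroedinger_cocycle d \<omega> W R D lam E (x + of_int n * \<omega>) *\<^sub>v (\<psi> n @\<^sub>v \<psi> (n - 1))"
proof -
  let ?y = "x + of_int n * \<omega>"
  let ?W = "W (?y + \<omega>)"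
  have y: "x + of_int (n + 1) * \<omega> = ?y + \<omega>" by (simp add: algebra_simps)
  have "?W \<in> Units (ring_mat TYPE(real) d ())"
    using inv W unfolding y by (intro det_non_zero_imp_unit) auto
  then obtain V where V: "mat_inverse ?W = Some V"
    using mat_inverse(1)[OF W, where b = "()"] by (cases "mat_inverse ?W") auto
  have Vi: "?W * V = 1\<^sub>m d" "V * ?W = 1\<^sub>m d" and Vc: "V \<in> carrier_mat d d"
    using mat_inverse(2)[OF W V] by auto
  let ?B = "lam \<cdot>\<^sub>m D ?y - R ?y - E \<cdot>\<^sub>m 1\<^sub>m d"
  let ?T = "transpose_mat (W ?y)"
  let ?r = "?B *\<^sub>v \<psi> n - ?T *\<^sub>v \<psi> (n - 1)"
  note [simp] = carrier_matD[OF W] carrier_matD[OF R] carrier_matD[OF D] carrier_vecD[OF \<psi>]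
  have Bc: "?B \<in> carrier_mat d d" and Tc: "?T \<in> carrier_mat d d" using W R D by auto
  have rc: "?r \<in> carrier_vec d" using Bc Tc \<psi> by (auto intro!: carrier_vecI)
  have lD: "lam \<cdot>\<^sub>m D ?y \<in> carrier_mat d d" and E1: "E \<cdot>\<^sub>m 1\<^sub>m d \<in> carrier_mat d d"
    using D by auto
  have lDR: "lam \<cdot>\<^sub>m D ?y - R ?y \<in> carrier_mat d d" using R by (intro minus_carrier_mat)
  have B: "?B *\<^sub>v \<psi> n = lam \<cdot>\<^sub>v (D ?y *\<^sub>v \<psi> n) - R ?y *\<^sub>v \<psi> n - E \<cdot>\<^sub>v \<psi> n"
    using minus_mult_distrib_mat_vec[OF lDR E1 \<psi>] minus_mult_distrib_mat_vec[OF lD R \<psi>]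
      smult_mat_mult_vec[OF D \<psi>] smult_mat_mult_vec[OF one_carrier_mat \<psi>] \<psi>
    by simp
  have "schroedinger_equation \<omega> W R D lam E x \<psi> n \<longleftrightarrow> ?W *\<^sub>v \<psi> (n + 1) = ?r"
    unfolding schroedinger_equation_def y B
    by (rule vec_rearrange[of _ d]) (auto intro!: carrier_vecI)
  also have "\<dots> \<longleftrightarrow> \<psi> (n + 1) = V *\<^sub>v ?r"
  proof
    assume "?W *\<^sub>v \<psi> (n + 1) = ?r"
    hence "V *\<^sub>v ?r = (V * ?W) *\<^sub>v \<psi> (n + 1)"
      using assoc_mult_mat_vec[OF Vc W \<psi>] by simp
    thus "\<psi> (n + 1) = V *\<^sub>v ?r" using Vi \<psi> by simp
  next
    assume "\<psi> (n + 1) = V *\<^sub>v ?r"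
    thus "?W *\<^sub>v \<psi> (n + 1) = ?r"
      using assoc_mult_mat_vec[OF W[of "?y + \<omega>"] Vc rc, unfolded Vi one_mult_mat_vec[OF rc]]
      by simp
  qed
  also have "V *\<^sub>v ?r = (V * ?B) *\<^sub>v \<psi> n + (- (V * ?T)) *\<^sub>v \<psi> (n - 1)"
  proof -
    have "V *\<^sub>v ?r = V *\<^sub>v (?B *\<^sub>v \<psi> n) - V *\<^sub>v (?T *\<^sub>v \<psi> (n - 1))"
      by (rule mult_minus_distrib_mat_vec[OF Vc mult_mat_vec_carrier[OF Bc \<psi>]
            mult_mat_vec_carrier[OF Tc \<psi>]])
    also have "V *\<^sub>v (?B *\<^sub>v \<psi> n) = (V * ?B) *\<^sub>v \<psi> n"
      by (rule assoc_mult_mat_vec[OF Vc Bc \<psi>, symmetric])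
    also have "V *\<^sub>v (?T *\<^sub>v \<psi> (n - 1)) = (V * ?T) *\<^sub>v \<psi> (n - 1)"
      by (rule assoc_mult_mat_vec[OF Vc Tc \<psi>, symmetric])
    also have "(V * ?B) *\<^sub>v \<psi> n - (V * ?T) *\<^sub>v \<psi> (n - 1) =
        (V * ?B) *\<^sub>v \<psi> n + - ((V * ?T) *\<^sub>v \<psi> (n - 1))"
      using mult_mat_vec_carrier[OF mult_carrier_mat[OF Vc Bc] \<psi>]
        mult_mat_vec_carrier[OF mult_carrier_mat[OF Vc Tc] \<psi>]
      by (rule minus_add_uminus_vec)
    also have "- ((V * ?T) *\<^sub>v \<psi> (n - 1)) = (- (V * ?T)) *\<^sub>v \<psi> (n - 1)"
      by (rule uminus_mult_mat_vec[symmetric]) simp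
    finally show ?thesis .
  qed
  also have "\<psi> (n + 1) = (V * ?B) *\<^sub>v \<psi> n + (- (V * ?T)) *\<^sub>v \<psi> (n - 1) \<longleftrightarrow>
    \<psi> (n + 1) @\<^sub>v \<psi> n =
      schroedinger_cocycle d \<omega> W R D lam E ?y *\<^sub>v (\<psi> n @\<^sub>v \<psi> (n - 1))"
  proof -
    have "schroedinger_cocycle d \<omega> W R D lam E ?y *\<^sub>v (\<psi> n @\<^sub>v \<psi> (n - 1)) =
      ((V * ?B) *\<^sub>v \<psi> n + (- (V * ?T)) *\<^sub>v \<psi> (n - 1)) @\<^sub>v
      (1\<^sub>m d *\<^sub>v \<psi> n + 0\<^sub>m d d *\<^sub>v \<psi> (n - 1))"
      unfolding schroedinger_cocycle_def Let_def V option.sel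
      by (rule four_block_mat_mult_vec[OF mult_carrier_mat[OF Vc Bc]
            uminus_carrier_mat[OF mult_carrier_mat[OF Vc Tc]] one_carrier_mat zero_carrier_mat \<psi> \<psi>])
    moreover have "1\<^sub>m d *\<^sub>v \<psi> n + 0\<^sub>m d d *\<^sub>v \<psi> (n - 1) = \<psi> n"
    proof -
      have "0\<^sub>m d d *\<^sub>v \<psi> (n - 1) = 0\<^sub>v d"
        using \<psi>[of "n - 1"] by (intro eq_vecI) auto
      thus ?thesis using \<psi> by simp
    qed
    moreover have "(V * ?B) *\<^sub>v \<psi> n + (- (V * ?T)) *\<^sub>v \<psi> (n - 1) \<in> carrier_vec d"
      using Vc by (auto intro!: carrier_vecI)
    ultimately show ?thesis using append_vec_eq[OF \<psi>] by metis
  qed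
  finally show ?thesis .
qed

end

theory Submission
  imports Defs
    "HOL-Analysis.Kronecker_Approximation_Theorem"
    "HOL-Complex_Analysis.Conformal_Mappings"
    "Jordan_Normal_Form.Schur_Decomposition"
begin

text \<open>
  Multiplying the cocycle by \<open>det W(x + \<omega>)\<close> gives a continuous cocycle \<open>B\<close> that extends
  holomorphically to the annulus. For a continuous submultiplicative process over an irrational
  rotation the exponential growth rate is almost everywhere equal to the growth rate of the
  supremum over the circle (unique ergodicity, and the covering argument of Katznelson and Weiss
  with open sets); applied to the norms of the compound matrices of \<open>B\<close> and to the products of
  \<open>det W\<close> this yields the existence of all Lyapunov exponents.

  Growth rates of suprema can be estimated by the three circles theorem. Since \<open>D\<close> has no constant
  eigenvalue, compactness gives, uniformly in \<open>E / \<lambda>\<close>, a circle of radius \<open>r > 1\<close> on which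
  \<open>\<lambda> D - E\<close> is uniformly invertible at scale \<open>\<Lambda> = sqrt (\<lambda>\<^sup>2 + E\<^sup>2)\<close>. There the upper left
  \<open>d\<close> by \<open>d\<close> block of the \<open>n\<close>-th iterate expands by \<open>c \<Lambda>\<close> at every step, so its determinant is at
  least \<open>(c \<Lambda>)\<close> to the power \<open>n d\<close>, whereas on a larger circle it is at most \<open>(C \<Lambda>)\<close> to the power
  \<open>n d\<close>; the powers of \<open>\<Lambda>\<close> cancel in the three circles inequality and bound the sum of the first
  \<open>d\<close> exponents from below by \<open>d ln \<Lambda> - C\<close>. The sum of the first \<open>d - 1\<close> exponents is at most
  \<open>(d - 1) (ln \<Lambda> + C)\<close>, which leaves \<open>ln \<Lambda> - C\<close> for the \<open>d\<close>-th one.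

  The symmetry of the exponents comes from the symplectic form with blocks \<open>0, -W\<^sup>T, W, 0\<close>, which
  the cocycle carries from \<open>x\<close> to \<open>x + \<omega>\<close>.
\<close>

section \<open>Uniform visits of irrational rotations\<close>

text \<open>The three circles theorem only produces a large value at some point of the unit circle;
  this is why all rates are rates of suprema, which the almost everywhere theorem then turns into
  exponents. Rotations preserve circles about the origin, so every estimate is uniform in the unit
  number \<open>u\<close>, and the constants do not see the frequency. As \<open>E\<close> is
  unbounded, \<open>lam\<close> D - \<open>E\<close> is divided by \<Lambda> and becomes a D + b
  with (a, b) on the unit circle; this compact set also contains a = 0, the case of infinite E /
  \<open>lam\<close>. The obstacle is that det W may vanish, so that a rate could be minus infinity.
  For the products of det W three circles excludes this; for the compounds of every order k the
  symplectic form does, since the inverse of an iterate is bounded by a multiple of the iterate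
  itself, which therefore cannot be small. Removing the scalar det W subtracts k times its rate from
  the sum of the first k exponents; consecutive sums differ by one such rate, for which an upper
  bound suffices.\<close>

definition circle_measure :: "real set \<Rightarrow> real" where
  "circle_measure S = measure lborel (S \<inter> {0..<1})"

lemma measure_lborel_vimage_plus:
  fixes A :: "real set"
  assumes "A \<in> sets borel"
  shows "measure lborel {x. x + t \<in> A} = measure lborel A"
proof -
  have "measure lborel A = measure (distr lborel borel ((+) t)) A"
    by (simp only: lborel_distr_plus)
  also have "\<dots> = measure lborel ((+) t -` A \<inter> space lborel)"
    using assms by (intro measure_distr) auto
  also have "(+) t -` A \<inter> space lborel = {x. x + t \<in> A}"
    by (auto simp: add.commute)
  finally show ?thesis by simp
qed

lemma periodic_add_int:
  fixes f :: "real \<Rightarrow> 'a"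
  assumes "\<And>x. f (x + 1) = f x"
  shows "f (x + of_int k) = f x"
proof -
  have n: "f (y + real m) = f y" for y m
  proof (induction m)
    case (Suc m)
    have "f (y + real (Suc m)) = f ((y + real m) + 1)" by (simp add: algebra_simps)
    thus ?case using Suc assms by metis
  qed simp
  show ?thesis
  proof (cases "k \<ge> 0")
    case True
    thus ?thesis using n[of x "nat k"] by simp
  next
    case False
    thus ?thesis using n[of "x + of_int k" "nat (- k)"] by simp
  qed
qed

lemma borel_vimage_plus [measurable]:
  fixes A :: "real set"
  assumes "A \<in> sets borel"
  shows "{x. x + t \<in> A} \<in> sets borel"
proof -
  have "(\<lambda>x. x + t) -` A \<inter> space borel \<in> sets borel"
    by (rule measurable_sets[OF _ assms]) simp
  thus ?thesis by (simp add: vimage_def)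
qed

lemma fmeasurable_unit: "S \<in> sets borel \<Longrightarrow> S \<inter> {a..<b::real} \<in> fmeasurable lborel"
proof (rule fmeasurableI2)
  have "emeasure lborel {a..<b} \<le> emeasure lborel {a..b}" by (intro emeasure_mono) auto
  also have "\<dots> < \<infinity>" using emeasure_lborel_cbox_finite[of a b] by simp
  finally show "{a..<b} \<in> fmeasurable lborel" by (intro fmeasurableI) auto
qed auto

lemma measure_less_of_emeasure_less:
  assumes "emeasure M A < ennreal e" "0 < e"
  shows "measure M A < e"
  using assms by (cases "emeasure M A") (auto simp: measure_def ennreal_less_iff)

text \<open>By periodicity only the fractional part \<open>s\<close> of the shift matters; the
  window from s to 1 + s is cut at 1 and the overhang is moved back by one period.\<close>

lemma circle_measure_translate:
  assumes S: "S \<in> sets borel" and per: "\<And>x. x + 1 \<in> S \<longleftrightarrow> x \<in> S"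
  shows "circle_measure {x. x + t \<in> S} = circle_measure S"
proof -
  define s where "s = frac t"
  have s: "0 \<le> s" "s < 1" by (auto simp: s_def frac_lt_1)
  have pS: "x + of_int k \<in> S \<longleftrightarrow> x \<in> S" for x k
    using periodic_add_int[of "\<lambda>x. x \<in> S"] per by blast
  have "x + t \<in> S \<longleftrightarrow> x + s \<in> S" for x
    using pS[of "x + s" "\<lfloor>t\<rfloor>"] by (simp add: s_def frac_def)
  hence "circle_measure {x. x + t \<in> S} = measure lborel {x. x + s \<in> S \<inter> {s..<1+s}}"
    unfolding circle_measure_def by (intro arg_cong[where f="measure lborel"]) auto
  also have "\<dots> = measure lborel (S \<inter> {s..<1+s})"
    using S by (intro measure_lborel_vimage_plus) auto
  also have "S \<inter> {s..<1+s} = S \<inter> {s..<1} \<union> S \<inter> {1..<1+s}" using s by auto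
  also have "measure lborel \<dots> = measure lborel (S \<inter> {s..<1}) + measure lborel (S \<inter> {1..<1+s})"
    by (intro measure_Un_AE AE_I2 fmeasurable_unit S) auto
  also have "measure lborel (S \<inter> {1..<1+s}) = measure lborel {x. x + 1 \<in> S \<inter> {1..<1+s}}"
    using S by (intro measure_lborel_vimage_plus[symmetric]) auto
  also have "{x. x + 1 \<in> S \<inter> {1..<1+s}} = S \<inter> {0..<s}" using per by auto
  also have "measure lborel (S \<inter> {s..<1}) + measure lborel (S \<inter> {0..<s}) =
      measure lborel (S \<inter> {s..<1} \<union> S \<inter> {0..<s})"
    by (intro measure_Un_AE[symmetric] AE_I2 fmeasurable_unit S) auto
  also have "S \<inter> {s..<1} \<union> S \<inter> {0..<s} = S \<inter> {0..<1}" using s by auto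
  finally show ?thesis by (simp add: circle_measure_def)
qed

definition visits :: "real \<Rightarrow> real set \<Rightarrow> real \<Rightarrow> nat \<Rightarrow> nat" where
  "visits \<omega> P x n = card {j. j < n \<and> x + real j * \<omega> \<in> P}"

lemma visits_eq_sum: "real (visits \<omega> P x n) = (\<Sum>j<n. indicat_real {y. y + real j * \<omega> \<in> P} x)"
proof -
  have "(\<Sum>j<n. indicat_real {y. y + real j * \<omega> \<in> P} x) =
      (\<Sum>j\<in>{..<n}. if x + real j * \<omega> \<in> P then 1 else 0)"
    by (intro sum.cong) (auto simp: indicator_def)
  also have "\<dots> = real (card ({..<n} \<inter> {j. x + real j * \<omega> \<in> P}))"
    by (subst sum.inter_filter[symmetric]) (auto simp: Int_def)
  finally show ?thesis unfolding visits_def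
    by (simp add: Int_def)
qed

lemma visits_integral:
  assumes P: "P \<in> sets borel" and per: "\<And>x. x + 1 \<in> P \<longleftrightarrow> x \<in> P"
  shows "integrable lborel (\<lambda>x. indicat_real {0..<1} x * real (visits \<omega> P x n))"
    and "(LINT x|lborel. indicat_real {0..<1} x * real (visits \<omega> P x n)) = real n * circle_measure P"
proof -
  let ?A = "\<lambda>j. {y. y + real j * \<omega> \<in> P} \<inter> {0..<1}"
  have eq: "indicat_real {0..<1} x * real (visits \<omega> P x n) = (\<Sum>j<n. indicat_real (?A j) x)" for x
    unfolding visits_eq_sum sum_distrib_left
    by (intro sum.cong) (auto simp: indicator_def)
  have A: "?A j \<in> fmeasurable lborel" for j
    by (intro fmeasurable_unit borel_vimage_plus P)
  have int: "integrable lborel (indicat_real (?A j))" for j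
    using A[of j] by (auto simp: fmeasurable_def)
  show "integrable lborel (\<lambda>x. indicat_real {0..<1} x * real (visits \<omega> P x n))"
    unfolding eq using int by auto
  have "(LINT x|lborel. indicat_real {0..<1} x * real (visits \<omega> P x n)) = (\<Sum>j<n. measure lborel (?A j))"
    unfolding eq by (subst Bochner_Integration.integral_sum[OF int]) simp
  also have "\<dots> = (\<Sum>j<n. circle_measure P)"
    using circle_measure_translate[OF P per] by (simp add: circle_measure_def)
  finally show "(LINT x|lborel. indicat_real {0..<1} x * real (visits \<omega> P x n)) =
      real n * circle_measure P" by simp
qed

text \<open>The integral of the visit count over the circle is
  \<open>real n * circle_measure P\<close>, so the count cannot stay below that value everywhere.
  The slack 1 avoids the case of equality in the comparison of integrals.\<close>

lemma exists_visits_ge: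
  assumes P: "P \<in> sets borel" and per: "\<And>x. x + 1 \<in> P \<longleftrightarrow> x \<in> P"
  shows "\<exists>x. real (visits \<omega> P x n) \<ge> real n * circle_measure P - 1"
proof (rule ccontr)
  let ?c = "real n * circle_measure P - 1"
  assume "\<not> ?thesis"
  hence lt: "real (visits \<omega> P x n) \<le> ?c" for x by (auto simp: not_le less_imp_le)
  have "(LINT x|lborel. indicat_real {0..<1} x * real (visits \<omega> P x n)) \<le>
      (LINT x|lborel. indicat_real {0..<1::real} x * ?c)"
    by (intro integral_mono visits_integral(1)[OF P per] mult_left_mono lt) auto
  also have "\<dots> = ?c"
    by (simp add: measure_def)
  finally show False using visits_integral(2)[OF P per] by simp
qed

text \<open>Density of one forward orbit, made uniform in \<open>t\<close>: it suffices to come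
  close to the finitely many grid points - i / m, and \<open>J\<close> is the largest time needed
  for one of them.\<close>

lemma kronecker_uniform:
  fixes \<omega> :: real
  assumes "\<omega> \<notin> \<rat>" "0 < \<eta>"
  shows "\<exists>J::nat. \<forall>t. \<exists>k\<le>J. \<exists>p::int. \<bar>t + real k * \<omega> - of_int p\<bar> < \<eta>"
proof -
  obtain m :: nat where m: "m > 0" "1 / real m < \<eta> / 2"
    using \<open>0 < \<eta>\<close> by (metis half_gt_zero nat_approx_posE zero_less_Suc)
  have "\<exists>k::nat. \<exists>p::int. \<bar>real k * \<omega> - of_int p + real i / real m\<bar> < \<eta> / 2" for i :: nat
  proof -
    obtain h k where "k > 0" "\<bar>of_int k * \<omega> - of_int h - (- (real i / real m))\<bar> < \<eta> / 2"
      using sequence_of_fractional_parts_is_dense[OF assms(1), of "\<eta>/2"] assms(2)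
      by (metis half_gt_zero)
    thus ?thesis by (intro exI[of _ "nat k"] exI[of _ h]) auto
  qed
  then obtain K P where KP: "\<And>i. \<bar>real (K i) * \<omega> - of_int (P i) + real i / real m\<bar> < \<eta> / 2"
    by metis
  define J where "J = Max (K ` {..m})"
  have "\<exists>k\<le>J. \<exists>p::int. \<bar>t + real k * \<omega> - of_int p\<bar> < \<eta>" for t
  proof -
    define i where "i = nat \<lfloor>frac t * m\<rfloor>"
    have fr: "0 \<le> frac t" "frac t < 1" by (auto simp: frac_lt_1)
    have nn: "0 \<le> frac t * m" using fr by simp
    have i1: "real i \<le> frac t * m" "frac t * m < real i + 1"
      using nn by (auto simp: i_def of_nat_nat le_nat_floor) 
    have "frac t * m < m" using fr m by simp
    hence "i \<le> m" using i1 by linarith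
    have "\<bar>frac t - real i / real m\<bar> \<le> 1 / real m"
    proof -
      have "frac t - real i / real m = (frac t * m - real i) / m" using m by (simp add: field_simps)
      also have "\<bar>\<dots>\<bar> = \<bar>frac t * m - real i\<bar> / m" by simp
      also have "\<dots> \<le> 1 / m" using i1 by (intro divide_right_mono) auto
      finally show ?thesis .
    qed
    hence "\<bar>frac t + real (K i) * \<omega> - of_int (P i)\<bar> < \<eta>"
      using KP[of i] m(2) by linarith
    hence "\<bar>t + real (K i) * \<omega> - of_int (P i + \<lfloor>t\<rfloor>)\<bar> < \<eta>"
      by (simp add: frac_def algebra_simps)
    moreover have "K i \<le> J" using \<open>i \<le> m\<close> by (auto simp: J_def intro!: Max_ge)
    ultimately show ?thesis by blast
  qed
  thus ?thesis by blast
qed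

text \<open>Approximating sets are found inside one period; this spreads them over the line, where
  visits are counted.\<close>

definition periodization :: "real set \<Rightarrow> real set" where
  "periodization A = (\<Union>p::int. {x. x + of_int p \<in> A})"

lemma periodization_periodic: "x + 1 \<in> periodization A \<longleftrightarrow> x \<in> periodization A"
proof
  assume "x + 1 \<in> periodization A"
  then obtain p where "x + of_int (p + 1) \<in> A" by (auto simp: periodization_def algebra_simps)
  thus "x \<in> periodization A" unfolding periodization_def by blast
next
  assume "x \<in> periodization A"
  then obtain p where "x + 1 + of_int (p - 1) \<in> A" by (auto simp: periodization_def algebra_simps)
  thus "x + 1 \<in> periodization A" unfolding periodization_def by blast
qed

lemma periodization_Int_unit:
  assumes "A \<subseteq> {0..<1}"
  shows "periodization A \<inter> {0..<1} = A"
proof -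
  have "p = 0" if "0 \<le> x" "x < 1" "0 \<le> x + real_of_int p" "x + real_of_int p < 1" for x p
    using that by linarith
  thus ?thesis using assms by (fastforce simp: periodization_def intro: exI[of _ 0])
qed

lemma borel_periodization: "A \<in> sets borel \<Longrightarrow> periodization A \<in> sets borel"
  unfolding periodization_def by (intro sets.countable_UN) auto

lemma open_periodization:
  assumes "open A" shows "open (periodization A)"
proof -
  have "open ((\<lambda>x. x + of_int p) -` A)" for p :: int
    by (intro open_vimage assms continuous_intros)
  thus ?thesis unfolding periodization_def vimage_def by blast
qed

text \<open>Averaging provides one point \<open>x\<close> with many visits to a compact part of
  \<open>U\<close>. Every orbit comes \<eta>-close to \<open>x\<close> within \<open>J\<close>
  steps, up to integers, and from then on shadows its visits, because the \<eta>-neighbourhood of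
  the compact set stays in \<open>U\<close>.\<close>

lemma uniform_visits:
  assumes \<omega>: "\<omega> \<notin> \<rat>" and U: "open U" and per: "\<And>x. x + 1 \<in> U \<longleftrightarrow> x \<in> U"
    and q: "q < circle_measure U"
  shows "\<exists>J::nat. \<forall>y n. real (visits \<omega> U y n) \<ge> q * real n - real J"
proof -
  let ?S = "U \<inter> {0..<1}"
  have Sb: "?S \<in> sets borel" using U by auto
  have "?S \<in> sets lebesgue" using Sb by auto
  moreover have "0 < circle_measure U - q" using q by simp
  ultimately obtain K0 where K0: "closed K0" "K0 \<subseteq> ?S" "?S - K0 \<in> lmeasurable"
      "emeasure lebesgue (?S - K0) < ennreal (circle_measure U - q)"
    by (rule sets_lebesgue_inner_closed)
  have "compact K0" using K0 by (auto simp: compact_eq_bounded_closed intro: bounded_subset[of "{0..<1}"])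
  then obtain \<eta> where \<eta>: "0 < \<eta>" "(\<Union>x\<in>K0. ball x \<eta>) \<subseteq> U"
    using compact_subset_open_imp_ball_epsilon_subset[of K0 U] U K0 by blast
  have K0b: "K0 \<in> sets borel" using K0 by auto
  have "emeasure lborel (?S - K0) < ennreal (circle_measure U - q)"
    using K0(4) Sb K0b by simp
  hence "measure lborel (?S - K0) < circle_measure U - q"
    using q by (intro measure_less_of_emeasure_less) auto
  moreover have "measure lborel (?S - K0) = circle_measure U - measure lborel K0"
    unfolding circle_measure_def using K0b K0(2)
    using fmeasurable_unit[THEN fmeasurableD2, OF borel_open[OF U]] Sb by (intro measure_Diff) auto
  ultimately have K0q: "q < measure lborel K0" by simp
  define K where "K = periodization K0"
  have KB: "K \<in> sets borel" and Kp: "\<And>x. x + 1 \<in> K \<longleftrightarrow> x \<in> K"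
    unfolding K_def by (auto intro!: borel_periodization K0b simp: periodization_periodic)
  have cK: "circle_measure K = measure lborel K0"
    unfolding circle_measure_def K_def using K0(2) by (subst periodization_Int_unit) auto
  have pU: "x + of_int k \<in> U \<longleftrightarrow> x \<in> U" for x k
    using periodic_add_int[of "\<lambda>x. x \<in> U"] per by blast
  obtain J :: nat where J: "\<And>t. \<exists>k\<le>J. \<exists>p::int. \<bar>t + real k * \<omega> - of_int p\<bar> < \<eta>"
    using kronecker_uniform[OF \<omega> \<eta>(1)] by blast
  have "real (visits \<omega> U y n) \<ge> q * real n - real (J + 1)" for y n
  proof -
    obtain x where x: "real (visits \<omega> K x n) \<ge> real n * circle_measure K - 1"
      using exists_visits_ge[OF KB Kp] by blast
    obtain k p where k: "k \<le> J" and p: "\<bar>(y - x) + real k * \<omega> - of_int p\<bar> < \<eta>"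
      using J by blast
    have imp: "y + real (k + j) * \<omega> \<in> U" if xK: "x + real j * \<omega> \<in> K" for j
    proof -
      obtain p' where p': "x + real j * \<omega> + of_int p' \<in> K0"
        using xK unfolding K_def periodization_def by auto
      have "dist (x + real j * \<omega> + of_int p') (y + real (k + j) * \<omega> + of_int (p' - p)) < \<eta>"
        using p by (simp add: dist_real_def algebra_simps abs_minus_commute)
      hence "y + real (k + j) * \<omega> + of_int (p' - p) \<in> U" using \<eta>(2) p' by (auto simp: subset_iff)
      thus ?thesis by (simp only: pU)
    qed
    \<comment> \<open>The delay \<open>k\<close> maps visits of \<open>x\<close> injectively to
      visits of \<open>y\<close>; at most \<open>k\<close> of them are pushed beyond time
      \<open>n\<close>.\<close>
    have "visits \<omega> K x n \<le> card ({j. j < n \<and> y + real j * \<omega> \<in> U} \<union> {n..<n+k})"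
      unfolding visits_def
    proof (rule card_inj_on_le[where f = "(+) k"])
      show "(+) k ` {j. j < n \<and> x + real j * \<omega> \<in> K} \<subseteq> {j. j < n \<and> y + real j * \<omega> \<in> U} \<union> {n..<n + k}"
        using imp by (auto simp del: of_nat_add)
    qed auto
    also have "\<dots> \<le> visits \<omega> U y n + k"
      unfolding visits_def by (rule card_Un_le[THEN order_trans]) simp
    finally have "real (visits \<omega> K x n) \<le> real (visits \<omega> U y n) + real J" using k by linarith
    moreover have "q * real n \<le> real n * circle_measure K"
      using mult_right_mono[of q "circle_measure K" "real n"] K0q cK by (simp add: mult.commute)
    ultimately show ?thesis using x by simp
  qed
  thus ?thesis by blast
qed

section \<open>Ergodicity of the rotation\<close>

lemma circle_measure_le_1: "S \<in> sets borel \<Longrightarrow> circle_measure S \<le> 1"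
proof -
  assume "S \<in> sets borel"
  hence "measure lborel (S \<inter> {0..<1}) \<le> measure lborel {0..<1::real}"
    by (intro measure_mono_fmeasurable) (auto intro: fmeasurableI)
  thus ?thesis by (simp add: circle_measure_def)
qed

lemma circle_measure_Compl:
  assumes "S \<in> sets borel"
  shows "circle_measure (- S) = 1 - circle_measure S"
proof -
  have "- S \<inter> {0..<1} = {0..<1} - S \<inter> {0..<1}" by auto
  thus ?thesis unfolding circle_measure_def
    using assms by (simp, subst measure_Diff) (auto simp: emeasure_lborel_Icc_eq)
qed

text \<open>Up to an endpoint, cover the complement of \<open>S\<close> by an open \<open>U\<close>
  that meets \<open>S\<close> in measure less than \<open>e\<close>. Backward orbits of points of
  \<open>S\<close> never leave \<open>S\<close>, but visit \<open>U\<close> with frequency at least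
  \<open>q\<close>; integrating over \<open>S\<close> shows that \<open>U \<inter> S\<close> has
  measure at least \<open>e\<close>.\<close>

lemma rotation_ergodic:
  assumes \<omega>: "\<omega> \<notin> \<rat>" and S: "S \<in> sets borel" and per: "\<And>x. x + 1 \<in> S \<longleftrightarrow> x \<in> S"
    and inv: "\<And>x. x + \<omega> \<in> S \<Longrightarrow> x \<in> S" and pos: "0 < circle_measure S"
  shows "circle_measure S = 1"
proof (rule ccontr)
  assume "circle_measure S \<noteq> 1"
  hence q0: "0 < circle_measure (- S)"
    using circle_measure_le_1[OF S] circle_measure_Compl[OF S] by simp
  define q where "q = circle_measure (- S) / 2"
  have q: "0 < q" "q < circle_measure (- S)" using q0 by (auto simp: q_def)
  define e where "e = q * circle_measure S"
  have e: "0 < e" using q pos by (simp add: e_def)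
  \<comment> \<open>The endpoint 0 is dropped so that the open cover can be kept inside a single
    period.\<close>
  define Q where "Q = (- S) \<inter> {0<..<1}"
  have Qb: "Q \<in> sets borel" using S by (auto simp: Q_def)
  obtain U1 where U1: "open U1" "Q \<subseteq> U1" "emeasure lborel (U1 - Q) < e"
    using outer_regular_lborel[OF Qb e] by blast
  define U0 where "U0 = U1 \<inter> {0<..<1}"
  have U0: "open U0" "U0 \<subseteq> {0..<1}" "Q \<subseteq> U0" using U1 by (auto simp: U0_def Q_def)
  define U where "U = periodization U0"
  have U: "open U" "U \<in> sets borel" and Up: "\<And>x. x + 1 \<in> U \<longleftrightarrow> x \<in> U"
    unfolding U_def using open_periodization[OF U0(1)] by (auto simp: periodization_periodic)
  have U01: "U \<inter> {0..<1} = U0" unfolding U_def by (rule periodization_Int_unit[OF U0(2)])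
  have "circle_measure (- S) \<le> measure lborel (U0 \<union> {0})"
    unfolding circle_measure_def
  proof (rule measure_mono_fmeasurable)
    show "- S \<inter> {0..<1} \<subseteq> U0 \<union> {0}" using U0(3) by (force simp: Q_def)
    show "U0 \<union> {0} \<in> fmeasurable lborel"
      by (rule fmeasurableI2[of "{0..<1}"]) (use U0 in \<open>auto intro: fmeasurableI\<close>)
  qed (use S in auto)
  also have "\<dots> \<le> measure lborel U0 + measure lborel {0::real}"
    using U0 by (intro measure_Un_le) auto
  finally have cU: "q < circle_measure U" using q U01 by (simp add: circle_measure_def)
  \<comment> \<open>The invariance of \<open>S\<close> runs backwards, hence visits are counted for
    the opposite rotation.\<close>
  have "- \<omega> \<notin> \<rat>" using \<omega> by simp
  from uniform_visits[OF this U(1) Up cU]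
  obtain J :: nat where J: "\<And>y n. real (visits (-\<omega>) U y n) \<ge> q * real n - real J" by blast
  have backw: "y - real j * \<omega> \<in> S" if "y \<in> S" for y j
  proof (induction j)
    case (Suc j)
    have "(y - real (Suc j) * \<omega>) + \<omega> \<in> S" using Suc by (simp add: algebra_simps)
    thus ?case by (rule inv)
  qed (use that in simp)
  have USb: "U \<inter> S \<in> sets borel" and USp: "\<And>x. x + 1 \<in> U \<inter> S \<longleftrightarrow> x \<in> U \<inter> S"
    using U S Up per by auto
  have le: "real n * circle_measure (U \<inter> S) \<ge> (q * real n - real J) * circle_measure S" for n
  proof -
    have "indicat_real (S \<inter> {0..<1}) x * (q * real n - real J) \<le>
        indicat_real {0..<1} x * real (visits (-\<omega>) (U \<inter> S) x n)" for x
    proof (cases "x \<in> S \<inter> {0..<1}")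
      case True
      hence "visits (-\<omega>) (U \<inter> S) x n = visits (-\<omega>) U x n"
        unfolding visits_def using backw[of x] by (intro arg_cong[where f=card]) auto
      thus ?thesis using J[where y=x and n=n] True by (simp add: indicator_def)
    qed (auto simp: indicator_def)
    moreover have "S \<inter> {0..<1} \<in> fmeasurable lborel" by (rule fmeasurable_unit[OF S])
    ultimately have "(LINT x|lborel. indicat_real (S \<inter> {0..<1}) x * (q * real n - real J)) \<le>
        (LINT x|lborel. indicat_real {0..<1} x * real (visits (-\<omega>) (U \<inter> S) x n))"
      using fmeasurableD2[of "S \<inter> {0..<1}" lborel] S
      by (intro integral_mono visits_integral(1)[OF USb USp])
         (auto simp: less_top)
    thus ?thesis unfolding visits_integral(2)[OF USb USp]
      by (simp add: circle_measure_def mult.commute)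
  qed
  have lim: "q * circle_measure S \<le> circle_measure (U \<inter> S)"
  proof (rule ccontr)
    assume "\<not> ?thesis"
    hence d: "0 < q * circle_measure S - circle_measure (U \<inter> S)" by simp
    obtain n :: nat where "real J * circle_measure S < real n * (q * circle_measure S - circle_measure (U \<inter> S))"
      using reals_Archimedean3[OF d] by blast
    thus False using le[of n] by (simp add: algebra_simps)
  qed
  have "circle_measure (U \<inter> S) = measure lborel (U0 - Q)"
  proof -
    have "U \<inter> S \<inter> {0..<1} = U0 - Q" using U01 by (auto simp: Q_def U0_def)
    thus ?thesis by (simp add: circle_measure_def)
  qed
  also have "\<dots> < e"
  proof -
    have "emeasure lborel (U0 - Q) \<le> emeasure lborel (U1 - Q)"
      using U1 Qb by (intro emeasure_mono) (auto simp: U0_def)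
    hence "emeasure lborel (U0 - Q) < e" using U1(3) by simp
    thus ?thesis using e
      by (intro measure_less_of_emeasure_less)
  qed
  finally show False using lim by (simp add: e_def)
qed

lemma circle_measure_mono:
  assumes "A \<subseteq> B" "A \<in> sets borel" "B \<in> sets borel"
  shows "circle_measure A \<le> circle_measure B"
  unfolding circle_measure_def using assms
  by (intro measure_mono_fmeasurable fmeasurable_unit) auto

lemma circle_measure_UN_incseq:
  assumes A: "\<And>n. A n \<in> sets borel" and inc: "incseq A"
  shows "(\<lambda>n. circle_measure (A n)) \<longlonglongrightarrow> circle_measure (\<Union>n. A n)"
proof -
  have "(\<lambda>n. measure lborel (A n \<inter> {0..<1})) \<longlonglongrightarrow> measure lborel (\<Union>n. A n \<inter> {0..<1})"
  proof (rule Lim_measure_incseq)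
    show "incseq (\<lambda>n. A n \<inter> {0..<1})" using inc by (auto simp: incseq_def)
    have "(\<Union>n. A n \<inter> {0..<1}) = (\<Union>n. A n) \<inter> {0..<1}" by auto
    thus "emeasure lborel (\<Union>n. A n \<inter> {0..<1}) \<noteq> \<infinity>"
      using fmeasurableD2[OF fmeasurable_unit[of "\<Union>n. A n"]] A by auto
  qed (use A in auto)
  moreover have "(\<Union>n. A n \<inter> {0..<1}) = (\<Union>n. A n) \<inter> {0..<1}" by auto
  ultimately show ?thesis by (simp add: circle_measure_def)
qed

text \<open>The covering argument of Katznelson and Weiss: an orbit segment is cut into blocks on which
  \<open>g\<close> is small, plus the steps at which the orbit is outside \<open>V\<close>.\<close>

lemma covering_bound:
  fixes g :: "nat \<Rightarrow> real \<Rightarrow> real"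
  assumes sub: "\<And>m n x. g (m + n) x \<le> g n (x + real m * \<omega>) * g m x"
    and nn: "\<And>n x. 0 \<le> g n x" and up: "\<And>n x. g n x \<le> exp (b * real n)"
    and V: "\<And>x. x \<in> V \<Longrightarrow> \<exists>m\<ge>1. m \<le> N \<and> g m x \<le> exp (a * real m)" and ab: "a \<le> b"
  shows "g n y \<le> exp (a * real n + (b - a) * (real (n - visits \<omega> V y n) + real N))"
proof (induction n arbitrary: y rule: less_induct)
  case (less n)
  define bad where "bad n y = n - visits \<omega> V y n" for n y
  have bad_card: "bad n y = card {j. j < n \<and> y + real j * \<omega> \<notin> V}" for n y
  proof -
    have "card {..<n} = card ({j. j < n \<and> y + real j * \<omega> \<in> V} \<union> {j. j < n \<and> y + real j * \<omega> \<notin> V})"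
      by (rule arg_cong[where f=card]) auto
    also have "\<dots> = visits \<omega> V y n + card {j. j < n \<and> y + real j * \<omega> \<notin> V}"
      unfolding visits_def by (rule card_Un_disjoint) auto
    finally show ?thesis unfolding bad_def by simp
  qed
  have shift: "card ((+) m ` {j. j < n - m \<and> (y + real m * \<omega>) + real j * \<omega> \<notin> V}) = bad (n - m) (y + real m * \<omega>)"
    for m unfolding bad_card by (rule card_image) auto
  have bad_m: "bad (n - m) (y + real m * \<omega>) \<le> bad n y" for m
    unfolding shift[symmetric] bad_card[of n]
  proof (rule card_mono)
    have "(y + real (m + j) * \<omega> \<in> V) = ((y + real m * \<omega>) + real j * \<omega> \<in> V)" for j
      by (rule arg_cong[where f="\<lambda>x. x \<in> V"]) (simp add: algebra_simps)
    thus "(+) m ` {j. j < n - m \<and> (y + real m * \<omega>) + real j * \<omega> \<notin> V} \<subseteq> {j. j < n \<and> y + real j * \<omega> \<notin> V}"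
      by (auto simp del: of_nat_add)
  qed simp
  have step: "g n y \<le> g (n - m) (y + real m * \<omega>) * g m y" if "m \<le> n" for m
    using sub[of m "n - m" y] that by simp
  \<comment> \<open>The last fewer than \<open>N\<close> steps are paid for by the constant term.
    From a point of \<open>V\<close> a whole block is taken at rate \<open>a\<close>; a single step
    from outside \<open>V\<close> costs \<open>b\<close> and uses up one bad time.\<close>
  show ?case unfolding bad_def[symmetric]
  proof (cases "n < N")
    case True
    have "b * real n \<le> a * real n + (b - a) * (real (bad n y) + real N)"
    proof -
      have "(b - a) * real n \<le> (b - a) * (real (bad n y) + real N)"
        using True ab by (intro mult_left_mono) auto
      thus ?thesis by (simp add: algebra_simps)
    qed
    thus "g n y \<le> exp (a * real n + (b - a) * (real (bad n y) + real N))"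
      using up[of n y] by (meson exp_le_cancel_iff order_trans)
  next
    case False
    show "g n y \<le> exp (a * real n + (b - a) * (real (bad n y) + real N))"
    proof (cases "y \<in> V")
      case True
      then obtain m where m: "1 \<le> m" "m \<le> N" "g m y \<le> exp (a * real m)" using V by blast
      have "g n y \<le> g (n - m) (y + real m * \<omega>) * g m y" using step m False by simp
      also have "\<dots> \<le> exp (a * real (n - m) + (b - a) * (real (bad (n - m) (y + real m * \<omega>)) + real N))
          * exp (a * real m)"
        using less.IH[of "n - m" "y + real m * \<omega>"] m False nn
        by (intro mult_mono) (auto simp: bad_def)
      also have "\<dots> \<le> exp (a * real (n - m) + (b - a) * (real (bad n y) + real N)) * exp (a * real m)"
        using ab bad_m[of m] by (intro mult_right_mono) (simp_all add: mult_left_mono)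
      also have "\<dots> = exp (a * real n + (b - a) * (real (bad n y) + real N))"
      proof -
        have "real (n - m) = real n - real m" using m False by simp
        thus ?thesis by (simp only: exp_add[symmetric]) (simp add: algebra_simps)
      qed
      finally show ?thesis .
    next
      case yV: False
      show ?thesis
      proof (cases "n = 0")
        case True
        have "g 0 y \<le> exp 0" using up[of 0 y] by simp
        also have "exp 0 \<le> exp ((b - a) * (real (bad 0 y) + real N))" using ab by simp
        finally show ?thesis using True by simp
      next
        case n0: False
        have bad1: "bad (n - 1) (y + \<omega>) + 1 \<le> bad n y"
        proof -
          have "card (insert 0 ((+) 1 ` {j. j < n - 1 \<and> (y + real 1 * \<omega>) + real j * \<omega> \<notin> V})) \<le> bad n y"
            unfolding bad_card
          proof (rule card_mono)
            have "(y + real (1 + j) * \<omega> \<in> V) = ((y + real 1 * \<omega>) + real j * \<omega> \<in> V)" for j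
              by (rule arg_cong[where f="\<lambda>x. x \<in> V"]) (simp add: algebra_simps)
            thus "insert 0 ((+) 1 ` {j. j < n - 1 \<and> (y + real 1 * \<omega>) + real j * \<omega> \<notin> V})
                \<subseteq> {j. j < n \<and> y + real j * \<omega> \<notin> V}"
              using yV n0 by (auto simp del: of_nat_add of_nat_Suc)
          qed simp
          moreover have "card (insert 0 ((+) 1 ` {j. j < n - 1 \<and> (y + real 1 * \<omega>) + real j * \<omega> \<notin> V})) =
              Suc (bad (n - 1) (y + real 1 * \<omega>))"
            unfolding shift[symmetric] by (rule card_insert_disjoint) auto
          ultimately show ?thesis by simp
        qed
        have "g n y \<le> g (n - 1) (y + \<omega>) * g 1 y" using step[of 1] n0 by simp
        also have "\<dots> \<le> exp (a * real (n - 1) + (b - a) * (real (bad (n - 1) (y + \<omega>)) + real N)) * exp b"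
          using less.IH[of "n - 1" "y + \<omega>"] n0 nn up[of 1 y]
          by (intro mult_mono) (auto simp: bad_def)
        also have "\<dots> = exp (a * real n + (b - a) * (real (bad (n - 1) (y + \<omega>) + 1) + real N))"
        proof -
          have "real (n - 1) = real n - 1" using n0 by simp
          thus ?thesis by (simp only: exp_add[symmetric]) (simp add: algebra_simps)
        qed
        also have "\<dots> \<le> exp (a * real n + (b - a) * (real (bad n y) + real N))"
          using ab bad1 by (simp add: mult_left_mono)
        finally show ?thesis .
      qed
    qed
  qed
qed

section \<open>Subadditive processes over an irrational rotation\<close>

text \<open>The process is kept multiplicative because \<open>g\<close> may vanish, so that its
  logarithm would not be continuous. The last assumption keeps the rate of the suprema away from
  minus infinity.\<close>

locale rotation_process =
  fixes \<omega> :: real and g :: "nat \<Rightarrow> real \<Rightarrow> real"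
  assumes irrational: "\<omega> \<notin> \<rat>"
    and cont: "\<And>n. continuous_on UNIV (g n)"
    and periodic: "\<And>n x. g n (x + 1) = g n x"
    and nonneg: "\<And>n x. 0 \<le> g n x"
    and g_0: "\<And>x. g 0 x = 1"
    and submult: "\<And>m n x. g (m + n) x \<le> g n (x + real m * \<omega>) * g m x"
    and not_superexp: "\<exists>c K. 0 < K \<and> (\<exists>\<^sub>F n in sequentially. \<exists>x. K * exp (c * real n) \<le> g n x)"
begin

definition rates :: "real set" where
  "rates = {l. \<forall>\<^sub>F n in sequentially. \<forall>x. g n x \<le> exp (l * real n)}"

text \<open>This is the limsup of the logarithm of the supremum of \<open>g n\<close>, divided by
  n.\<close>

definition growth :: real where
  "growth = Inf rates"

lemma exp_bound: "\<exists>b. \<forall>n x. g n x \<le> exp (b * real n)"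
proof -
  have "compact (g 1 ` {0..1})"
    using cont[of 1] by (intro compact_continuous_image) (auto intro: continuous_on_subset)
  then obtain C where C: "\<And>y. y \<in> {0..1} \<Longrightarrow> g 1 y \<le> C"
    by (meson bounded_imp_bdd_above bdd_above.E compact_imp_bounded imageI)
  define b where "b = ln (max C 1)"
  have 1: "g 1 x \<le> exp b" for x
  proof -
    have "g 1 x = g 1 (frac x)"
      using periodic_add_int[of "g 1" "frac x" "\<lfloor>x\<rfloor>"] periodic by (simp add: frac_def)
    also have "\<dots> \<le> C" by (rule C) (auto simp: frac_lt_1 less_imp_le)
    also have "\<dots> \<le> exp b" by (simp add: b_def)
    finally show ?thesis .
  qed
  have "g n x \<le> exp (b * real n)" for n x
  proof (induction n arbitrary: x)
    case (Suc n)
    have "g (Suc n) x \<le> g n (x + \<omega>) * g 1 x" using submult[of 1 n x] by simp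
    also have "\<dots> \<le> exp (b * real n) * exp b" by (intro mult_mono Suc 1 nonneg) auto
    also have "\<dots> = exp (b * real (Suc n))" by (simp add: exp_add[symmetric] algebra_simps)
    finally show ?case .
  qed (simp add: g_0)
  thus ?thesis by blast
qed

lemma rates_nonempty: "rates \<noteq> {}"
  using exp_bound unfolding rates_def by (auto intro: always_eventually)

lemma rates_lower_bound:
  assumes K: "0 < K" and low: "\<exists>\<^sub>F n in sequentially. \<exists>x. K * exp (c * real n) \<le> g n x"
    and l: "l \<in> rates"
  shows "c \<le> l"
proof (rule ccontr)
  assume "\<not> c \<le> l"
  hence "0 < c - l" by simp
  hence "filterlim (\<lambda>n. (c - l) * real n) at_top sequentially"
    by (intro filterlim_tendsto_pos_mult_at_top[OF tendsto_const] filterlim_real_sequentially)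
  hence "\<forall>\<^sub>F n in sequentially. (c - l) * real n > - ln K"
    by (auto simp: filterlim_at_top_dense)
  moreover have "\<forall>\<^sub>F n in sequentially. \<forall>x. g n x \<le> exp (l * real n)"
    using l by (simp add: rates_def)
  ultimately have "\<forall>\<^sub>F n in sequentially. (c - l) * real n > - ln K \<and> (\<forall>x. g n x \<le> exp (l * real n))"
    by (rule eventually_conj)
  from frequently_eventually_conj[OF low this]
  have "\<exists>\<^sub>F n in sequentially. ((c - l) * real n > - ln K \<and> (\<forall>x. g n x \<le> exp (l * real n))) \<and>
      (\<exists>x. K * exp (c * real n) \<le> g n x)" .
  then obtain n x where n: "K * exp (c * real n) \<le> g n x" "(c - l) * real n > - ln K"
    "g n x \<le> exp (l * real n)" by (auto dest: frequently_ex)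
  have "exp (ln K + c * real n) \<le> exp (l * real n)"
    using n K by (simp add: exp_add)
  thus False using n(2) by (simp add: algebra_simps)
qed

lemma rates_bdd_below: "bdd_below rates"
proof -
  obtain c K where K: "0 < K" "\<exists>\<^sub>F n in sequentially. \<exists>x. K * exp (c * real n) \<le> g n x"
    using not_superexp by blast
  from rates_lower_bound[OF K] show ?thesis by (rule bdd_belowI)
qed

lemma growth_ge:
  assumes "0 < K" "\<exists>\<^sub>F n in sequentially. \<exists>x. K * exp (c * real n) \<le> g n x"
  shows "c \<le> growth"
  unfolding growth_def using rates_nonempty rates_lower_bound[OF assms]
  by (intro cInf_greatest)

lemma growth_le:
  assumes "l \<in> rates" shows "growth \<le> l"
  unfolding growth_def by (rule cInf_lower[OF assms rates_bdd_below])

lemma rates_above_growth: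
  assumes "growth < l" shows "l \<in> rates"
proof -
  obtain l' where l': "l' \<in> rates" "l' < l"
    using assms rates_nonempty rates_bdd_below unfolding growth_def by (auto simp: cInf_less_iff)
  have "exp (l' * real n) \<le> exp (l * real n)" for n using l' by (simp add: mult_right_mono)
  thus ?thesis using l' unfolding rates_def
    by (auto elim!: eventually_mono intro: order_trans)
qed

text \<open>Points where exp (a n) / g n is unbounded in n, a vanishing denominator counting as
  infinite. The factor \<open>m\<close> makes membership insensitive to constants, which yields
  backward invariance.\<close>

definition slow :: "real \<Rightarrow> real set" where
  "slow a = {x. \<forall>m::nat. \<exists>n\<ge>m. real m * g n x < exp (a * real n)}"

lemma slow_borel: "slow a \<in> sets borel"
proof -
  have "open {x. real m * g n x < exp (a * real n)}" for m n
    using cont by (intro open_Collect_less continuous_intros)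
  hence "{x. real m * g n x < exp (a * real n)} \<in> sets borel" for m n by simp
  hence "(\<Inter>m. \<Union>n\<in>{m..}. {x. real m * g n x < exp (a * real n)}) \<in> sets borel"
    by (intro sets.countable_INT' sets.countable_UN'') auto
  also have "(\<Inter>m. \<Union>n\<in>{m..}. {x. real m * g n x < exp (a * real n)}) = slow a"
    by (auto simp: slow_def)
  finally show ?thesis .
qed

lemma slow_backward:
  assumes "x + \<omega> \<in> slow a" shows "x \<in> slow a"
proof -
  \<comment> \<open>Cost of prepending one step: \<open>C * exp a\<close> bounds
    \<open>g 1 x\<close>, and the added 1 keeps \<open>C\<close> positive. The enlarged threshold
    \<open>m'\<close> absorbs it.\<close>
  define C where "C = (g 1 x + 1) * exp (- a)"
  have C: "0 < C" using nonneg[of 1 x] by (simp add: C_def add_nonneg_pos)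
  have "\<exists>n\<ge>m. real m * g n x < exp (a * real n)" for m
  proof -
    define m' where "m' = max m (nat \<lceil>C * real m\<rceil>)"
    have m': "m \<le> m'" "C * real m \<le> real m'" by (auto simp: m'_def) linarith
    obtain n where n: "n \<ge> m'" "real m' * g n (x + \<omega>) < exp (a * real n)"
      using assms by (auto simp: slow_def)
    have "real m * g (Suc n) x \<le> real m * (g n (x + \<omega>) * g 1 x)"
      using submult[of 1 n x] by (intro mult_left_mono) auto
    also have "\<dots> \<le> real m * (g n (x + \<omega>) * (C * exp a))"
      using nonneg[of n] by (intro mult_left_mono) (auto simp: C_def exp_minus field_simps)
    also have "\<dots> = (C * real m) * g n (x + \<omega>) * exp a" by simp
    also have "\<dots> \<le> real m' * g n (x + \<omega>) * exp a"
      using m' nonneg by (intro mult_right_mono) auto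
    also have "\<dots> < exp (a * real n) * exp a" using n by simp
    also have "\<dots> = exp (a * real (Suc n))" by (simp add: exp_add[symmetric] algebra_simps)
    finally show ?thesis using n m' by (intro exI[of _ "Suc n"]) auto
  qed
  thus ?thesis by (auto simp: slow_def)
qed

text \<open>Otherwise the set has full measure by ergodicity, so the open sets \<open>V N\<close>,
  where some block of length at most \<open>N\<close> has rate below \<open>a\<close>, nearly fill
  the circle. Uniform visits and the covering bound then force
  \<open>growth \<le> a + e / 2\<close>, which is less than \<open>growth\<close>.\<close>

lemma slow_null:
  assumes e: "0 < e"
  shows "circle_measure (slow (growth - e)) = 0"
proof (rule ccontr)
  define a where "a = growth - e"
  let ?S = "slow a"
  assume "\<not> ?thesis"
  hence pos: "0 < circle_measure ?S"
    unfolding a_def circle_measure_def by (simp add: less_le)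
  have per: "x + 1 \<in> ?S \<longleftrightarrow> x \<in> ?S" for x by (simp add: slow_def periodic)
  have full: "circle_measure ?S = 1"
    by (rule rotation_ergodic[OF irrational slow_borel per slow_backward pos])
  define V where "V N = {x. \<exists>m\<in>{1..N}. g m x < exp (a * real m)}" for N :: nat
  have Vopen: "open (V N)" for N
  proof -
    have "V N = (\<Union>m\<in>{1..N}. {x. g m x < exp (a * real m)})" by (auto simp: V_def)
    moreover have "open {x. g m x < exp (a * real m)}" for m
      using cont by (intro open_Collect_less continuous_intros)
    ultimately show ?thesis by auto
  qed
  hence Vb: "V N \<in> sets borel" for N by simp
  have Vper: "x + 1 \<in> V N \<longleftrightarrow> x \<in> V N" for x N by (simp add: V_def periodic)
  have "?S \<subseteq> (\<Union>N. V N)"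
  proof
    fix x assume "x \<in> ?S"
    then obtain n where "n \<ge> 1" "real (1::nat) * g n x < exp (a * real n)" unfolding slow_def by blast
    hence "x \<in> V n" by (auto simp: V_def)
    thus "x \<in> (\<Union>N. V N)" by blast
  qed
  hence "1 \<le> circle_measure (\<Union>N. V N)"
    using circle_measure_mono[of ?S "\<Union>N. V N"] slow_borel Vb full by auto
  moreover have "(\<lambda>N. circle_measure (V N)) \<longlonglongrightarrow> circle_measure (\<Union>N. V N)"
    using Vb by (intro circle_measure_UN_incseq) (force simp: incseq_def V_def)+
  ultimately have ev: "\<forall>\<^sub>F N in sequentially. circle_measure (V N) > 1 - \<delta>" if "\<delta> > 0" for \<delta>
    using that by (intro order_tendstoD) auto
  obtain b0 where b0: "\<And>n x. g n x \<le> exp (b0 * real n)" using exp_bound by blast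
  define b where "b = max b0 a"
  have ab: "a \<le> b" by (simp add: b_def)
  have b: "g n x \<le> exp (b * real n)" for n x
  proof -
    have "b0 * real n \<le> b * real n" by (rule mult_right_mono) (auto simp: b_def)
    thus ?thesis using b0[of n x] by (meson exp_le_cancel_iff order_trans)
  qed
  \<comment> \<open>Times outside \<open>V N\<close> have frequency at most \<delta>, up to a
    constant, and an extra cost \<open>b - a\<close> each, hence e / 4 per step; another e / 4
    absorbs the constants.\<close>
  define \<delta> where "\<delta> = e / (4 * (b - a + 1))"
  have \<delta>: "0 < \<delta>" "(b - a) * \<delta> \<le> e / 4"
    using e ab by (auto simp: \<delta>_def field_simps)
  obtain N where N: "circle_measure (V N) > 1 - \<delta>"
    using ev[OF \<delta>(1)] by (auto simp: eventually_sequentially)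
  obtain J :: nat where J: "\<And>y n. real (visits \<omega> (V N) y n) \<ge> (1 - \<delta>) * real n - real J"
    using uniform_visits[OF irrational Vopen Vper N] by blast
  have bound: "g n y \<le> exp ((a + e / 4) * real n + (b - a) * (real J + real N))" for n y
  proof -
    have "visits \<omega> (V N) y n \<le> card {..<n}" unfolding visits_def by (rule card_mono) auto
    hence "real (n - visits \<omega> (V N) y n) \<le> \<delta> * real n + real J"
      using J[of n y] by (simp add: of_nat_diff algebra_simps)
    hence "(b - a) * (real (n - visits \<omega> (V N) y n) + real N) \<le> (b - a) * (\<delta> * real n + real J + real N)"
      using ab by (intro mult_left_mono) auto
    also have "\<dots> = (b - a) * \<delta> * real n + (b - a) * (real J + real N)" by (simp add: algebra_simps)
    also have "\<dots> \<le> e / 4 * real n + (b - a) * (real J + real N)"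
      using \<delta>(2) by (intro add_right_mono mult_right_mono) auto
    finally have "a * real n + (b - a) * (real (n - visits \<omega> (V N) y n) + real N) \<le>
        (a + e / 4) * real n + (b - a) * (real J + real N)" by (simp add: algebra_simps)
    moreover have "g n y \<le> exp (a * real n + (b - a) * (real (n - visits \<omega> (V N) y n) + real N))"
      by (rule covering_bound[OF submult nonneg b _ ab]) (auto simp: V_def intro: less_imp_le)
    ultimately show ?thesis by (meson exp_le_cancel_iff order_trans)
  qed
  have "filterlim (\<lambda>n. e / 4 * real n) at_top sequentially"
    using e by (intro filterlim_tendsto_pos_mult_at_top[OF tendsto_const] filterlim_real_sequentially) auto
  hence "\<forall>\<^sub>F n in sequentially. e / 4 * real n \<ge> (b - a) * (real J + real N)"
    by (simp add: filterlim_at_top)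
  hence "\<forall>\<^sub>F n in sequentially. \<forall>x. g n x \<le> exp ((a + e / 2) * real n)"
  proof (rule eventually_mono, intro allI)
    fix n x assume "e / 4 * real n \<ge> (b - a) * (real J + real N)"
    hence "(a + e / 4) * real n + (b - a) * (real J + real N) \<le> (a + e / 2) * real n"
      by (simp add: algebra_simps)
    thus "g n x \<le> exp ((a + e / 2) * real n)" using bound by (meson exp_le_cancel_iff order_trans)
  qed
  hence "growth \<le> a + e / 2" by (intro growth_le) (simp add: rates_def)
  thus False using e by (simp add: a_def)
qed

lemma AE_lebesgue_on_circle:
  assumes "S \<in> sets borel" "circle_measure S = 0"
  shows "AE x in lebesgue_on {0..<1}. x \<notin> S"
proof -
  have "emeasure lborel (S \<inter> {0..<1}) = 0"
    using assms fmeasurableD2[OF fmeasurable_unit[OF assms(1), of 0 1]]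
    by (simp add: circle_measure_def emeasure_eq_ennreal_measure)
  hence "AE x in lborel. x \<notin> S \<inter> {0..<1}"
    using assms by (intro AE_not_in) auto
  hence "AE x in lebesgue. x \<notin> S \<inter> {0..<1}" by (rule AE_completion)
  thus ?thesis by (subst AE_restrict_space_iff) auto
qed

text \<open>The upper bound holds at every point by the choice of \<open>growth\<close>; the lower
  one fails only on a countable union of null sets \<open>slow\<close>.\<close>

theorem AE_growth:
  "AE x in lebesgue_on {0..<1}. (\<forall>\<^sub>F n in sequentially. 0 < g n x) \<and>
     (\<lambda>n. ln (g n x) / real n) \<longlonglongrightarrow> growth"
proof -
  have "AE x in lebesgue_on {0..<1}. \<forall>k::nat. x \<notin> slow (growth - 1 / real (Suc k))"
    unfolding AE_all_countable using slow_null by (intro allI AE_lebesgue_on_circle slow_borel) auto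
  thus ?thesis
  proof (eventually_elim)
    fix x assume x: "\<forall>k::nat. x \<notin> slow (growth - 1 / real (Suc k))"
    have lower: "\<forall>\<^sub>F n in sequentially. exp ((growth - e) * real n) < g n x" if e: "e > 0" for e
    proof -
      \<comment> \<open>Half of \<open>e\<close> pays for 1 / (k + 1), the other half beats the
        factor \<open>m\<close>.\<close>
      obtain k :: nat where k: "1 / real (Suc k) < e / 2"
        using e by (metis half_gt_zero nat_approx_posE)
      obtain m where m: "\<And>n. n \<ge> m \<Longrightarrow> exp ((growth - 1 / real (Suc k)) * real n) \<le> real m * g n x"
        using x[rule_format, of k] unfolding slow_def by (auto simp: not_less)
      have "filterlim (\<lambda>n. e / 2 * real n) at_top sequentially"
        using e by (intro filterlim_tendsto_pos_mult_at_top[OF tendsto_const] filterlim_real_sequentially) auto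
      hence "\<forall>\<^sub>F n in sequentially. e / 2 * real n > ln (real m + 1)"
        by (simp add: filterlim_at_top_dense)
      thus ?thesis using eventually_ge_at_top[of m]
      proof eventually_elim
        fix n assume n: "ln (real m + 1) < e / 2 * real n" "m \<le> n"
        have "real m + 1 = exp (ln (real m + 1))" by simp
        also have "\<dots> < exp (e / 2 * real n)" using n by (simp only: exp_less_cancel_iff)
        finally have m1: "real m + 1 < exp (e / 2 * real n)" .
        have "exp ((growth - e) * real n) * exp (e / 2 * real n) = exp ((growth - e / 2) * real n)"
          by (simp add: exp_add[symmetric] algebra_simps)
        also have "\<dots> \<le> exp ((growth - 1 / real (Suc k)) * real n)"
          using k by (subst exp_le_cancel_iff, intro mult_right_mono) auto
        also have "\<dots> \<le> real m * g n x" by (rule m[OF n(2)])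
        finally have *: "exp ((growth - e) * real n) * exp (e / 2 * real n) \<le> real m * g n x" .
        have gp: "0 < g n x"
          using * nonneg[of n x] by (smt (verit) exp_gt_zero mult_eq_0_iff mult_pos_pos)
        show "exp ((growth - e) * real n) < g n x"
        proof (rule ccontr)
          assume "\<not> ?thesis"
          hence "g n x \<le> exp ((growth - e) * real n)" by simp
          hence "real m * g n x \<le> real m * exp ((growth - e) * real n)" by (rule mult_left_mono) auto
          also have "\<dots> < exp (e / 2 * real n) * exp ((growth - e) * real n)"
            using m1 by simp
          finally show False using * by (simp add: mult.commute)
        qed
      qed
    qed
    have upper: "\<forall>\<^sub>F n in sequentially. g n x \<le> exp ((growth + e) * real n)" if e: "e > 0" for e
      using rates_above_growth[of "growth + e"] e by (auto simp: rates_def elim: eventually_mono)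
    have pos: "\<forall>\<^sub>F n in sequentially. 0 < g n x"
      by (rule eventually_mono[OF lower[of 1]]) (auto intro: order_less_trans[OF exp_gt_zero])
    moreover have "(\<lambda>n. ln (g n x) / real n) \<longlonglongrightarrow> growth"
    proof (rule tendstoI)
      fix e :: real assume e: "0 < e"
      hence "0 < e / 2" by simp
      from lower[OF this] upper[OF this] pos eventually_gt_at_top[of 0]
      show "\<forall>\<^sub>F n in sequentially. dist (ln (g n x) / real n) growth < e"
      proof eventually_elim
        fix n assume n: "exp ((growth - e / 2) * real n) < g n x" "g n x \<le> exp ((growth + e / 2) * real n)"
          "0 < g n x" "0 < n"
        have "(growth - e / 2) * real n < ln (g n x)"
          using n(1,3) by (metis exp_gt_zero ln_exp ln_less_cancel_iff)
        moreover have "ln (g n x) \<le> (growth + e / 2) * real n"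
          using n(2,3) by (metis exp_gt_zero ln_exp ln_le_cancel_iff)
        ultimately have "growth - e / 2 < ln (g n x) / real n" "ln (g n x) / real n \<le> growth + e / 2"
          using n(4) by (auto simp: field_simps)
        thus "dist (ln (g n x) / real n) growth < e" using e by (simp add: dist_real_def abs_less_iff)
      qed
    qed
    ultimately show "(\<forall>\<^sub>F n in sequentially. 0 < g n x) \<and> (\<lambda>n. ln (g n x) / real n) \<longlonglongrightarrow> growth" by blast
  qed
qed

end

section \<open>Compound matrices\<close>

definition minor :: "nat \<Rightarrow> 'a::comm_ring_1 mat \<Rightarrow> (nat \<Rightarrow> nat) \<Rightarrow> (nat \<Rightarrow> nat) \<Rightarrow> 'a" where
  "minor k M f g = det (mat k k (\<lambda>(a, b). M $$ (f a, g b)))"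

text \<open>All index maps instead of increasing ones: a product of sums then expands directly into
  a sum over \<open>idx\<close>, and permuting the arguments is a bijection of it. Maps with
  repeated values contribute vanishing minors. \<open>PiE\<close> fixes the values outside the
  domain, which makes the set finite.\<close>

definition idx :: "nat \<Rightarrow> nat \<Rightarrow> (nat \<Rightarrow> nat) set" where
  "idx k n = PiE {0..<k} (\<lambda>_. {0..<n})"

lemma finite_idx [simp]: "finite (idx k n)"
  unfolding idx_def by (intro finite_PiE) auto

lemma card_idx: "card (idx k n) = n ^ k"
  unfolding idx_def by (simp add: card_PiE)

lemma idx_less: "f \<in> idx k n \<Longrightarrow> a < k \<Longrightarrow> f a < n"
  unfolding idx_def by (force simp: PiE_iff)

lemma minor_Leibniz:
  "minor k M f g = (\<Sum>p | p permutes {0..<k}. signof p * (\<Prod>a = 0..<k. M $$ (f a, g (p a))))"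
proof -
  have "(\<Prod>a = 0..<k. mat k k (\<lambda>(a, b). M $$ (f a, g b)) $$ (a, p a)) = (\<Prod>a = 0..<k. M $$ (f a, g (p a)))"
    if "p permutes {0..<k}" for p
    using permutes_in_image[OF that] by (intro prod.cong) auto
  thus ?thesis unfolding minor_def det_def by simp
qed

lemma minor_permute_rows:
  assumes "q permutes {0..<k}"
  shows "minor k M (g \<circ> q) h = signof q * minor k M g h"
proof -
  have "mat k k (\<lambda>(a, b). M $$ ((g \<circ> q) a, h b)) =
      mat k k (\<lambda>(i, j). mat k k (\<lambda>(a, b). M $$ (g a, h b)) $$ (q i, j))"
    using permutes_in_image[OF assms] by (intro eq_matI) auto
  thus ?thesis unfolding minor_def using det_permute_rows[OF _ assms] by (metis mat_carrier)
qed

lemma bij_betw_idx_compose: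
  assumes q: "q permutes {0..<k}"
  shows "bij_betw (\<lambda>g. g \<circ> q) (idx k n) (idx k n)"
proof (rule bij_betwI[where g = "\<lambda>g. g \<circ> Hilbert_Choice.inv q"])
  have *: "g \<circ> p \<in> idx k n" if p: "p permutes {0..<k}" and g: "g \<in> idx k n" for p g
    using g permutes_in_image[OF p] permutes_not_in[OF p]
    unfolding idx_def PiE_iff extensional_def by auto
  show "(\<lambda>g. g \<circ> q) \<in> idx k n \<rightarrow> idx k n" using *[OF q] by auto
  show "(\<lambda>g. g \<circ> Hilbert_Choice.inv q) \<in> idx k n \<rightarrow> idx k n" using *[OF permutes_inv[OF q]] by auto
qed (auto simp: o_assoc[symmetric] permutes_inv_o[OF q])

text \<open>Expanding the product leaves minors of \<open>B\<close> weighted by plain products of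
  entries of \<open>A\<close>. Reindexing by each permutation \<open>q\<close> and adding up turns
  the weights into minors of \<open>A\<close>; the number of permutations is the factor
  \<open>fact k\<close>.\<close>

lemma Cauchy_Binet_maps:
  fixes A B :: "'a::{comm_ring_1,ring_char_0} mat"
  assumes A: "A \<in> carrier_mat n n" and B: "B \<in> carrier_mat n n"
    and f: "f \<in> idx k n" and h: "h \<in> idx k n"
  shows "fact k * minor k (A * B) f h = (\<Sum>g\<in>idx k n. minor k A f g * minor k B g h)"
proof -
  let ?P = "{p. p permutes {0..<k}}"
  have "minor k (A * B) f h = (\<Sum>p\<in>?P. signof p * (\<Prod>a = 0..<k. \<Sum>c\<in>{0..<n}. A $$ (f a, c) * B $$ (c, h (p a))))"
    unfolding minor_Leibniz
  proof (intro sum.cong refl arg_cong2[where f="(*)"] prod.cong)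
    fix p a assume p: "p \<in> ?P" and a: "a \<in> {0..<k}"
    have pa: "p a < k" using permutes_in_image[of p "{0..<k}" a] p a by auto
    show "(A * B) $$ (f a, h (p a)) = (\<Sum>c\<in>{0..<n}. A $$ (f a, c) * B $$ (c, h (p a)))"
      using A B idx_less[OF f, of a] idx_less[OF h, OF pa] a
      by (auto simp: scalar_prod_def)
  qed
  also have "\<dots> = (\<Sum>p\<in>?P. signof p * (\<Sum>g\<in>idx k n. \<Prod>a = 0..<k. A $$ (f a, g a) * B $$ (g a, h (p a))))"
    unfolding idx_def by (subst prod_sum_PiE) auto
  also have "\<dots> = (\<Sum>g\<in>idx k n. (\<Prod>a = 0..<k. A $$ (f a, g a)) * minor k B g h)"
    unfolding minor_Leibniz sum_distrib_left prod.distrib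
    by (subst sum.swap) (simp add: algebra_simps)
  finally have E: "minor k (A * B) f h = (\<Sum>g\<in>idx k n. (\<Prod>a = 0..<k. A $$ (f a, g a)) * minor k B g h)" .
  have Eq: "minor k (A * B) f h = (\<Sum>g\<in>idx k n. signof q * (\<Prod>a = 0..<k. A $$ (f a, g (q a))) * minor k B g h)"
    if q: "q \<in> ?P" for q
  proof -
    have qp: "q permutes {0..<k}" using q by simp
    have "minor k (A * B) f h = (\<Sum>g\<in>idx k n. (\<Prod>a = 0..<k. A $$ (f a, (g \<circ> q) a)) * minor k B (g \<circ> q) h)"
      unfolding E by (rule sum.reindex_bij_betw[OF bij_betw_idx_compose[OF qp], symmetric])
    thus ?thesis unfolding minor_permute_rows[OF qp] by (simp add: algebra_simps)
  qed
  have "fact k * minor k (A * B) f h = (\<Sum>q\<in>?P. minor k (A * B) f h)"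
    by (simp add: card_permutations)
  also have "\<dots> = (\<Sum>q\<in>?P. \<Sum>g\<in>idx k n. signof q * (\<Prod>a = 0..<k. A $$ (f a, g (q a))) * minor k B g h)"
    by (intro sum.cong Eq refl)
  also have "\<dots> = (\<Sum>g\<in>idx k n. minor k A f g * minor k B g h)"
    unfolding minor_Leibniz[of k A] sum_distrib_right by (rule sum.swap)
  finally show ?thesis .
qed

definition minor_ssq :: "nat \<Rightarrow> 'a::real_normed_field mat \<Rightarrow> real" where
  "minor_ssq k M = (\<Sum>f\<in>idx k (dim_row M). \<Sum>g\<in>idx k (dim_row M). (norm (minor k M f g))\<^sup>2)"

text \<open>The Hilbert-Schmidt norm of the \<open>k\<close>-th compound matrix: dividing by the factorial accounts
  for summing over all index maps instead of increasing ones.\<close>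

definition compound_norm :: "nat \<Rightarrow> 'a::real_normed_field mat \<Rightarrow> real" where
  "compound_norm k M = sqrt (minor_ssq k M) / fact k"

lemma minor_ssq_nonneg: "0 \<le> minor_ssq k M"
  unfolding minor_ssq_def by (intro sum_nonneg) auto

lemma compound_norm_nonneg: "0 \<le> compound_norm k M"
  unfolding compound_norm_def by (simp add: minor_ssq_nonneg)

lemma compound_norm_square: "(compound_norm k M)\<^sup>2 * (fact k)\<^sup>2 = minor_ssq k M"
  unfolding compound_norm_def by (simp add: power_divide minor_ssq_nonneg)

lemma minor_le_compound_norm:
  assumes "M \<in> carrier_mat n n" "f \<in> idx k n" "g \<in> idx k n"
  shows "norm (minor k M f g) \<le> fact k * compound_norm k M"
proof -
  have "(norm (minor k M f g))\<^sup>2 \<le> (\<Sum>g\<in>idx k n. (norm (minor k M f g))\<^sup>2)"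
    using assms by (intro member_le_sum) auto
  also have "\<dots> \<le> minor_ssq k M"
    using assms unfolding minor_ssq_def
    by (auto intro!: member_le_sum[where f="\<lambda>f. \<Sum>g\<in>idx k n. (norm (minor k M f g))\<^sup>2"] sum_nonneg)
  finally have "norm (minor k M f g) \<le> sqrt (minor_ssq k M)" by (rule real_le_rsqrt)
  thus ?thesis by (simp add: compound_norm_def)
qed

text \<open>Cauchy-Schwarz in each entry of the Cauchy-Binet formula; the factor
  \<open>fact k\<close> there matches the normalization of \<open>compound_norm\<close>. That no
  constant is left is what makes the norms of the iterates a submultiplicative process.\<close>

lemma compound_norm_mult:
  assumes A: "A \<in> carrier_mat n n" and B: "B \<in> carrier_mat n n"
  shows "compound_norm k (A * B) \<le> compound_norm k A * compound_norm k B"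
proof -
  let ?I = "idx k n"
  define a b where "a f g = norm (minor k A f g)" and "b f g = norm (minor k B f g)" for f g
  have AB: "A * B \<in> carrier_mat n n" using A B by auto
  have le: "(fact k)\<^sup>2 * (norm (minor k (A * B) f h))\<^sup>2 \<le> (\<Sum>g\<in>?I. (a f g)\<^sup>2) * (\<Sum>g\<in>?I. (b g h)\<^sup>2)"
    if f: "f \<in> ?I" and h: "h \<in> ?I" for f h
  proof -
    have "fact k * norm (minor k (A * B) f h) = norm (fact k * minor k (A * B) f h)"
      by (simp add: norm_mult)
    also have "\<dots> \<le> (\<Sum>g\<in>?I. a f g * b g h)"
      unfolding Cauchy_Binet_maps[OF A B f h]
      by (rule sum_norm_le) (simp add: a_def b_def norm_mult)
    finally have "(fact k * norm (minor k (A * B) f h))\<^sup>2 \<le> (\<Sum>g\<in>?I. a f g * b g h)\<^sup>2"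
      by (intro power_mono) auto
    also have "\<dots> \<le> (\<Sum>g\<in>?I. (a f g)\<^sup>2) * (\<Sum>g\<in>?I. (b g h)\<^sup>2)"
      by (rule Cauchy_Schwarz_ineq_sum)
    finally show ?thesis by (simp add: power_mult_distrib)
  qed
  have "(fact k)\<^sup>2 * minor_ssq k (A * B) = (\<Sum>f\<in>?I. \<Sum>h\<in>?I. (fact k)\<^sup>2 * (norm (minor k (A * B) f h))\<^sup>2)"
    using A unfolding minor_ssq_def sum_distrib_left by simp
  also have "\<dots> \<le> (\<Sum>f\<in>?I. \<Sum>h\<in>?I. (\<Sum>g\<in>?I. (a f g)\<^sup>2) * (\<Sum>g\<in>?I. (b g h)\<^sup>2))"
    by (intro sum_mono le)
  also have "\<dots> = minor_ssq k A * (\<Sum>h\<in>?I. \<Sum>g\<in>?I. (b g h)\<^sup>2)"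
    using A unfolding minor_ssq_def a_def by (simp add: sum_product)
  also have "(\<Sum>h\<in>?I. \<Sum>g\<in>?I. (b g h)\<^sup>2) = minor_ssq k B"
    using B unfolding minor_ssq_def b_def by (subst sum.swap) simp
  finally have "(fact k)\<^sup>2 * minor_ssq k (A * B) \<le> minor_ssq k A * minor_ssq k B" .
  hence "sqrt ((fact k)\<^sup>2 * minor_ssq k (A * B)) \<le> sqrt (minor_ssq k A * minor_ssq k B)"
    by (rule real_sqrt_le_mono)
  thus ?thesis by (simp add: compound_norm_def real_sqrt_mult field_simps)
qed

lemma minor_smult:
  assumes M: "M \<in> carrier_mat n n" and f: "f \<in> idx k n" and g: "g \<in> idx k n"
  shows "minor k (c \<cdot>\<^sub>m M) f g = c ^ k * minor k M f g"
proof -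
  have "mat k k (\<lambda>(a, b). (c \<cdot>\<^sub>m M) $$ (f a, g b)) = c \<cdot>\<^sub>m mat k k (\<lambda>(a, b). M $$ (f a, g b))"
    using M idx_less[OF f] idx_less[OF g] by (intro eq_matI) auto
  thus ?thesis by (simp add: minor_def)
qed

lemma compound_norm_smult:
  assumes M: "M \<in> carrier_mat n n"
  shows "compound_norm k (c \<cdot>\<^sub>m M) = norm c ^ k * compound_norm k M"
proof -
  have "minor_ssq k (c \<cdot>\<^sub>m M) = (norm c ^ k)\<^sup>2 * minor_ssq k M"
    using M unfolding minor_ssq_def sum_distrib_left
    by (intro sum.cong) (auto simp: minor_smult norm_mult norm_power power_mult_distrib)
  thus ?thesis by (simp add: compound_norm_def real_sqrt_mult)
qed

lemma minor_transpose:
  assumes M: "M \<in> carrier_mat n n" and f: "f \<in> idx k n" and g: "g \<in> idx k n"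
  shows "minor k (transpose_mat M) f g = minor k M g f"
proof -
  have "mat k k (\<lambda>(a, b). transpose_mat M $$ (f a, g b)) = transpose_mat (mat k k (\<lambda>(a, b). M $$ (g a, f b)))"
    using M idx_less[OF f] idx_less[OF g] by (intro eq_matI) auto
  thus ?thesis unfolding minor_def by (simp add: det_transpose[of _ k])
qed

lemma compound_norm_transpose:
  assumes M: "M \<in> carrier_mat n n"
  shows "compound_norm k (transpose_mat M) = compound_norm k M"
proof -
  have "minor_ssq k (transpose_mat M) = (\<Sum>f\<in>idx k n. \<Sum>g\<in>idx k n. (norm (minor k M g f))\<^sup>2)"
    using M unfolding minor_ssq_def by (intro sum.cong) (auto simp: minor_transpose)
  also have "\<dots> = minor_ssq k M" using M unfolding minor_ssq_def by (subst sum.swap) simp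
  finally show ?thesis by (simp add: compound_norm_def)
qed

lemma compound_norm_cmat:
  assumes M: "M \<in> carrier_mat n n"
  shows "compound_norm k (cmat M) = compound_norm k M"
proof -
  have "minor k (cmat M) f g = complex_of_real (minor k M f g)" if "f \<in> idx k n" "g \<in> idx k n" for f g
  proof -
    have "mat k k (\<lambda>(a, b). cmat M $$ (f a, g b)) = cmat (mat k k (\<lambda>(a, b). M $$ (f a, g b)))"
      using M idx_less[OF that(1)] idx_less[OF that(2)] by (intro eq_matI) auto
    thus ?thesis by (simp add: minor_def)
  qed
  hence "minor_ssq k (cmat M) = minor_ssq k M"
    using M unfolding minor_ssq_def by (intro sum.cong) auto
  thus ?thesis by (simp add: compound_norm_def)
qed

lemma norm_det_le:
  fixes A :: "'a::real_normed_field mat"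
  assumes A: "A \<in> carrier_mat k k" and e: "\<And>i j. i < k \<Longrightarrow> j < k \<Longrightarrow> norm (A $$ (i, j)) \<le> e"
  shows "norm (det A) \<le> fact k * e ^ k"
proof -
  have "norm (det A) \<le> (\<Sum>p | p permutes {0..<k}. e ^ k)"
    unfolding det_def'[OF A]
  proof (rule sum_norm_le)
    fix p assume "p \<in> {p. p permutes {0..<k}}"
    hence p: "p permutes {0..<k}" by simp
    have "norm (signof p :: 'a) = 1" by (cases p rule: sign_cases) auto
    hence "norm (signof p * (\<Prod>i = 0..<k. A $$ (i, p i))) = (\<Prod>i = 0..<k. norm (A $$ (i, p i)))"
      by (simp add: norm_mult prod_norm)
    also have "\<dots> \<le> (\<Prod>i = 0..<k. e)"
      using e permutes_in_image[OF p] by (intro prod_mono) auto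
    finally show "norm (signof p * (\<Prod>i = 0..<k. A $$ (i, p i))) \<le> e ^ k" by simp
  qed
  also have "\<dots> = fact k * e ^ k" by (simp add: card_permutations)
  finally show ?thesis .
qed

lemma compound_norm_le:
  assumes M: "M \<in> carrier_mat n n" and e: "\<And>i j. i < n \<Longrightarrow> j < n \<Longrightarrow> norm (M $$ (i, j)) \<le> e" and "0 \<le> e"
  shows "compound_norm k M \<le> real n ^ k * e ^ k"
proof -
  have "norm (minor k M f g) \<le> fact k * e ^ k" if "f \<in> idx k n" "g \<in> idx k n" for f g
    unfolding minor_def
    by (rule norm_det_le) (use e idx_less[OF that(1)] idx_less[OF that(2)] in auto)
  hence "(norm (minor k M f g))\<^sup>2 \<le> (fact k * e ^ k)\<^sup>2" if "f \<in> idx k n" "g \<in> idx k n" for f g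
    using that by (intro power_mono) auto
  hence "(\<Sum>f\<in>idx k n. \<Sum>g\<in>idx k n. (norm (minor k M f g))\<^sup>2) \<le>
      (\<Sum>f\<in>idx k n. \<Sum>g\<in>idx k n. (fact k * e ^ k)\<^sup>2)"
    by (intro sum_mono)
  hence "minor_ssq k M \<le> (\<Sum>f\<in>idx k n. \<Sum>g\<in>idx k n. (fact k * e ^ k)\<^sup>2)"
    using M by (simp add: minor_ssq_def)
  also have "\<dots> = (real n ^ k * (fact k * e ^ k))\<^sup>2"
    by (simp add: card_idx power2_eq_square)
  finally have "sqrt (minor_ssq k M) \<le> real n ^ k * (fact k * e ^ k)"
    using \<open>0 \<le> e\<close> by (intro real_le_lsqrt) auto
  thus ?thesis by (simp add: compound_norm_def field_simps)
qed

lemma idx_restrict_id: "k \<le> n \<Longrightarrow> restrict id {0..<k} \<in> idx k n"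
  by (auto simp: idx_def)

lemma minor_restrict_id: "minor k M (restrict id {0..<k}) (restrict id {0..<k}) = det (mat k k (($$) M))"
  unfolding minor_def by (intro arg_cong[where f=det] eq_matI) auto

lemma compound_norm_one:
  assumes "k \<le> n"
  shows "0 < compound_norm k (1\<^sub>m n :: 'a::real_normed_field mat)"
proof -
  have "mat k k (($$) (1\<^sub>m n :: 'a mat)) = 1\<^sub>m k" using assms by (intro eq_matI) auto
  hence "minor k (1\<^sub>m n :: 'a mat) (restrict id {0..<k}) (restrict id {0..<k}) = 1"
    by (simp add: minor_restrict_id)
  hence "1 \<le> fact k * compound_norm k (1\<^sub>m n :: 'a mat)"
    using minor_le_compound_norm[OF one_carrier_mat idx_restrict_id[OF assms] idx_restrict_id[OF assms], where ?'a='a]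
    by simp
  thus ?thesis by (smt (verit) fact_gt_zero mult_nonneg_nonpos)
qed

section \<open>Traces of compound matrices and eigenvalues\<close>

text \<open>This is \<open>fact k\<close> times the trace of the k-th compound, that is,
  \<open>fact k\<close> times the k-th elementary symmetric polynomial of the eigenvalues.\<close>

definition minor_trace :: "nat \<Rightarrow> 'a::comm_ring_1 mat \<Rightarrow> 'a" where
  "minor_trace k N = (\<Sum>g\<in>idx k (dim_row N). minor k N g g)"

lemma minor_trace_mult_commute:
  fixes A B :: "'a::field_char_0 mat"
  assumes A: "A \<in> carrier_mat n n" and B: "B \<in> carrier_mat n n"
  shows "minor_trace k (A * B) = minor_trace k (B * A)"
proof -
  have "fact k * minor_trace k (A * B) = (\<Sum>f\<in>idx k n. \<Sum>g\<in>idx k n. minor k A f g * minor k B g f)"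
    using A B unfolding minor_trace_def sum_distrib_left
    by (auto intro!: sum.cong Cauchy_Binet_maps)
  also have "\<dots> = (\<Sum>f\<in>idx k n. \<Sum>g\<in>idx k n. minor k B f g * minor k A g f)"
    by (subst sum.swap) (simp add: mult.commute)
  also have "\<dots> = fact k * minor_trace k (B * A)"
    using A B unfolding minor_trace_def sum_distrib_left
    by (auto intro!: sum.cong Cauchy_Binet_maps[symmetric])
  finally show ?thesis by simp
qed

lemma minor_trace_similar:
  fixes A B :: "'a::field_char_0 mat"
  assumes "similar_mat_wit A B P Q" "A \<in> carrier_mat n n"
  shows "minor_trace k A = minor_trace k B"
proof -
  note w = similar_mat_witD2[OF assms(2,1)]
  have "minor_trace k A = minor_trace k (P * (B * Q))" using w by (simp add: assoc_mult_mat[of _ n n])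
  also have "\<dots> = minor_trace k ((B * Q) * P)" using w by (intro minor_trace_mult_commute[of _ n]) auto
  also have "(B * Q) * P = B" using w by (simp add: assoc_mult_mat[of _ n n _ n])
  finally show ?thesis .
qed

text \<open>The bridge from norms to singular values: the right side depends only on the eigenvalues
  of the Gram matrix.\<close>

lemma minor_ssq_eq_trace:
  fixes M :: "real mat"
  assumes M: "M \<in> carrier_mat n n"
  shows "minor_ssq k M = fact k * minor_trace k (transpose_mat M * M)"
proof -
  have "fact k * minor_trace k (transpose_mat M * M) =
      (\<Sum>g\<in>idx k n. \<Sum>f\<in>idx k n. minor k (transpose_mat M) g f * minor k M f g)"
    unfolding minor_trace_def sum_distrib_left
    using M Cauchy_Binet_maps[of "transpose_mat M" n M _ k] by (auto intro!: sum.cong)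
  also have "\<dots> = (\<Sum>g\<in>idx k n. \<Sum>f\<in>idx k n. (norm (minor k M f g))\<^sup>2)"
    using M by (intro sum.cong) (auto simp: minor_transpose power2_eq_square)
  also have "\<dots> = minor_ssq k M" using M unfolding minor_ssq_def by (subst sum.swap) auto
  finally show ?thesis by simp
qed

text \<open>As \<open>g\<close> need not be increasing, the selected submatrix need not be
  triangular. Still, for injective \<open>g\<close> every permutation other than the identity lowers
  \<open>g\<close> at some place and meets a zero below the diagonal of \<open>T\<close>.\<close>

lemma minor_upper_triangular:
  assumes T: "T \<in> carrier_mat n n" "upper_triangular T" and g: "g \<in> idx k n"
  shows "minor k T g g = (if inj_on g {0..<k} then \<Prod>a = 0..<k. T $$ (g a, g a) else 0)"
proof (cases "inj_on g {0..<k}")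
  case True
  have zero: "signof p * (\<Prod>a = 0..<k. T $$ (g a, g (p a))) = 0"
    if p: "p permutes {0..<k}" and pid: "p \<noteq> id" for p
  proof -
    have pk: "a < k \<Longrightarrow> p a < k" for a using permutes_in_image[OF p, of a] by auto
    have "\<exists>a<k. g (p a) < g a"
    proof (rule ccontr)
      assume "\<not> ?thesis"
      hence le: "\<And>a. a < k \<Longrightarrow> g a \<le> g (p a)" using not_less by blast
      \<comment> \<open>A permutation preserves the sum of the values, so if none of them decreases,
        none changes.\<close>
      have "(\<Sum>a = 0..<k. g (p a)) = (\<Sum>a = 0..<k. g a)"
        using sum.permute[OF p, of g] by (simp add: o_def)
      hence "\<forall>a\<in>{0..<k}. g a = g (p a)"
        using le by (metis (no_types, lifting) atLeastLessThan_iff finite_atLeastLessThan leD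
            less_le sum_strict_mono_ex1)
      hence "\<forall>a\<in>{0..<k}. a = p a" using True pk by (auto simp: inj_on_def)
      hence "p a = a" for a using permutes_not_in[OF p, of a] by (cases "a < k") auto
      thus False using pid by auto
    qed
    then obtain a where a: "a < k" "g (p a) < g a" by blast
    hence "T $$ (g a, g (p a)) = 0"
      using T idx_less[OF g] by (auto simp: upper_triangular_def)
    hence "(\<Prod>a = 0..<k. T $$ (g a, g (p a))) = 0" using a by (intro prod_zero) auto
    thus ?thesis by simp
  qed
  have "minor k T g g = (\<Sum>p\<in>{id}. signof p * (\<Prod>a = 0..<k. T $$ (g a, g (p a))))"
    unfolding minor_Leibniz
    by (rule sum.mono_neutral_right) (use zero permutes_id in \<open>auto intro: finite_permutations\<close>)
  thus ?thesis using True by (simp add: signof_id)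
next
  case False
  then obtain i j where ij: "i < k" "j < k" "i \<noteq> j" "g i = g j" by (auto simp: inj_on_def)
  have "minor k T g g = 0"
    unfolding minor_def
    by (rule det_identical_rows[of _ k i j]) (use ij in \<open>auto simp: row_def\<close>)
  thus ?thesis using False by simp
qed

text \<open>Schur triangularization: the trace is invariant under similarity, and on a triangular
  matrix it sees only the diagonal.\<close>

lemma minor_trace_eigenvalues:
  fixes N :: "real mat"
  assumes N: "N \<in> carrier_mat n n" and cp: "char_poly N = (\<Prod>e\<leftarrow>es. [:- e, 1:])"
  shows "minor_trace k N = (\<Sum>g\<in>{g\<in>idx k n. inj_on g {0..<k}}. \<Prod>a = 0..<k. es ! g a)"
    and "det N = prod_list es" and "length es = n"
proof -
  obtain T P Q where TPQ: "schur_decomposition N es = (T, P, Q)" by (cases "schur_decomposition N es") auto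
  from schur_decomposition[OF N cp this]
  have sim: "similar_mat_wit N T P Q" and ut: "upper_triangular T" and diag: "diag_mat T = es" by auto
  have T: "T \<in> carrier_mat n n" using similar_mat_witD2[OF N sim] by simp
  have es: "T $$ (i, i) = es ! i" if "i < n" for i
    using diag T that by (auto simp: diag_mat_def)
  show "length es = n" using diag T by (auto simp: diag_mat_def)
  show "det N = prod_list es"
    using det_similar[of N T] sim det_upper_triangular[OF ut T] diag by (auto simp: similar_mat_def)
  have "minor_trace k N = minor_trace k T" by (rule minor_trace_similar[OF sim N])
  also have "\<dots> = (\<Sum>g\<in>idx k n. if inj_on g {0..<k} then \<Prod>a = 0..<k. es ! g a else 0)"
    unfolding minor_trace_def using T
  proof (intro sum.cong)
    fix g assume g: "g \<in> idx k n"
    have "(\<Prod>a = 0..<k. T $$ (g a, g a)) = (\<Prod>a = 0..<k. es ! g a)"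
      by (intro prod.cong refl es idx_less[OF g]) simp
    thus "minor k T g g = (if inj_on g {0..<k} then \<Prod>a = 0..<k. es ! g a else 0)"
      by (simp only: minor_upper_triangular[OF T ut g])
  qed (use T in simp)
  also have "\<dots> = (\<Sum>g\<in>{g\<in>idx k n. inj_on g {0..<k}}. \<Prod>a = 0..<k. es ! g a)"
    by (rule sum.inter_filter[symmetric]) simp
  finally show "minor_trace k N = \<dots>" .
qed

section \<open>Singular values\<close>

text \<open>For an eigenvector v and w = C v, the value \<open>a\<close> times the squared length of
  v is the squared length of w; the plain transpose acts as the adjoint because C has real entries.
  Complex vectors occur because the real characteristic polynomial is not yet known to
  split.\<close>

lemma gram_eigenvalue_nonneg:
  fixes M :: "real mat"
  assumes M: "M \<in> carrier_mat n n" and ev: "eigenvalue (cmat (transpose_mat M * M)) a"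
  shows "\<exists>r\<ge>0. a = complex_of_real r"
proof -
  let ?C = "cmat M"
  have C: "?C \<in> carrier_mat n n" using M by auto
  have NC: "cmat (transpose_mat M * M) = transpose_mat ?C * ?C"
    using M by (intro eq_matI) (auto simp: scalar_prod_def)
  obtain v where v: "v \<in> carrier_vec n" "v \<noteq> 0\<^sub>v n" "(transpose_mat ?C * ?C) *\<^sub>v v = a \<cdot>\<^sub>v v"
    using ev C unfolding eigenvalue_def eigenvector_def NC by auto
  define w where "w = ?C *\<^sub>v v"
  have w: "w \<in> carrier_vec n" using C v by (auto simp: w_def)
  have wk: "w $ k = (\<Sum>i<n. ?C $$ (k, i) * v $ i)" if "k < n" for k
    using that C v by (auto simp: w_def scalar_prod_def lessThan_atLeast0)
  have Cw: "transpose_mat ?C *\<^sub>v w = a \<cdot>\<^sub>v v"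
    using v(3) assoc_mult_mat_vec[of "transpose_mat ?C" n n ?C n v] C v by (simp add: w_def)
  have av: "a * v $ i = (\<Sum>k<n. ?C $$ (k, i) * w $ k)" if "i < n" for i
  proof -
    have "(transpose_mat ?C *\<^sub>v w) $ i = (\<Sum>k<n. ?C $$ (k, i) * w $ k)"
      using that C w by (auto simp: scalar_prod_def lessThan_atLeast0)
    thus ?thesis using Cw that v by simp
  qed
  define S T where "S = (\<Sum>i<n. (norm (v $ i))\<^sup>2)" and "T = (\<Sum>k<n. (norm (w $ k))\<^sup>2)"
  have "a * complex_of_real S = (\<Sum>i<n. (a * v $ i) * cnj (v $ i))"
    by (simp add: S_def sum_distrib_left complex_norm_square mult.assoc del: of_real_power)
  also have "\<dots> = (\<Sum>i<n. \<Sum>k<n. ?C $$ (k, i) * w $ k * cnj (v $ i))"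
    by (intro sum.cong refl) (simp add: av sum_distrib_right)
  also have "\<dots> = (\<Sum>k<n. w $ k * cnj (\<Sum>i<n. ?C $$ (k, i) * v $ i))"
    using M by (subst sum.swap) (auto simp: sum_distrib_left intro!: sum.cong)
  also have "\<dots> = (\<Sum>k<n. w $ k * cnj (w $ k))"
    by (intro sum.cong refl) (simp add: wk)
  also have "\<dots> = complex_of_real T"
    by (simp add: T_def complex_norm_square del: of_real_power)
  finally have aS: "a * complex_of_real S = complex_of_real T" .
  have "\<exists>i<n. v $ i \<noteq> 0" using v(1,2) by (metis carrier_vecD eq_vecI index_zero_vec)
  hence S: "0 < S" unfolding S_def by (auto intro!: sum_pos2)
  have T: "0 \<le> T" unfolding T_def by (intro sum_nonneg) auto
  have "a = complex_of_real (T / S)" using aS S by (simp add: field_simps)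
  thus ?thesis using S T by (intro exI[of _ "T / S"]) auto
qed

text \<open>Factor over the complex numbers, where all roots turn out to be real and nonnegative,
  and pull the factorization back along the injective map of polynomials.\<close>

lemma gram_char_poly:
  fixes M :: "real mat"
  assumes M: "M \<in> carrier_mat n n"
  shows "\<exists>rs. length rs = n \<and> (\<forall>r\<in>set rs. 0 \<le> r) \<and>
    char_poly (transpose_mat M * M) = (\<Prod>r\<leftarrow>rs. [:- r, 1:])"
proof -
  let ?N = "transpose_mat M * M"
  have N: "?N \<in> carrier_mat n n" using M by auto
  hence cN: "cmat ?N \<in> carrier_mat n n" by auto
  obtain as where as: "char_poly (cmat ?N) = (\<Prod>a\<leftarrow>as. [:- a, 1:])" "length as = n"
    using char_poly_factorized[OF cN] by blast
  have real: "\<exists>r\<ge>0. a = complex_of_real r" if "a \<in> set as" for a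
  proof (rule gram_eigenvalue_nonneg[OF M])
    have "0 = (\<lambda>x. poly [:- x, 1:] a) a" by simp
    hence "0 \<in> set (map (\<lambda>x. poly [:- x, 1:] a) as)" using that unfolding set_map by (rule image_eqI)
    hence "poly (char_poly (cmat ?N)) a = 0"
      unfolding as(1) poly_prod_list prod_list_zero_iff by (simp add: o_def)
    thus "eigenvalue (cmat ?N) a" using eigenvalue_root_char_poly[OF cN] by simp
  qed
  define rs where "rs = map Re as"
  have as_rs: "as = map complex_of_real rs"
  proof -
    have "map (complex_of_real \<circ> Re) as = as"
    proof (rule map_idI)
      fix a assume "a \<in> set as"
      then obtain r where "a = complex_of_real r" using real by blast
      thus "(complex_of_real \<circ> Re) a = a" by simp
    qed
    thus ?thesis by (simp add: rs_def)
  qed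
  interpret map_poly_inj_comm_ring_hom complex_of_real ..
  have "map_poly complex_of_real (char_poly ?N) = (\<Prod>a\<leftarrow>as. [:- a, 1:])"
    unfolding of_real_hom.char_poly_hom[OF N, symmetric] by (rule as(1))
  also have "\<dots> = map_poly complex_of_real (\<Prod>r\<leftarrow>rs. [:- r, 1:])"
    unfolding as_rs
  proof (induction rs)
    case (Cons r rs)
    have "map_poly complex_of_real [:- r, 1:] = [:- complex_of_real r, 1:]"
      by (simp add: map_poly_pCons)
    thus ?case using Cons by (simp only: list.map prod_list.Cons hom_mult)
  qed simp
  finally have "char_poly ?N = (\<Prod>r\<leftarrow>rs. [:- r, 1:])" by (rule injectivity)
  moreover have "\<forall>r\<in>set rs. 0 \<le> r"
  proof
    fix r assume "r \<in> set rs"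
    then obtain a where a: "a \<in> set as" "r = Re a" by (auto simp: rs_def)
    obtain r' where "0 \<le> r'" "a = complex_of_real r'" using real[OF a(1)] by blast
    thus "0 \<le> r" using a(2) by simp
  qed
  moreover have "length rs = n" using as(2) by (simp add: rs_def)
  ultimately show ?thesis by blast
qed

lemma proots_prod_linear: "proots (\<Prod>r\<leftarrow>rs. [:- r, 1:]) = mset (rs :: real list)"
proof (induction rs)
  case (Cons r rs)
  have "(\<Prod>r\<leftarrow>rs. [:- r, 1:]) \<noteq> (0 :: real poly)" by (auto simp: prod_list_zero_iff)
  hence "proots ([:- r, 1:] * (\<Prod>r\<leftarrow>rs. [:- r, 1:])) = proots [:- r, 1:] + proots (\<Prod>r\<leftarrow>rs. [:- r, 1:])"
    by (intro proots_mult) auto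
  thus ?case using Cons proots_linear_factor[of "- r"] by simp
qed simp

lemma singular_values_facts:
  assumes M: "M \<in> carrier_mat n n"
  shows "length (singular_values M) = n"
    and "sorted_wrt (\<ge>) (singular_values M)"
    and "\<forall>x\<in>set (singular_values M). 0 \<le> x"
    and "char_poly (transpose_mat M * M) = (\<Prod>e\<leftarrow>map (\<lambda>x. x\<^sup>2) (singular_values M). [:- e, 1:])"
proof -
  let ?s = "singular_values M"
  obtain rs where rs: "length rs = n" "\<forall>r\<in>set rs. 0 \<le> r"
    "char_poly (transpose_mat M * M) = (\<Prod>r\<leftarrow>rs. [:- r, 1:])" using gram_char_poly[OF M] by blast
  have s: "mset ?s = image_mset sqrt (mset rs)"
    unfolding singular_values_def rs(3) proots_prod_linear by simp
  show "length ?s = n" using arg_cong[OF s, of size] rs(1) by simp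
  show "sorted_wrt (\<ge>) ?s" unfolding singular_values_def
    by (simp add: sorted_wrt_rev)
  have "set ?s = sqrt ` set rs" using arg_cong[OF s, of set_mset] by simp
  thus "\<forall>x\<in>set ?s. 0 \<le> x" using rs(2) by auto
  have "mset (map (\<lambda>x. x\<^sup>2) ?s) = image_mset (\<lambda>r. (sqrt r)\<^sup>2) (mset rs)"
    using s by (simp add: image_mset.compositionality o_def)
  also have "\<dots> = mset rs"
    by (intro multiset.map_ident_strong) (use rs(2) in auto)
  finally have m: "mset (map (\<lambda>x. x\<^sup>2) ?s) = mset rs" .
  have "(\<Prod>e\<leftarrow>map (\<lambda>x. x\<^sup>2) ?s. [:- e, 1:]) = prod_mset (image_mset (\<lambda>e. [:- e, 1:]) (mset (map (\<lambda>x. x\<^sup>2) ?s)))"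
    by (simp only: prod_mset_prod_list[symmetric] mset_map)
  also have "\<dots> = (\<Prod>r\<leftarrow>rs. [:- r, 1:])" unfolding m
    by (simp only: prod_mset_prod_list[symmetric] mset_map)
  finally show "char_poly (transpose_mat M * M) = (\<Prod>e\<leftarrow>map (\<lambda>x. x\<^sup>2) ?s. [:- e, 1:])" using rs(3) by simp
qed

text \<open>Known as the operator norm of the k-th exterior power; along the cocycle its rate is the
  sum of the first k exponents.\<close>

definition sv_prod :: "nat \<Rightarrow> real mat \<Rightarrow> real" where
  "sv_prod k M = (\<Prod>a<k. singular_values M ! a)"

text \<open>Remove the largest index m of \<open>A\<close>: among k + 1 indices it is at least k, so
  its factor is at most \<open>s k\<close>.\<close>

lemma prod_le_prod_initial:
  fixes s :: "nat \<Rightarrow> real"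
  assumes "finite A" "A \<subseteq> {..<n}" and anti: "\<And>i j. i \<le> j \<Longrightarrow> j < n \<Longrightarrow> s j \<le> s i"
    and nn: "\<And>i. i < n \<Longrightarrow> 0 \<le> s i"
  shows "prod s A \<le> (\<Prod>i<card A. s i)"
  using assms(1,2)
proof (induction "card A" arbitrary: A)
  case (Suc k)
  hence "A \<noteq> {}" by auto
  define m where "m = Max A"
  have m: "m \<in> A" "m < n" using Suc \<open>A \<noteq> {}\<close> by (auto simp: m_def)
  have "A \<subseteq> {..m}" using Suc by (auto simp: m_def)
  hence "Suc k \<le> Suc m" using Suc card_mono[of "{..m}" A] by simp
  hence km: "k \<le> m" by simp
  have cardA: "card (A - {m}) = k" using Suc m by simp
  have "prod s A = s m * prod s (A - {m})" using Suc m by (subst prod.remove[of A m]) auto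
  also have "\<dots> \<le> s k * (\<Prod>i<k. s i)"
    using Suc(1)[of "A - {m}"] cardA Suc(3,4) anti[OF km] nn m km
    by (intro mult_mono) (auto intro!: prod_nonneg)
  finally show ?case using Suc(2) by (simp add: mult.commute flip: Suc(2))
qed auto

lemma singular_values_nonneg:
  "M \<in> carrier_mat n n \<Longrightarrow> i < n \<Longrightarrow> 0 \<le> singular_values M ! i"
  using singular_values_facts(1,3) by (metis nth_mem)

lemma singular_values_antimono:
  "M \<in> carrier_mat n n \<Longrightarrow> i \<le> j \<Longrightarrow> j < n \<Longrightarrow> singular_values M ! j \<le> singular_values M ! i"
  using singular_values_facts(1,2)[of M n] by (cases "i = j") (auto simp: sorted_wrt_iff_nth_less)

lemma sv_prod_nonneg: "M \<in> carrier_mat n n \<Longrightarrow> k \<le> n \<Longrightarrow> 0 \<le> sv_prod k M"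
  unfolding sv_prod_def using singular_values_nonneg by (intro prod_nonneg) auto

lemma minor_trace_gram:
  assumes M: "M \<in> carrier_mat n n"
  shows "minor_trace k (transpose_mat M * M) =
    (\<Sum>g\<in>{g\<in>idx k n. inj_on g {0..<k}}. (\<Prod>a = 0..<k. singular_values M ! g a)\<^sup>2)"
proof -
  have N: "transpose_mat M * M \<in> carrier_mat n n" using M by auto
  show ?thesis
    unfolding minor_trace_eigenvalues(1)[OF N singular_values_facts(4)[OF M]] prod_power_distrib
  proof (intro sum.cong prod.cong refl)
    fix g a assume "g \<in> {g \<in> idx k n. inj_on g {0..<k}}" "a \<in> {0..<k}"
    hence "g a < n" using idx_less[of g k n a] by simp
    thus "map (\<lambda>x. x\<^sup>2) (singular_values M) ! g a = (singular_values M ! g a)\<^sup>2"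
      using singular_values_facts(1)[OF M] by simp
  qed
qed

text \<open>The Gram trace is a sum of squares, and the initial index map contributes the square of
  \<open>sv_prod\<close>.\<close>

lemma sv_prod_le_compound_norm:
  assumes M: "M \<in> carrier_mat n n" and k: "k \<le> n"
  shows "sv_prod k M \<le> fact k * compound_norm k M"
proof -
  define i where "i = restrict id {0..<k}"
  have i: "i \<in> idx k n" "inj_on i {0..<k}" using idx_restrict_id[OF k] by (auto simp: i_def inj_on_def)
  have "(sv_prod k M)\<^sup>2 = (\<Prod>a = 0..<k. singular_values M ! i a)\<^sup>2"
    unfolding sv_prod_def i_def by (simp add: lessThan_atLeast0)
  also have "\<dots> \<le> minor_trace k (transpose_mat M * M)"
    unfolding minor_trace_gram[OF M] using i
    by (intro member_le_sum[of i]) auto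
  also have "\<dots> \<le> minor_ssq k M"
  proof -
    have "0 \<le> minor_trace k (transpose_mat M * M)" unfolding minor_trace_gram[OF M]
      by (intro sum_nonneg) auto
    thus ?thesis unfolding minor_ssq_eq_trace[OF M]
      using mult_right_mono[of 1 "fact k :: real"] by (simp add: fact_ge_1)
  qed
  also have "\<dots> = (fact k * compound_norm k M)\<^sup>2"
    by (simp add: compound_norm_square[symmetric] power_mult_distrib mult.commute)
  finally show ?thesis by (rule power2_le_imp_le) (simp add: compound_norm_nonneg)
qed

text \<open>Every square in the Gram trace is at most the leading one, and there are at most n ^ k
  of them. The constant is crude but independent of \<open>M\<close>, so it disappears in the
  rates.\<close>

lemma compound_norm_le_sv_prod:
  assumes M: "M \<in> carrier_mat n n" and k: "k \<le> n"
  shows "compound_norm k M \<le> real n ^ k * sv_prod k M"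
proof -
  let ?I = "{g\<in>idx k n. inj_on g {0..<k}}"
  have le: "(\<Prod>a = 0..<k. singular_values M ! g a)\<^sup>2 \<le> (sv_prod k M)\<^sup>2" if "g \<in> ?I" for g
  proof (rule power_mono)
    have g: "inj_on g {0..<k}" "\<And>a. a < k \<Longrightarrow> g a < n" using that idx_less[of g k n] by auto
    have "(\<Prod>a = 0..<k. singular_values M ! g a) = (\<Prod>i\<in>g ` {0..<k}. singular_values M ! i)"
      using g(1) by (subst prod.reindex) auto
    also have "\<dots> \<le> (\<Prod>i<card (g ` {0..<k}). singular_values M ! i)"
      using g(2) by (intro prod_le_prod_initial[of _ n] singular_values_antimono[OF M]
          singular_values_nonneg[OF M]) auto
    also have "\<dots> = sv_prod k M"
      unfolding sv_prod_def using g(1) by (subst card_image) auto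
    finally show "(\<Prod>a = 0..<k. singular_values M ! g a) \<le> sv_prod k M" .
    show "0 \<le> (\<Prod>a = 0..<k. singular_values M ! g a)"
      using g(2) by (intro prod_nonneg ballI singular_values_nonneg[OF M]) auto
  qed
  have "minor_trace k (transpose_mat M * M) \<le> real (card ?I) * (sv_prod k M)\<^sup>2"
    unfolding minor_trace_gram[OF M] by (rule sum_bounded_above[OF le])
  also have "\<dots> \<le> real n ^ k * (sv_prod k M)\<^sup>2"
  proof -
    have "card ?I \<le> card (idx k n)" by (intro card_mono) auto
    hence "real (card ?I) \<le> real (n ^ k)" unfolding card_idx by (simp only: of_nat_le_iff)
    hence "real (card ?I) \<le> real n ^ k" by (simp only: of_nat_power)
    thus ?thesis by (rule mult_right_mono) auto
  qed
  also have "\<dots> \<le> (real n ^ k)\<^sup>2 * (sv_prod k M)\<^sup>2"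
  proof (rule mult_right_mono)
    have "1 \<le> n ^ k" using k by (cases "n = 0") auto
    hence "real 1 \<le> real (n ^ k)" by (simp only: of_nat_le_iff)
    hence "1 \<le> real n ^ k" by (simp only: of_nat_power of_nat_1)
    thus "real n ^ k \<le> (real n ^ k)\<^sup>2" by (rule self_le_power) simp
  qed auto
  finally have "minor_trace k (transpose_mat M * M) \<le> (real n ^ k * sv_prod k M)\<^sup>2"
    by (simp add: power_mult_distrib)
  hence "minor_ssq k M \<le> fact k * (real n ^ k * sv_prod k M)\<^sup>2"
    unfolding minor_ssq_eq_trace[OF M] by (intro mult_left_mono) auto
  also have "\<dots> \<le> (fact k)\<^sup>2 * (real n ^ k * sv_prod k M)\<^sup>2"
  proof (rule mult_right_mono)
    show "(fact k :: real) \<le> (fact k)\<^sup>2" by (rule self_le_power) (auto simp: fact_ge_1)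
  qed auto
  finally have "(compound_norm k M)\<^sup>2 * (fact k)\<^sup>2 \<le> (real n ^ k * sv_prod k M)\<^sup>2 * (fact k)\<^sup>2"
    unfolding compound_norm_square by (simp only: mult.commute[of "(fact k)\<^sup>2"])
  hence "(compound_norm k M)\<^sup>2 \<le> (real n ^ k * sv_prod k M)\<^sup>2"
    by (rule mult_right_le_imp_le) simp
  moreover have "0 \<le> real n ^ k * sv_prod k M"
    using sv_prod_nonneg[OF M k] by (intro mult_nonneg_nonneg) simp_all
  ultimately show ?thesis by (rule power2_le_imp_le)
qed

lemma sv_prod_eq_abs_det:
  assumes M: "M \<in> carrier_mat n n"
  shows "sv_prod n M = \<bar>det M\<bar>"
proof -
  have N: "transpose_mat M * M \<in> carrier_mat n n" using M by auto
  have "(det M)\<^sup>2 = det (transpose_mat M * M)"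
    using det_mult[of "transpose_mat M" n M] det_transpose[OF M] M by (simp add: power2_eq_square)
  also have "\<dots> = (\<Prod>x\<leftarrow>singular_values M. x\<^sup>2)"
    by (rule minor_trace_eigenvalues(2)[OF N singular_values_facts(4)[OF M]])
  also have "\<dots> = (sv_prod n M)\<^sup>2"
  proof -
    have "(\<Prod>x\<leftarrow>singular_values M. x\<^sup>2) = (\<Prod>i = 0..<n. map (\<lambda>x. x\<^sup>2) (singular_values M) ! i)"
      unfolding prod.list_conv_set_nth using singular_values_facts(1)[OF M] by simp
    also have "\<dots> = (\<Prod>i = 0..<n. (singular_values M ! i)\<^sup>2)"
      using singular_values_facts(1)[OF M] by (intro prod.cong refl) simp
    also have "\<dots> = (\<Prod>i = 0..<n. singular_values M ! i)\<^sup>2" by (rule prod_power_distrib[symmetric])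
    finally show ?thesis by (simp only: sv_prod_def lessThan_atLeast0)
  qed
  finally have "\<bar>det M\<bar> = \<bar>sv_prod n M\<bar>" by (simp only: power2_eq_iff abs_eq_iff)
  thus ?thesis using sv_prod_nonneg[OF M order_refl] by linarith
qed

text \<open>By x - N' = - x N' (1 / x - N) and multiplicativity of det, the two polynomials agree at
  every nonzero x, hence at infinitely many points.\<close>

lemma char_poly_inverse:
  fixes N N' :: "real mat"
  assumes N: "N \<in> carrier_mat n n" and N': "N' \<in> carrier_mat n n" and inv: "N' * N = 1\<^sub>m n"
    and cp: "char_poly N = (\<Prod>e\<leftarrow>es. [:- e, 1:])"
  shows "char_poly N' = (\<Prod>e\<leftarrow>map inverse es. [:- e, 1:])"
proof -
  have len: "length es = n" and dN: "det N = prod_list es"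
    using minor_trace_eigenvalues(2,3)[OF N cp] by auto
  have dd: "det N' * det N = 1" using det_mult[OF N' N] inv by simp
  hence "prod_list es \<noteq> 0" unfolding dN by (metis mult_zero_right zero_neq_one)
  hence nz: "\<forall>e\<in>set es. e \<noteq> 0" by (auto simp: prod_list_zero_iff)
  have pe: "poly (char_poly A) x = det (x \<cdot>\<^sub>m 1\<^sub>m n - A)" if "A \<in> carrier_mat n n" for A :: "real mat" and x
  proof -
    have "- char_matrix A x = x \<cdot>\<^sub>m 1\<^sub>m n - A"
      using that by (intro eq_matI) (auto simp: char_matrix_def)
    thus ?thesis using char_poly_matrix[OF that] by simp
  qed
  have "poly (char_poly N') x = poly (\<Prod>e\<leftarrow>map inverse es. [:- e, 1:]) x" if x: "x \<noteq> 0" for x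
  proof -
    have B: "inverse x \<cdot>\<^sub>m 1\<^sub>m n - N \<in> carrier_mat n n" using N by auto
    have "x \<cdot>\<^sub>m 1\<^sub>m n - N' = (- x) \<cdot>\<^sub>m (N' * (inverse x \<cdot>\<^sub>m 1\<^sub>m n - N))"
    proof -
      have "N' * (inverse x \<cdot>\<^sub>m 1\<^sub>m n - N) = inverse x \<cdot>\<^sub>m N' - 1\<^sub>m n"
        using N N' inv by (subst mult_minus_distrib_mat[of _ n n]) (auto simp: mult_smult_distrib[of _ n n])
      moreover have "(- x) \<cdot>\<^sub>m (inverse x \<cdot>\<^sub>m N' - 1\<^sub>m n) = x \<cdot>\<^sub>m 1\<^sub>m n - N'"
      proof (rule eq_matI)
        fix i j assume "i < dim_row (x \<cdot>\<^sub>m 1\<^sub>m n - N')" "j < dim_col (x \<cdot>\<^sub>m 1\<^sub>m n - N')"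
        hence ij: "i < n" "j < n" using N' by auto
        have xx: "x * (inverse x * a) = a" for a using x by simp
        show "((- x) \<cdot>\<^sub>m (inverse x \<cdot>\<^sub>m N' - 1\<^sub>m n)) $$ (i, j) = (x \<cdot>\<^sub>m 1\<^sub>m n - N') $$ (i, j)"
          using ij N' xx[of "N' $$ (i, j)"] by (simp add: right_diff_distrib)
      qed (use N' in auto)
      ultimately show ?thesis by simp
    qed
    hence "poly (char_poly N') x = (- x) ^ n * (det N' * poly (char_poly N) (inverse x))"
      unfolding pe[OF N'] pe[OF N] using N N' B by (simp add: det_mult[OF N' B])
    also have "\<dots> = (\<Prod>e\<leftarrow>es. (- x) * (inverse x - e) / e)"
    proof -
      have "prod_list es * det N' = 1" using dd unfolding dN by (simp only: mult.commute)
      hence "det N' = inverse (prod_list es)" by (rule inverse_unique[symmetric])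
      moreover have "c ^ length es * (inverse (prod_list es) * (\<Prod>e\<leftarrow>es. f e)) = (\<Prod>e\<leftarrow>es. c * f e / e)"
        for c :: real and f
      proof (induction es)
        case (Cons e es)
        have "c ^ length (e # es) * (inverse (prod_list (e # es)) * (\<Prod>e\<leftarrow>e # es. f e)) =
            (c * f e / e) * (c ^ length es * (inverse (prod_list es) * (\<Prod>e\<leftarrow>es. f e)))"
          by (simp add: divide_inverse)
        thus ?case unfolding Cons by simp
      qed simp
      ultimately show ?thesis using len unfolding cp by (simp add: poly_prod_list o_def)
    qed
    also have "\<dots> = (\<Prod>e\<leftarrow>es. x - inverse e)"
    proof (intro arg_cong[where f=prod_list] map_cong refl)
      fix e assume "e \<in> set es"
      hence e: "e \<noteq> 0" using nz by blast
      have "(- x) * (inverse x - e) = x * e - 1" using x by (simp add: right_diff_distrib)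
      thus "(- x) * (inverse x - e) / e = x - inverse e"
        using e by (simp add: diff_divide_distrib inverse_eq_divide)
    qed
    also have "\<dots> = poly (\<Prod>e\<leftarrow>map inverse es. [:- e, 1:]) x"
      by (simp add: poly_prod_list o_def)
    finally show ?thesis .
  qed
  hence "- {0} \<subseteq> {x. poly (char_poly N' - (\<Prod>e\<leftarrow>map inverse es. [:- e, 1:])) x = 0}" by auto
  hence "infinite {x. poly (char_poly N' - (\<Prod>e\<leftarrow>map inverse es. [:- e, 1:])) x = 0}"
    by (rule infinite_super) (simp add: infinite_UNIV_char_0)
  hence "char_poly N' - (\<Prod>e\<leftarrow>map inverse es. [:- e, 1:]) = 0" using poly_roots_finite by blast
  thus ?thesis by simp
qed

text \<open>The k smallest singular values of \<open>M\<close> are the inverses of the k largest of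
  \<open>M'\<close>, so their product is at least 1 / (k! times the compound norm of
  \<open>M'\<close>). Dividing \<open>sv_prod n M\<close> by this product leaves the n - k
  largest.\<close>

lemma sv_prod_inverse:
  assumes M: "M \<in> carrier_mat n n" and M': "M' \<in> carrier_mat n n" and inv: "M' * M = 1\<^sub>m n"
    and k: "k \<le> n"
  shows "sv_prod (n - k) M \<le> fact k * compound_norm k M' * sv_prod n M"
proof -
  let ?s = "\<lambda>i. singular_values M ! i"
  let ?N = "transpose_mat M * M" and ?N' = "M' * transpose_mat M'"
  define es where "es = map inverse (map (\<lambda>x. x\<^sup>2) (singular_values M))"
  have N: "?N \<in> carrier_mat n n" "?N' \<in> carrier_mat n n" using M M' by auto
  have inv': "M * M' = 1\<^sub>m n" by (rule mat_mult_left_right_inverse[OF M' M inv])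
  have T: "transpose_mat M \<in> carrier_mat n n" "transpose_mat M' \<in> carrier_mat n n" using M M' by auto
  \<comment> \<open>\<open>?N'\<close> is both the inverse of the Gram matrix of \<open>M\<close>
    and the Gram matrix of the transpose of \<open>M'\<close>.\<close>
  have "?N' * ?N = M' * (transpose_mat M' * (transpose_mat M * M))"
    using T M M' by (intro assoc_mult_mat) auto
  also have "transpose_mat M' * (transpose_mat M * M) = (transpose_mat M' * transpose_mat M) * M"
    using T M by (intro assoc_mult_mat[symmetric]) auto
  also have "M' * \<dots> = M' * (transpose_mat M' * transpose_mat M) * M"
    using T M M' by (intro assoc_mult_mat[symmetric]) auto
  also have "transpose_mat M' * transpose_mat M = 1\<^sub>m n"
    using transpose_mult[OF M M'] inv' by simp
  finally have NN: "?N' * ?N = 1\<^sub>m n" using M' inv by simp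
  have cp: "char_poly ?N' = (\<Prod>e\<leftarrow>es. [:- e, 1:])"
    unfolding es_def by (rule char_poly_inverse[OF N NN singular_values_facts(4)[OF M]])
  have es: "es ! i = (inverse (?s i))\<^sup>2" if "i < n" for i
    using singular_values_facts(1)[OF M] that by (simp add: es_def power_inverse)
  have "det M' * det M = 1" using det_mult[OF M' M] inv by simp
  hence pos: "0 < sv_prod n M" unfolding sv_prod_eq_abs_det[OF M] by auto
  hence spos: "0 < ?s i" if "i < n" for i
  proof -
    have "?s i \<noteq> 0"
    proof
      assume "?s i = 0"
      hence "(\<Prod>a<n. ?s a) = 0" using that by (intro prod_zero) auto
      thus False using pos unfolding sv_prod_def by linarith
    qed
    thus ?thesis using singular_values_nonneg[OF M that] by simp
  qed
  \<comment> \<open>The last k positions of the nonincreasing list, where the smallest singular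
    values of \<open>M\<close> stand.\<close>
  define g where "g = restrict (\<lambda>a. n - k + a) {0..<k}"
  have g: "g \<in> idx k n" "inj_on g {0..<k}"
    using k by (auto simp: g_def idx_def inj_on_def)
  define p where "p = (\<Prod>a = 0..<k. ?s (n - k + a))"
  have sp: "sv_prod n M = sv_prod (n - k) M * p"
  proof -
    have "{..<n} = {..<n - k} \<union> (+) (n - k) ` {0..<k}"
    proof
      show "{..<n} \<subseteq> {..<n - k} \<union> (+) (n - k) ` {0..<k}"
      proof
        fix x assume x: "x \<in> {..<n}"
        show "x \<in> {..<n - k} \<union> (+) (n - k) ` {0..<k}"
        proof (cases "x < n - k")
          case False
          hence "x = (n - k) + (x - (n - k))" "x - (n - k) \<in> {0..<k}" using x k by auto
          thus ?thesis by blast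
        qed simp
      qed
    qed (use k in auto)
    hence "sv_prod n M = prod ?s ({..<n - k} \<union> (+) (n - k) ` {0..<k})" by (simp add: sv_prod_def)
    also have "\<dots> = prod ?s {..<n - k} * prod ?s ((+) (n - k) ` {0..<k})"
      by (intro prod.union_disjoint) auto
    also have "prod ?s ((+) (n - k) ` {0..<k}) = p"
      unfolding p_def by (subst prod.reindex) auto
    finally show ?thesis by (simp add: sv_prod_def)
  qed
  have es_nn: "0 \<le> (\<Prod>a = 0..<k. es ! h a)" if h: "h \<in> idx k n" for h
    using idx_less[OF h] by (intro prod_nonneg ballI) (simp add: es)
  have p: "0 < p" unfolding p_def using k by (intro prod_pos) (auto intro!: spos)
  have "(inverse p)\<^sup>2 = (\<Prod>a = 0..<k. es ! g a)"
  proof -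
    have "(\<Prod>a = 0..<k. es ! g a) = (\<Prod>a = 0..<k. (inverse (?s (n - k + a)))\<^sup>2)"
      using k by (intro prod.cong) (auto simp: es g_def)
    also have "\<dots> = (\<Prod>a = 0..<k. inverse (?s (n - k + a)))\<^sup>2" by (rule prod_power_distrib[symmetric])
    also have "(\<Prod>a = 0..<k. inverse (?s (n - k + a))) = inverse p"
      unfolding p_def using prod_inversef[of "\<lambda>a. ?s (n - k + a)"] by (simp only: o_def)
    finally show ?thesis by simp
  qed
  also have "\<dots> \<le> minor_trace k ?N'"
    unfolding minor_trace_eigenvalues(1)[OF N(2) cp]
    by (rule member_le_sum[of g]) (use g es_nn in auto)
  also have "\<dots> \<le> minor_ssq k (transpose_mat M')"
  proof -
    have "0 \<le> minor_trace k ?N'" unfolding minor_trace_eigenvalues(1)[OF N(2) cp]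
      by (intro sum_nonneg) (use es_nn in auto)
    moreover have "minor_ssq k (transpose_mat M') = fact k * minor_trace k ?N'"
      using minor_ssq_eq_trace[of "transpose_mat M'" n k] M' by simp
    ultimately show ?thesis using mult_right_mono[of 1 "fact k :: real"] by (simp add: fact_ge_1)
  qed
  also have "\<dots> = (fact k * compound_norm k M')\<^sup>2"
    by (simp add: compound_norm_square[symmetric] power_mult_distrib compound_norm_transpose[OF M'] mult.commute)
  finally have "inverse p \<le> fact k * compound_norm k M'"
    by (rule power2_le_imp_le) (simp add: compound_norm_nonneg)
  hence "inverse p * sv_prod n M \<le> fact k * compound_norm k M' * sv_prod n M"
    using pos by (intro mult_right_mono) auto
  moreover have "inverse p * sv_prod n M = sv_prod (n - k) M" unfolding sp using p by simp
  ultimately show ?thesis by simp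
qed

section \<open>Holomorphic functions on an annulus\<close>

definition closed_ring :: "real \<Rightarrow> complex set" where
  "closed_ring r = {z. 1 \<le> norm z \<and> norm z \<le> r}"

lemma compact_closed_ring: "compact (closed_ring r)"
proof -
  have "closed_ring r = cball 0 r - ball 0 1" by (auto simp: closed_ring_def dist_norm)
  thus ?thesis by (simp add: compact_diff)
qed

text \<open>Maximum principle for h / z ^ m, with the Hadamard exponent rounded up to an integer m
  so that the power is single valued. The rounding costs the summand \<open>ln r1\<close>.\<close>

lemma three_circles:
  assumes h: "h holomorphic_on closed_ring r2" and r: "1 < r1" "r1 < r2" and z1: "norm z1 = r1" "h z1 \<noteq> 0"
    and M1: "\<And>z. norm z = 1 \<Longrightarrow> norm (h z) \<le> M1" and M2: "\<And>z. norm z = r2 \<Longrightarrow> norm (h z) \<le> M2"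
    and pos: "0 < M1" "M1 \<le> M2"
  shows "ln (norm (h z1)) \<le> (1 - ln r1 / ln r2) * ln M1 + ln r1 / ln r2 * ln M2 + ln r1"
proof -
  have l2: "0 < ln r2" "0 < ln r1" using r by auto
  define m where "m = nat \<lceil>(ln M2 - ln M1) / ln r2\<rceil>"
  have q: "0 \<le> (ln M2 - ln M1) / ln r2" using pos l2 by auto
  have m: "(ln M2 - ln M1) / ln r2 \<le> real m" "real m \<le> (ln M2 - ln M1) / ln r2 + 1"
    using q by (auto simp: m_def)
  define f where "f z = h z / z ^ m" for z
  have fbound: "norm (f z) \<le> M1" if "norm z = 1 \<or> norm z = r2" for z
    using that
  proof
    assume "norm z = 1"
    thus ?thesis using M1[of z] by (simp add: f_def norm_divide norm_power)
  next
    assume z: "norm z = r2"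
    have "ln M2 \<le> ln M1 + real m * ln r2" using m(1) l2 by (simp add: field_simps)
    also have "\<dots> = ln (M1 * r2 ^ m)" using pos r by (simp add: ln_mult ln_realpow)
    finally have "M2 \<le> M1 * r2 ^ m" using pos r by (subst (asm) ln_le_cancel_iff) auto
    hence "norm (h z) \<le> M1 * r2 ^ m" using M2[OF z] by simp
    thus ?thesis using z r by (simp add: f_def norm_divide norm_power divide_le_eq)
  qed
  have fh: "f holomorphic_on closed_ring r2"
    unfolding f_def using h by (intro holomorphic_intros) (auto simp: closed_ring_def)
  have closed: "closed (closed_ring r2)" by (rule compact_imp_closed[OF compact_closed_ring])
  have op: "open {z::complex. 1 < norm z \<and> norm z < r2}"
    by (intro open_Collect_conj open_Collect_less continuous_intros)
  have sub: "{z. 1 < norm z \<and> norm z < r2} \<subseteq> interior (closed_ring r2)"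
    by (rule interior_maximal[OF _ op]) (auto simp: closed_ring_def)
  have "norm (f z1) \<le> M1"
  proof (rule maximum_modulus_frontier[of f "closed_ring r2"])
    show "f holomorphic_on interior (closed_ring r2)"
      by (rule holomorphic_on_subset[OF fh interior_subset])
    show "continuous_on (closure (closed_ring r2)) f"
      using holomorphic_on_imp_continuous_on[OF fh] closed by simp
    show "bounded (closed_ring r2)" by (rule compact_imp_bounded[OF compact_closed_ring])
    show "z1 \<in> closed_ring r2" using z1 r by (simp add: closed_ring_def)
    fix z assume "z \<in> frontier (closed_ring r2)"
    hence "z \<in> closed_ring r2" "z \<notin> interior (closed_ring r2)" using closed by (auto simp: frontier_def)
    hence "1 \<le> norm z" "norm z \<le> r2" "\<not> (1 < norm z \<and> norm z < r2)"
      using sub by (auto simp: closed_ring_def)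
    hence "norm z = 1 \<or> norm z = r2" by linarith
    thus "norm (f z) \<le> M1" by (rule fbound)
  qed
  hence "norm (h z1) \<le> M1 * r1 ^ m"
    using z1 r by (simp add: f_def norm_divide norm_power divide_le_eq)
  hence "ln (norm (h z1)) \<le> ln (M1 * r1 ^ m)"
    using z1 pos r by (subst ln_le_cancel_iff) auto
  also have "\<dots> = ln M1 + real m * ln r1" using pos r by (simp add: ln_mult ln_realpow)
  also have "\<dots> \<le> ln M1 + ((ln M2 - ln M1) / ln r2 + 1) * ln r1"
    using m(2) l2 by (intro add_left_mono mult_right_mono) auto
  also have "\<dots> = (1 - ln r1 / ln r2) * ln M1 + ln r1 / ln r2 * ln M2 + ln r1"
    using l2 by (simp add: field_simps)
  finally show ?thesis .
qed

text \<open>Three circles read backwards: a function large at one point of the middle circle and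
  controlled on the outer one cannot be small on the whole unit circle. There the unit circle has
  weight at least \<delta>, so the gap \<beta> - \<alpha> is amplified by at most 1 /
  \<delta>.\<close>

lemma three_circles_lower_bound:
  assumes h: "h holomorphic_on closed_ring r2" and r: "1 < r1" "r1 < r2" and z1: "norm z1 = r1"
    and \<delta>: "0 < \<delta>" "ln r1 \<le> (1 - \<delta>) * ln r2"
    and low: "exp (\<alpha> * n) \<le> norm (h z1)" and up: "\<And>z. norm z = r2 \<Longrightarrow> norm (h z) \<le> F * exp (\<beta> * n)"
    and F: "1 \<le> F" and \<alpha>\<beta>: "\<alpha> \<le> \<beta>" and n: "0 \<le> n"
  shows "\<exists>z. norm z = 1 \<and> exp (- ((ln r2 + 1 + ln F) / \<delta>)) * exp ((\<beta> - (\<beta> - \<alpha>) / \<delta>) * n) \<le> norm (h z)"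
proof (rule ccontr)
  define m1 where "m1 = - ((ln r2 + 1 + ln F) / \<delta>) + (\<beta> - (\<beta> - \<alpha>) / \<delta>) * n"
  define m2 where "m2 = ln F + \<beta> * n"
  assume "\<not> ?thesis"
  hence M1: "norm (h z) \<le> exp m1" if "norm z = 1" for z
    using that unfolding m1_def exp_add by (force simp: not_le intro: less_imp_le)
  have M2: "norm (h z) \<le> exp m2" if "norm z = r2" for z
    using up[OF that] F by (simp add: m2_def exp_add)
  have l2: "0 < ln r2" "0 < ln r1" "ln r1 < ln r2" using r by auto
  define t where "t = ln r1 / ln r2"
  have t: "0 < t" "t < 1" "\<delta> \<le> 1 - t" using l2 \<delta> by (auto simp: t_def field_simps)
  have lF: "0 \<le> ln F" using F by simp
  \<comment> \<open>The part \<open>ln r2 + 1\<close> outweighs the rounding loss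
    \<open>ln r1\<close> and makes the final inequality strict; \<open>ln F\<close> absorbs the
    prefactor of the upper bound.\<close>
  define u where "u = (ln r2 + 1 + ln F) + (\<beta> - \<alpha>) * n"
  have u: "0 \<le> u" unfolding u_def using l2 lF \<alpha>\<beta> n by simp
  have m1: "m1 = \<beta> * n - u / \<delta>" unfolding m1_def u_def by (simp add: field_simps diff_divide_distrib add_divide_distrib)
  have "0 \<le> u / \<delta>" using u \<delta> by simp
  hence le: "exp m1 \<le> exp m2" unfolding m1 m2_def using lF by simp
  have nz: "h z1 \<noteq> 0" using low by auto
  have "\<alpha> * n \<le> ln (norm (h z1))" using low nz by (subst ln_ge_iff) auto
  also have "\<dots> \<le> (1 - t) * ln (exp m1) + t * ln (exp m2) + ln r1"
    unfolding t_def by (rule three_circles[OF h r z1 nz M1 M2 _ le]) auto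
  also have "\<dots> = (1 - t) * (\<beta> * n) - (1 - t) * (u / \<delta>) + t * (ln F + \<beta> * n) + ln r1"
    by (simp add: m1 m2_def right_diff_distrib)
  also have "\<dots> \<le> (1 - t) * (\<beta> * n) - u + t * (ln F + \<beta> * n) + ln r1"
  proof -
    have "u = \<delta> * (u / \<delta>)" using \<delta> by simp
    also have "\<dots> \<le> (1 - t) * (u / \<delta>)" using t u \<delta> by (intro mult_right_mono) auto
    finally show ?thesis by simp
  qed
  also have "\<dots> = \<beta> * n + t * ln F - u + ln r1" by (simp add: algebra_simps)
  also have "\<dots> \<le> \<beta> * n + ln F - u + ln r1"
    using mult_right_mono[of t 1 "ln F"] t lF by simp
  also have "\<dots> = \<alpha> * n + ln r1 - ln r2 - 1" by (simp add: u_def algebra_simps)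
  finally show False using l2 by simp
qed

section \<open>Circles free of zeros\<close>

definition open_ring :: "real \<Rightarrow> complex set" where
  "open_ring \<rho> = {z. 1 - \<rho> < norm z \<and> norm z < 1 + \<rho>}"

lemma open_open_ring: "open (open_ring \<rho>)"
  unfolding open_ring_def by (intro open_Collect_conj open_Collect_less continuous_intros)

lemma connected_open_ring: "connected (open_ring \<rho>)"
proof -
  have "connected {x::complex. 1 - \<rho> < norm (x - 0) \<and> norm (x - 0) < 1 + \<rho>}"
    by (rule connected_annulus) simp
  thus ?thesis by (simp add: open_ring_def)
qed

lemma open_ring_subset_interior: "open_ring \<rho> \<subseteq> interior (annulus \<rho>)"
  by (rule interior_maximal[OF _ open_open_ring]) (auto simp: open_ring_def annulus_def)

text \<open>A nonconstant function has finitely many zeros in a compact ring, so all but finitely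
  many radii are good; a constant that is nonzero somewhere has no zeros.\<close>

lemma circle_avoiding_zeros:
  assumes f: "f holomorphic_on open_ring \<rho>" and nz: "z0 \<in> open_ring \<rho>" "f z0 \<noteq> 0"
    and r2: "1 < r2" "r2 < 1 + \<rho>"
  shows "\<exists>r. 1 < r \<and> r < r2 \<and> (\<forall>z. norm z = r \<longrightarrow> f z \<noteq> 0)"
proof (cases "f constant_on open_ring \<rho>")
  case True
  then obtain c where c: "\<And>z. z \<in> open_ring \<rho> \<Longrightarrow> f z = c" by (auto simp: constant_on_def)
  have "f z \<noteq> 0" if "norm z = (1 + r2) / 2" for z
  proof -
    have "z \<in> open_ring \<rho>" using that r2 by (auto simp: open_ring_def)
    thus ?thesis using c nz by metis
  qed
  thus ?thesis using r2 by (intro exI[of _ "(1 + r2) / 2"]) auto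
next
  case False
  have sub: "closed_ring r2 \<subseteq> open_ring \<rho>" using r2 by (auto simp: closed_ring_def open_ring_def)
  have fin: "finite {z \<in> closed_ring r2. f z = 0}"
    by (rule holomorphic_compact_finite_zeros[OF f open_open_ring connected_open_ring compact_closed_ring sub False])
  have "infinite {1<..<r2}" using r2 by simp
  hence "\<not> {1<..<r2} \<subseteq> norm ` {z \<in> closed_ring r2. f z = 0}" using fin by (meson finite_imageI finite_subset)
  then obtain r where r: "r \<in> {1<..<r2}" "r \<notin> norm ` {z \<in> closed_ring r2. f z = 0}" by blast
  have "f z \<noteq> 0" if "norm z = r" for z
    using that r by (auto simp: closed_ring_def image_iff)
  thus ?thesis using r by auto
qed

text \<open>No single circle need work for all parameters, but a circle good for \<open>p\<close>
  stays good near \<open>p\<close>. Since the property weakens as \<delta> shrinks, a finite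
  subcover and the least margin suffice.\<close>

lemma uniform_circle_avoiding_zeros:
  fixes \<Phi> :: "'p::metric_space \<Rightarrow> complex \<Rightarrow> complex"
  assumes K: "compact K" and r2: "1 < r2" "r2 < 1 + \<rho>"
    and holo: "\<And>p. p \<in> K \<Longrightarrow> \<Phi> p holomorphic_on open_ring \<rho>"
    and nz: "\<And>p. p \<in> K \<Longrightarrow> \<exists>z\<in>open_ring \<rho>. \<Phi> p z \<noteq> 0"
    and cont: "continuous_on (K \<times> closed_ring r2) (\<lambda>(p, z). \<Phi> p z)"
  shows "\<exists>\<delta>>0. \<forall>p\<in>K. \<exists>r. 1 < r \<and> r < r2 \<and> ln r \<le> (1 - \<delta>) * ln r2 \<and> (\<forall>z. norm z = r \<longrightarrow> \<delta> \<le> norm (\<Phi> p z))"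
proof -
  have l2: "0 < ln r2" using r2 by simp
  define P where "P \<delta> p \<longleftrightarrow> (\<exists>r. 1 < r \<and> r < r2 \<and> ln r \<le> (1 - \<delta>) * ln r2 \<and> (\<forall>z. norm z = r \<longrightarrow> \<delta> \<le> norm (\<Phi> p z)))"
    for \<delta> p
  have mono: "P \<delta>' p" if "P \<delta> p" "\<delta>' \<le> \<delta>" for \<delta> \<delta>' p
  proof -
    obtain r where r: "1 < r" "r < r2" "ln r \<le> (1 - \<delta>) * ln r2" "\<forall>z. norm z = r \<longrightarrow> \<delta> \<le> norm (\<Phi> p z)"
      using \<open>P \<delta> p\<close> unfolding P_def by blast
    have "(1 - \<delta>) * ln r2 \<le> (1 - \<delta>') * ln r2" using that l2 by (intro mult_right_mono) auto
    thus ?thesis unfolding P_def using r that(2) by (intro exI[of _ r]) (auto intro: order_trans)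
  qed
  have local: "\<exists>\<eta>>0. \<exists>\<delta>>0. \<forall>q\<in>K. dist q p < \<eta> \<longrightarrow> P \<delta> q" if p: "p \<in> K" for p
  proof -
    obtain z0 where z0: "z0 \<in> open_ring \<rho>" "\<Phi> p z0 \<noteq> 0" using nz[OF p] by blast
    obtain r where r: "1 < r" "r < r2" "\<And>z. norm z = r \<Longrightarrow> \<Phi> p z \<noteq> 0"
      using circle_avoiding_zeros[OF holo[OF p] z0 r2] by blast
    have circ: "sphere 0 r \<subseteq> closed_ring r2" using r by (auto simp: closed_ring_def)
    have contp: "continuous_on (sphere 0 r) (\<lambda>z. norm (\<Phi> p z))"
    proof -
      have "continuous_on (sphere 0 r) (\<lambda>z. (\<lambda>(p, z). \<Phi> p z) (p, z))"
        by (rule continuous_on_compose2[OF cont]) (use p circ in \<open>auto intro!: continuous_intros\<close>)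
      thus ?thesis by (auto intro: continuous_on_norm)
    qed
    have "of_real r \<in> sphere (0::complex) r" using r by simp
    hence ne: "sphere (0::complex) r \<noteq> {}" by blast
    obtain zm where zm: "zm \<in> sphere 0 r" "\<And>z. z \<in> sphere 0 r \<Longrightarrow> norm (\<Phi> p zm) \<le> norm (\<Phi> p z)"
      using continuous_attains_inf[OF compact_sphere ne contp] by blast
    define m where "m = norm (\<Phi> p zm)"
    have m: "0 < m" using zm r by (simp add: m_def)
    have "compact (K \<times> sphere (0::complex) r)" by (intro compact_Times K compact_sphere)
    moreover have "continuous_on (K \<times> sphere 0 r) (\<lambda>(p, z). \<Phi> p z)"
      by (rule continuous_on_subset[OF cont]) (use circ in auto)
    ultimately have "uniformly_continuous_on (K \<times> sphere 0 r) (\<lambda>(p, z). \<Phi> p z)"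
      by (rule compact_uniformly_continuous[rotated])
    moreover have "0 < m / 2" using m by simp
    ultimately obtain \<eta> where \<eta>: "0 < \<eta>"
      "\<And>x y. x \<in> K \<times> sphere 0 r \<Longrightarrow> y \<in> K \<times> sphere 0 r \<Longrightarrow> dist y x < \<eta> \<Longrightarrow>
        dist ((\<lambda>(p, z). \<Phi> p z) y) ((\<lambda>(p, z). \<Phi> p z) x) < m / 2"
      unfolding uniformly_continuous_on_def by metis
    \<comment> \<open>Half of the minimal modulus survives small changes of the parameter; the other
      bound keeps the radius logarithmically away from \<open>r2\<close>.\<close>
    define \<delta> where "\<delta> = min (m / 2) (1 - ln r / ln r2)"
    have lr: "ln r < ln r2" using r by simp
    have \<delta>: "0 < \<delta>" using m lr l2 by (auto simp: \<delta>_def field_simps)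
    have "P \<delta> q" if q: "q \<in> K" "dist q p < \<eta>" for q
    proof -
      have "\<delta> \<le> norm (\<Phi> q z)" if z: "norm z = r" for z
      proof -
        have "dist (\<Phi> q z) (\<Phi> p z) < m / 2"
          using \<eta>(2)[of "(p, z)" "(q, z)"] p q z by (simp add: dist_Pair_Pair)
        hence "norm (\<Phi> p z) - norm (\<Phi> q z) < m / 2"
          by (metis dist_norm norm_minus_commute norm_triangle_ineq2 order_le_less_trans)
        moreover have "m \<le> norm (\<Phi> p z)" using zm(2)[of z] z by (simp add: m_def)
        moreover have "\<delta> \<le> m / 2" unfolding \<delta>_def by (rule min.cobounded1)
        ultimately show ?thesis by simp
      qed
      moreover have "ln r \<le> (1 - \<delta>) * ln r2"
      proof -
        have "\<delta> \<le> 1 - ln r / ln r2" by (simp add: \<delta>_def)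
        hence "ln r / ln r2 \<le> 1 - \<delta>" by simp
        thus ?thesis using l2 by (simp add: pos_divide_le_eq)
      qed
      ultimately show ?thesis unfolding P_def using r by blast
    qed
    thus ?thesis using \<eta>(1) \<delta> by blast
  qed
  then obtain \<eta> \<delta> where \<eta>\<delta>: "\<And>p. p \<in> K \<Longrightarrow> 0 < \<eta> p \<and> 0 < \<delta> p \<and> (\<forall>q\<in>K. dist q p < \<eta> p \<longrightarrow> P (\<delta> p) q)"
    by metis
  have "K \<subseteq> (\<Union>p\<in>K. ball p (\<eta> p))" using \<eta>\<delta> by force
  then obtain C where C: "C \<subseteq> K" "finite C" "K \<subseteq> (\<Union>p\<in>C. ball p (\<eta> p))"
    using compactE_image[OF K, of K "\<lambda>p. ball p (\<eta> p)"] by auto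
  define \<delta>0 where "\<delta>0 = Min (insert 1 (\<delta> ` C))"
  have "0 < \<delta>0" unfolding \<delta>0_def using C \<eta>\<delta> by (subst Min_gr_iff) auto
  moreover have "P \<delta>0 q" if q: "q \<in> K" for q
  proof -
    obtain p where p: "p \<in> C" "dist p q < \<eta> p" using C q by force
    have "P (\<delta> p) q" using \<eta>\<delta>[of p] p C q by (auto simp: dist_commute)
    moreover have "\<delta>0 \<le> \<delta> p" unfolding \<delta>0_def using C p by (intro Min_le) auto
    ultimately show ?thesis by (rule mono)
  qed
  ultimately show ?thesis unfolding P_def by blast
qed

section \<open>Holomorphic matrices\<close>

definition holo_mat :: "complex set \<Rightarrow> nat \<Rightarrow> (complex \<Rightarrow> complex mat) \<Rightarrow> bool" where
  "holo_mat S n M \<longleftrightarrow> (\<forall>z\<in>S. M z \<in> carrier_mat n n) \<and>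
     (\<forall>i<n. \<forall>j<n. (\<lambda>z. M z $$ (i, j)) holomorphic_on S)"

lemma holo_mat_carrier: "holo_mat S n M \<Longrightarrow> z \<in> S \<Longrightarrow> M z \<in> carrier_mat n n"
  by (simp add: holo_mat_def)

lemma holo_mat_entry: "holo_mat S n M \<Longrightarrow> i < n \<Longrightarrow> j < n \<Longrightarrow> (\<lambda>z. M z $$ (i, j)) holomorphic_on S"
  by (simp add: holo_mat_def)

lemma holo_matI:
  assumes "\<And>z. z \<in> S \<Longrightarrow> M z \<in> carrier_mat n n"
    and "\<And>i j. i < n \<Longrightarrow> j < n \<Longrightarrow> \<exists>f. f holomorphic_on S \<and> (\<forall>z\<in>S. M z $$ (i, j) = f z)"
  shows "holo_mat S n M"
  unfolding holo_mat_def
proof (intro conjI ballI allI impI)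
  fix i j assume "i < n" "j < n"
  then obtain f where "f holomorphic_on S" "\<forall>z\<in>S. M z $$ (i, j) = f z" using assms(2) by blast
  thus "(\<lambda>z. M z $$ (i, j)) holomorphic_on S" by (metis holomorphic_transform)
qed (use assms(1) in auto)

lemma holo_minor:
  assumes "holo_mat S n M" "\<And>a. a < k \<Longrightarrow> f a < n" "\<And>a. a < k \<Longrightarrow> g a < n"
  shows "(\<lambda>z. minor k (M z) f g) holomorphic_on S"
  unfolding minor_Leibniz
proof (intro holomorphic_on_sum holomorphic_on_mult holomorphic_on_const holomorphic_on_prod)
  fix p a assume p: "p \<in> {p. p permutes {0..<k}}" and a: "a \<in> {0..<k}"
  hence "p a < k" using permutes_in_image[of p "{0..<k}" a] by simp
  thus "(\<lambda>z. M z $$ (f a, g (p a))) holomorphic_on S"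
    using a assms by (intro holo_mat_entry[OF assms(1)]) auto
qed

lemma holo_det:
  assumes M: "holo_mat S n M"
  shows "(\<lambda>z. det (M z)) holomorphic_on S"
proof (rule holomorphic_transform)
  show "(\<lambda>z. minor n (M z) id id) holomorphic_on S" by (rule holo_minor[OF M]) auto
  fix z assume "z \<in> S"
  hence "mat n n (\<lambda>(a, b). M z $$ (id a, id b)) = M z"
    using carrier_matD[OF holo_mat_carrier[OF M]] by (intro eq_matI) auto
  thus "minor n (M z) id id = det (M z)" by (simp add: minor_def)
qed

lemma holo_mat_const: "A \<in> carrier_mat n n \<Longrightarrow> holo_mat S n (\<lambda>_. A)"
  by (simp add: holo_mat_def)

lemma holo_mat_mult:
  assumes A: "holo_mat S n A" and B: "holo_mat S n B"
  shows "holo_mat S n (\<lambda>z. A z * B z)"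
proof (rule holo_matI)
  fix i j assume ij: "i < n" "j < n"
  show "\<exists>f. f holomorphic_on S \<and> (\<forall>z\<in>S. (A z * B z) $$ (i, j) = f z)"
  proof (intro exI conjI ballI)
    show "(\<lambda>z. \<Sum>k = 0..<n. A z $$ (i, k) * B z $$ (k, j)) holomorphic_on S"
      using ij by (intro holomorphic_on_sum holomorphic_on_mult holo_mat_entry[OF A] holo_mat_entry[OF B]) auto
    fix z assume "z \<in> S"
    hence "A z \<in> carrier_mat n n" "B z \<in> carrier_mat n n" using A B by (auto dest: holo_mat_carrier)
    thus "(A z * B z) $$ (i, j) = (\<Sum>k = 0..<n. A z $$ (i, k) * B z $$ (k, j))"
      using ij by (auto simp: scalar_prod_def)
  qed
next
  fix z assume "z \<in> S"
  thus "A z * B z \<in> carrier_mat n n"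
    by (intro mult_carrier_mat[of _ n n] holo_mat_carrier[OF A] holo_mat_carrier[OF B])
qed

lemma holo_mat_minus:
  assumes A: "holo_mat S n A" and B: "holo_mat S n B"
  shows "holo_mat S n (\<lambda>z. A z - B z)"
proof (rule holo_matI)
  fix i j assume ij: "i < n" "j < n"
  have "(A z - B z) $$ (i, j) = A z $$ (i, j) - B z $$ (i, j)" if "z \<in> S" for z
    using holo_mat_carrier[OF A that] holo_mat_carrier[OF B that] ij by simp
  moreover have "(\<lambda>z. A z $$ (i, j) - B z $$ (i, j)) holomorphic_on S"
    using ij by (intro holomorphic_on_diff holo_mat_entry[OF A] holo_mat_entry[OF B])
  ultimately show "\<exists>f. f holomorphic_on S \<and> (\<forall>z\<in>S. (A z - B z) $$ (i, j) = f z)" by blast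
next
  fix z assume "z \<in> S"
  thus "A z - B z \<in> carrier_mat n n" using A B by (auto dest!: holo_mat_carrier)
qed

lemma holo_mat_add:
  assumes A: "holo_mat S n A" and B: "holo_mat S n B"
  shows "holo_mat S n (\<lambda>z. A z + B z)"
proof (rule holo_matI)
  fix i j assume ij: "i < n" "j < n"
  have "(A z + B z) $$ (i, j) = A z $$ (i, j) + B z $$ (i, j)" if "z \<in> S" for z
    using holo_mat_carrier[OF A that] holo_mat_carrier[OF B that] ij by simp
  moreover have "(\<lambda>z. A z $$ (i, j) + B z $$ (i, j)) holomorphic_on S"
    using ij by (intro holomorphic_on_add holo_mat_entry[OF A] holo_mat_entry[OF B])
  ultimately show "\<exists>f. f holomorphic_on S \<and> (\<forall>z\<in>S. (A z + B z) $$ (i, j) = f z)" by blast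
next
  fix z assume "z \<in> S"
  thus "A z + B z \<in> carrier_mat n n" using A B by (auto dest!: holo_mat_carrier)
qed

lemma holo_mat_uminus:
  assumes A: "holo_mat S n A"
  shows "holo_mat S n (\<lambda>z. - A z)"
proof (rule holo_matI)
  fix i j assume ij: "i < n" "j < n"
  have "(- A z) $$ (i, j) = - (A z $$ (i, j))" if "z \<in> S" for z
    using holo_mat_carrier[OF A that] ij by simp
  moreover have "(\<lambda>z. - (A z $$ (i, j))) holomorphic_on S"
    using ij by (intro holomorphic_on_minus holo_mat_entry[OF A])
  ultimately show "\<exists>f. f holomorphic_on S \<and> (\<forall>z\<in>S. (- A z) $$ (i, j) = f z)" by blast
next
  fix z assume "z \<in> S"
  thus "- A z \<in> carrier_mat n n" using A by (auto dest!: holo_mat_carrier)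
qed

lemma holo_mat_smult:
  assumes A: "holo_mat S n A" and f: "f holomorphic_on S"
  shows "holo_mat S n (\<lambda>z. f z \<cdot>\<^sub>m A z)"
proof (rule holo_matI)
  fix i j assume ij: "i < n" "j < n"
  have "(f z \<cdot>\<^sub>m A z) $$ (i, j) = f z * A z $$ (i, j)" if "z \<in> S" for z
    using holo_mat_carrier[OF A that] ij by simp
  moreover have "(\<lambda>z. f z * A z $$ (i, j)) holomorphic_on S"
    using ij by (intro holomorphic_on_mult f holo_mat_entry[OF A])
  ultimately show "\<exists>f'. f' holomorphic_on S \<and> (\<forall>z\<in>S. (f z \<cdot>\<^sub>m A z) $$ (i, j) = f' z)" by blast
next
  fix z assume "z \<in> S"
  thus "f z \<cdot>\<^sub>m A z \<in> carrier_mat n n" using A by (auto dest!: holo_mat_carrier)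
qed

lemma holo_mat_transpose:
  assumes A: "holo_mat S n A"
  shows "holo_mat S n (\<lambda>z. transpose_mat (A z))"
proof (rule holo_matI)
  fix i j assume ij: "i < n" "j < n"
  have "transpose_mat (A z) $$ (i, j) = A z $$ (j, i)" if "z \<in> S" for z
    using holo_mat_carrier[OF A that] ij by simp
  thus "\<exists>f. f holomorphic_on S \<and> (\<forall>z\<in>S. transpose_mat (A z) $$ (i, j) = f z)"
    using holo_mat_entry[OF A ij(2,1)] by blast
next
  fix z assume "z \<in> S"
  thus "transpose_mat (A z) \<in> carrier_mat n n" using A by (auto dest!: holo_mat_carrier)
qed

text \<open>Deleting a row and a column is expressed by index maps that skip \<open>j\<close> and
  \<open>i\<close>, so holomorphy and determinant bounds carry over to the adjugate.\<close>

lemma adj_mat_entry_minor: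
  assumes "A \<in> carrier_mat n n" "i < n" "j < n"
  shows "adj_mat A $$ (i, j) =
    (- 1) ^ (j + i) * minor (n - 1) A (\<lambda>a. if a < j then a else Suc a) (\<lambda>b. if b < i then b else Suc b)"
  using assms by (simp add: adj_mat_def cofactor_def mat_delete_def minor_def)

lemma holo_mat_adj:
  assumes A: "holo_mat S n A"
  shows "holo_mat S n (\<lambda>z. adj_mat (A z))"
proof (rule holo_matI)
  fix i j assume ij: "i < n" "j < n"
  let ?f = "\<lambda>z. (- 1) ^ (j + i) * minor (n - 1) (A z) (\<lambda>a. if a < j then a else Suc a) (\<lambda>b. if b < i then b else Suc b)"
  have "?f holomorphic_on S"
    by (intro holomorphic_on_mult holomorphic_on_const holo_minor[OF A]) auto
  moreover have "adj_mat (A z) $$ (i, j) = ?f z" if "z \<in> S" for z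
    using adj_mat_entry_minor[OF holo_mat_carrier[OF A that] ij] .
  ultimately show "\<exists>f. f holomorphic_on S \<and> (\<forall>z\<in>S. adj_mat (A z) $$ (i, j) = f z)" by blast
next
  fix z assume "z \<in> S"
  thus "adj_mat (A z) \<in> carrier_mat n n" using A by (auto dest!: holo_mat_carrier intro: adj_mat(1))
qed

lemma holo_mat_four_block:
  assumes A: "holo_mat S n A" and B: "holo_mat S n B" and C: "holo_mat S n C" and D: "holo_mat S n D"
  shows "holo_mat S (n + n) (\<lambda>z. four_block_mat (A z) (B z) (C z) (D z))"
proof (rule holo_matI)
  fix i j assume ij: "i < n + n" "j < n + n"
  let ?f = "\<lambda>z. if i < n then if j < n then A z $$ (i, j) else B z $$ (i, j - n)
    else if j < n then C z $$ (i - n, j) else D z $$ (i - n, j - n)"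
  have "?f holomorphic_on S"
  proof (cases "i < n")
    case True
    thus ?thesis using ij holo_mat_entry[OF A] holo_mat_entry[OF B] by (cases "j < n") auto
  next
    case False
    thus ?thesis using ij holo_mat_entry[OF C] holo_mat_entry[OF D] by (cases "j < n") auto
  qed
  moreover have "four_block_mat (A z) (B z) (C z) (D z) $$ (i, j) = ?f z" if "z \<in> S" for z
    using holo_mat_carrier[OF A that] holo_mat_carrier[OF B that] holo_mat_carrier[OF C that]
      holo_mat_carrier[OF D that] ij by simp
  ultimately show "\<exists>f. f holomorphic_on S \<and> (\<forall>z\<in>S. four_block_mat (A z) (B z) (C z) (D z) $$ (i, j) = f z)"
    by blast
next
  fix z assume "z \<in> S"
  thus "four_block_mat (A z) (B z) (C z) (D z) \<in> carrier_mat (n + n) (n + n)"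
    using A D by (auto dest!: holo_mat_carrier intro: four_block_carrier_mat)
qed

lemma open_ring_rotate: "norm u = 1 \<Longrightarrow> z * u \<in> open_ring \<rho> \<longleftrightarrow> z \<in> open_ring \<rho>"
  by (simp add: open_ring_def norm_mult)

lemma holomorphic_on_rotate:
  assumes "f holomorphic_on open_ring \<rho>" "norm u = 1"
  shows "(\<lambda>z. f (z * u)) holomorphic_on open_ring \<rho>"
proof -
  have "f \<circ> (\<lambda>z. z * u) holomorphic_on open_ring \<rho>"
    by (rule holomorphic_on_compose_gen[OF _ assms(1)])
       (use open_ring_rotate[OF assms(2)] in \<open>auto intro!: holomorphic_intros\<close>)
  thus ?thesis by (simp add: o_def)
qed

lemma holo_mat_rotate:
  assumes "holo_mat (open_ring \<rho>) n M" "norm u = 1"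
  shows "holo_mat (open_ring \<rho>) n (\<lambda>z. M (z * u))"
  using assms holomorphic_on_rotate[OF _ assms(2)] open_ring_rotate[OF assms(2)]
  unfolding holo_mat_def by blast

section \<open>Entry bounds and quantitative injectivity\<close>

definition entries_le :: "real \<Rightarrow> 'a::real_normed_field mat \<Rightarrow> bool" where
  "entries_le c A \<longleftrightarrow> (\<forall>i<dim_row A. \<forall>j<dim_col A. norm (A $$ (i, j)) \<le> c)"

lemma entries_le_mult:
  assumes A: "A \<in> carrier_mat n n" "entries_le a A" and B: "B \<in> carrier_mat n n" "entries_le b B" and "0 \<le> a"
  shows "entries_le (real n * (a * b)) (A * B)"
  unfolding entries_le_def
proof (intro allI impI)
  fix i j assume "i < dim_row (A * B)" "j < dim_col (A * B)"
  hence ij: "i < n" "j < n" using A B by auto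
  have "norm ((A * B) $$ (i, j)) = norm (\<Sum>k = 0..<n. A $$ (i, k) * B $$ (k, j))"
    using A B ij by (simp add: scalar_prod_def)
  also have "\<dots> \<le> (\<Sum>k = 0..<n. a * b)"
  proof (rule sum_norm_le)
    fix k assume "k \<in> {0..<n}"
    hence "norm (A $$ (i, k)) \<le> a" "norm (B $$ (k, j)) \<le> b" using A B ij by (auto simp: entries_le_def)
    thus "norm (A $$ (i, k) * B $$ (k, j)) \<le> a * b"
      unfolding norm_mult using \<open>0 \<le> a\<close> by (intro mult_mono) auto
  qed
  finally show "norm ((A * B) $$ (i, j)) \<le> real n * (a * b)" by simp
qed

lemma entries_le_adj:
  assumes A: "A \<in> carrier_mat n n" "entries_le c A"
  shows "entries_le (fact (n - 1) * c ^ (n - 1)) (adj_mat A)"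
  unfolding entries_le_def
proof (intro allI impI)
  fix i j assume "i < dim_row (adj_mat A)" "j < dim_col (adj_mat A)"
  hence ij: "i < n" "j < n" using A by (auto simp: adj_mat_def)
  have "norm (adj_mat A $$ (i, j)) = norm (minor (n - 1) A (\<lambda>a. if a < j then a else Suc a) (\<lambda>b. if b < i then b else Suc b))"
    unfolding adj_mat_entry_minor[OF A(1) ij] by (simp add: norm_mult norm_power)
  also have "\<dots> \<le> fact (n - 1) * c ^ (n - 1)"
    unfolding minor_def by (rule norm_det_le) (use A ij in \<open>auto simp: entries_le_def\<close>)
  finally show "norm (adj_mat A $$ (i, j)) \<le> fact (n - 1) * c ^ (n - 1)" .
qed

lemma entries_le_mono: "entries_le c A \<Longrightarrow> c \<le> c' \<Longrightarrow> entries_le c' A"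
  unfolding entries_le_def by (meson order_trans)

lemma holo_mat_entries_bounded:
  assumes M: "holo_mat S n M" and K: "compact K" "K \<subseteq> S"
  shows "\<exists>C\<ge>1. \<forall>z\<in>K. entries_le C (M z)"
proof -
  have "\<exists>c. \<forall>z\<in>K. norm (M z $$ (i, j)) \<le> c" if "i < n" "j < n" for i j
  proof -
    have "compact ((\<lambda>z. M z $$ (i, j)) ` K)"
      using holomorphic_on_imp_continuous_on[OF holo_mat_entry[OF M that]] K
      by (intro compact_continuous_image) (auto intro: continuous_on_subset)
    hence "bounded ((\<lambda>z. M z $$ (i, j)) ` K)" by (rule compact_imp_bounded)
    thus ?thesis by (auto simp: bounded_iff)
  qed
  then obtain c where c: "\<And>i j z. i < n \<Longrightarrow> j < n \<Longrightarrow> z \<in> K \<Longrightarrow> norm (M z $$ (i, j)) \<le> c i j" by metis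
  define C where "C = Max (insert 1 ((\<lambda>(i, j). c i j) ` ({..<n} \<times> {..<n})))"
  have "c i j \<le> C" if "i < n" "j < n" for i j
    unfolding C_def using that by (intro Max_ge) force+
  hence "norm (M z $$ (i, j)) \<le> C" if "i < n" "j < n" "z \<in> K" for i j z
    using c[OF that] that by (meson order_trans)
  hence "\<forall>z\<in>K. entries_le C (M z)"
    using carrier_matD[OF holo_mat_carrier[OF M]] K unfolding entries_le_def by auto
  moreover have "1 \<le> C" unfolding C_def by (intro Max_ge) auto
  ultimately show ?thesis by blast
qed

definition vnorm :: "complex Matrix.vec \<Rightarrow> real" where
  "vnorm v = (\<Sum>i<dim_vec v. norm (v $ i))"

lemma vnorm_nonneg: "0 \<le> vnorm v"
  unfolding vnorm_def by (intro sum_nonneg) auto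

lemma vnorm_add_ge: "v \<in> carrier_vec n \<Longrightarrow> w \<in> carrier_vec n \<Longrightarrow> vnorm v - vnorm w \<le> vnorm (v + w)"
proof -
  assume v: "v \<in> carrier_vec n" "w \<in> carrier_vec n"
  have "vnorm v - vnorm w = (\<Sum>i<n. norm (v $ i) - norm (w $ i))"
    using v by (simp add: vnorm_def sum_subtractf)
  also have "\<dots> \<le> (\<Sum>i<n. norm (v $ i + w $ i))"
    by (intro sum_mono norm_diff_ineq)
  also have "\<dots> = vnorm (v + w)" using v by (simp add: vnorm_def)
  finally show ?thesis .
qed

lemma vnorm_smult: "vnorm (c \<cdot>\<^sub>v v) = norm c * vnorm v"
  unfolding vnorm_def by (simp add: norm_mult sum_distrib_left)

lemma vnorm_pos:
  assumes "v \<in> carrier_vec n" "v \<noteq> 0\<^sub>v n"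
  shows "0 < vnorm v"
proof -
  obtain i where "i < n" "v $ i \<noteq> 0" using assms by (metis carrier_vecD eq_vecI index_zero_vec)
  thus ?thesis unfolding vnorm_def using assms by (intro sum_pos2[of _ i]) auto
qed

lemma vnorm_mult_mat_vec_le:
  assumes A: "A \<in> carrier_mat n n" "entries_le c A" and v: "v \<in> carrier_vec n"
  shows "vnorm (A *\<^sub>v v) \<le> real n * c * vnorm v"
proof -
  have "vnorm (A *\<^sub>v v) = (\<Sum>i<n. norm (\<Sum>j = 0..<n. A $$ (i, j) * v $ j))"
    using A v by (simp add: vnorm_def scalar_prod_def)
  also have "\<dots> \<le> (\<Sum>i<n. \<Sum>j = 0..<n. c * norm (v $ j))"
    using A by (intro sum_mono sum_norm_le) (auto simp: entries_le_def norm_mult intro!: mult_right_mono)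
  also have "\<dots> = real n * c * vnorm v"
    using v by (simp add: vnorm_def sum_distrib_left lessThan_atLeast0 mult.assoc)
  finally show ?thesis .
qed

text \<open>The adjugate turns A v into det A times v. A bound on the adjugate and a lower bound on
  the determinant thus measure injectivity without an inverse.\<close>

lemma vnorm_mult_mat_vec_ge:
  assumes A: "A \<in> carrier_mat n n" and adj: "entries_le c (adj_mat A)" and v: "v \<in> carrier_vec n"
  shows "norm (det A) * vnorm v \<le> real n * c * vnorm (A *\<^sub>v v)"
proof -
  have "adj_mat A *\<^sub>v (A *\<^sub>v v) = (adj_mat A * A) *\<^sub>v v"
    by (rule assoc_mult_mat_vec[symmetric, OF adj_mat(1)[OF A] A v])
  also have "\<dots> = det A \<cdot>\<^sub>v v"
    unfolding adj_mat(3)[OF A] using v by (intro eq_vecI) auto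
  finally have "norm (det A) * vnorm v = vnorm (adj_mat A *\<^sub>v (A *\<^sub>v v))" by (simp add: vnorm_smult)
  also have "\<dots> \<le> real n * c * vnorm (A *\<^sub>v v)"
    by (rule vnorm_mult_mat_vec_le[OF adj_mat(1)[OF A] adj]) (use A v in auto)
  finally show ?thesis .
qed

text \<open>The same with the two factors exchanged; it serves the adjugate of W, which replaces the
  inverse in the pole-free cocycle.\<close>

lemma adj_mult_mat_vec_ge:
  assumes A: "A \<in> carrier_mat n n" and c: "entries_le c A" and v: "v \<in> carrier_vec n"
  shows "norm (det A) * vnorm v \<le> real n * c * vnorm (adj_mat A *\<^sub>v v)"
proof -
  have "A *\<^sub>v (adj_mat A *\<^sub>v v) = (A * adj_mat A) *\<^sub>v v"
    by (rule assoc_mult_mat_vec[symmetric, OF A adj_mat(1)[OF A] v])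
  also have "\<dots> = det A \<cdot>\<^sub>v v"
    unfolding adj_mat(2)[OF A] using v by (intro eq_vecI) auto
  finally have "norm (det A) * vnorm v = vnorm (A *\<^sub>v (adj_mat A *\<^sub>v v))" by (simp add: vnorm_smult)
  also have "\<dots> \<le> real n * c * vnorm (adj_mat A *\<^sub>v v)"
    by (rule vnorm_mult_mat_vec_le[OF A c]) (use adj_mat(1)[OF A] v in auto)
  finally show ?thesis .
qed

text \<open>Testing with eigenvectors shows that every eigenvalue has modulus at least \<sigma>, and
  the determinant is the product of the n eigenvalues.\<close>

lemma det_ge_of_expanding:
  fixes Z :: "complex mat"
  assumes Z: "Z \<in> carrier_mat n n" and exp: "\<And>v. v \<in> carrier_vec n \<Longrightarrow> \<sigma> * vnorm v \<le> vnorm (Z *\<^sub>v v)"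
    and "0 \<le> \<sigma>"
  shows "\<sigma> ^ n \<le> norm (det Z)"
proof -
  obtain es where es: "char_poly Z = (\<Prod>e\<leftarrow>es. [:- e, 1:])" "length es = n"
    using char_poly_factorized[OF Z] by blast
  obtain T P Q where TPQ: "schur_decomposition Z es = (T, P, Q)" by (cases "schur_decomposition Z es") auto
  from schur_decomposition[OF Z es(1) this]
  have sim: "similar_mat_wit Z T P Q" and ut: "upper_triangular T" and diag: "diag_mat T = es" by auto
  have T: "T \<in> carrier_mat n n" using similar_mat_witD2[OF Z sim] by simp
  have det: "det Z = prod_list es"
    using det_similar[of Z T] sim det_upper_triangular[OF ut T] diag by (auto simp: similar_mat_def)
  have "\<sigma> \<le> norm e" if e: "e \<in> set es" for e
  proof -
    have "0 = (\<lambda>x. poly [:- x, 1:] e) e" by simp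
    hence "0 \<in> set (map (\<lambda>x. poly [:- x, 1:] e) es)" using e unfolding set_map by (rule image_eqI)
    hence "poly (char_poly Z) e = 0"
      unfolding es(1) poly_prod_list prod_list_zero_iff by (simp add: o_def)
    hence "eigenvalue Z e" using eigenvalue_root_char_poly[OF Z] by simp
    then obtain v where v: "v \<in> carrier_vec n" "v \<noteq> 0\<^sub>v n" "Z *\<^sub>v v = e \<cdot>\<^sub>v v"
      using Z by (auto simp: eigenvalue_def eigenvector_def)
    have "\<sigma> * vnorm v \<le> norm e * vnorm v" using exp[OF v(1)] v(3) by (simp add: vnorm_smult)
    thus ?thesis using vnorm_pos[OF v(1,2)] by (simp add: mult_le_cancel_right)
  qed
  hence "\<sigma> ^ length es \<le> norm (prod_list es)"
  proof (induction es)
    case (Cons e es)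
    hence "\<sigma> * \<sigma> ^ length es \<le> norm e * norm (prod_list es)"
      using \<open>0 \<le> \<sigma>\<close> by (intro mult_mono) auto
    thus ?case by (simp add: norm_mult)
  qed simp
  thus ?thesis using es(2) det by simp
qed

section \<open>The transfer matrices on the annulus\<close>

lemma continuous_on_det:
  fixes N :: "'p::topological_space \<Rightarrow> complex mat"
  assumes N: "\<And>x. x \<in> S \<Longrightarrow> N x \<in> carrier_mat n n"
    and c: "\<And>i j. i < n \<Longrightarrow> j < n \<Longrightarrow> continuous_on S (\<lambda>x. N x $$ (i, j))"
  shows "continuous_on S (\<lambda>x. det (N x))"
proof -
  have "continuous_on S (\<lambda>x. \<Sum>p | p permutes {0..<n}. signof p * (\<Prod>i = 0..<n. N x $$ (i, p i)))"
  proof (intro continuous_on_sum continuous_on_mult continuous_on_const continuous_on_prod)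
    fix p i assume p: "p \<in> {p. p permutes {0..<n}}" and i: "i \<in> {0..<n}"
    hence "p i < n" using permutes_in_image[of p "{0..<n}" i] by simp
    thus "continuous_on S (\<lambda>x. N x $$ (i, p i))" using i by (intro c) auto
  qed
  thus ?thesis by (rule continuous_on_eq) (simp add: det_def'[OF N])
qed

text \<open>\<open>nondegenerate\<close> covers all directions (a, b), hence E / \<open>lam\<close>
  including infinity. It speaks of the product with det FW so that a single circle serves both
  determinants.\<close>

locale schroedinger_extension =
  fixes d :: nat and \<rho> :: real and FW FR FD :: "complex \<Rightarrow> complex mat"
  assumes d: "1 \<le> d" and \<rho>: "0 < \<rho>"
    and FW: "holo_mat (open_ring \<rho>) d FW" and FR: "holo_mat (open_ring \<rho>) d FR"
    and FD: "holo_mat (open_ring \<rho>) d FD"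
    and nondegenerate: "\<And>a b :: real. a\<^sup>2 + b\<^sup>2 = 1 \<Longrightarrow> \<exists>z\<in>open_ring \<rho>.
      det (complex_of_real a \<cdot>\<^sub>m FD z + complex_of_real b \<cdot>\<^sub>m 1\<^sub>m d) * det (FW z) \<noteq> 0"
begin

text \<open>Strictly below 1 + \<rho>, so that the closed ring is a compact subset of the domain of
  holomorphy.\<close>

definition outer :: real where "outer = 1 + \<rho> / 2"

lemma outer: "1 < outer" "outer < 1 + \<rho>" using \<rho> by (auto simp: outer_def)

lemma closed_ring_subset: "closed_ring outer \<subseteq> open_ring \<rho>"
  using outer \<rho> by (auto simp: closed_ring_def open_ring_def)

definition pencil :: "real \<Rightarrow> real \<Rightarrow> complex \<Rightarrow> complex mat" where
  "pencil a b z = complex_of_real a \<cdot>\<^sub>m FD z + complex_of_real b \<cdot>\<^sub>m 1\<^sub>m d"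

lemma pencil_entry:
  assumes "z \<in> open_ring \<rho>" "i < d" "j < d"
  shows "pencil a b z $$ (i, j) = complex_of_real a * FD z $$ (i, j) + complex_of_real b * (if i = j then 1 else 0)"
  using holo_mat_carrier[OF FD assms(1)] assms by (simp add: pencil_def)

lemma holo_pencil: "holo_mat (open_ring \<rho>) d (pencil a b)"
  unfolding pencil_def
  by (intro holo_mat_add holo_mat_smult FD holo_mat_const holomorphic_on_const) simp

text \<open>The radius depends on (a, b); only the margin \<delta> is common, and it also bounds
  from below the weight of the unit circle in three circles.\<close>

lemma uniform_good_circle:
  "\<exists>\<delta>>0. \<forall>a b. a\<^sup>2 + b\<^sup>2 = 1 \<longrightarrow> (\<exists>r. 1 < r \<and> r < outer \<and> ln r \<le> (1 - \<delta>) * ln outer \<and>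
     (\<forall>z. norm z = r \<longrightarrow> \<delta> \<le> norm (det (pencil a b z) * det (FW z))))"
proof -
  let ?\<Phi> = "\<lambda>p :: real \<times> real. \<lambda>z. det (pencil (fst p) (snd p) z) * det (FW z)"
  let ?S = "sphere (0 :: real \<times> real) 1 \<times> closed_ring outer"
  have unit: "p \<in> sphere 0 1 \<longleftrightarrow> (fst p)\<^sup>2 + (snd p)\<^sup>2 = 1" for p :: "real \<times> real"
    by (cases p) (simp add: norm_Pair)
  have FDc: "continuous_on ?S (\<lambda>x. FD (snd x) $$ (i, j))" if "i < d" "j < d" for i j
    by (rule continuous_on_compose2[OF holomorphic_on_imp_continuous_on[OF holo_mat_entry[OF FD that]]])
       (use closed_ring_subset in \<open>auto intro!: continuous_intros\<close>)
  have "continuous_on ?S (\<lambda>x. det (pencil (fst (fst x)) (snd (fst x)) (snd x)))"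
  proof (rule continuous_on_det)
    fix x assume "x \<in> ?S"
    thus "pencil (fst (fst x)) (snd (fst x)) (snd x) \<in> carrier_mat d d"
      using closed_ring_subset by (intro holo_mat_carrier[OF holo_pencil]) auto
  next
    fix i j assume ij: "i < d" "j < d"
    have "continuous_on ?S (\<lambda>x. complex_of_real (fst (fst x)) * FD (snd x) $$ (i, j)
        + complex_of_real (snd (fst x)) * (if i = j then 1 else 0))"
      by (intro continuous_on_add continuous_on_mult FDc[OF ij] continuous_on_of_real continuous_intros)
    thus "continuous_on ?S (\<lambda>x. pencil (fst (fst x)) (snd (fst x)) (snd x) $$ (i, j))"
      by (rule continuous_on_eq) (simp only: mem_Times_iff pencil_entry[OF subsetD[OF closed_ring_subset] ij])
  qed
  moreover have "continuous_on ?S (\<lambda>x. det (FW (snd x)))"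
    by (rule continuous_on_compose2[OF holomorphic_on_imp_continuous_on[OF holo_det[OF FW]]])
       (use closed_ring_subset in \<open>auto intro!: continuous_intros\<close>)
  ultimately have "continuous_on ?S (\<lambda>(p, z). ?\<Phi> p z)"
    unfolding case_prod_unfold by (intro continuous_on_mult)
  then have "\<exists>\<delta>>0. \<forall>p\<in>sphere 0 1. \<exists>r. 1 < r \<and> r < outer \<and> ln r \<le> (1 - \<delta>) * ln outer \<and>
      (\<forall>z. norm z = r \<longrightarrow> \<delta> \<le> norm (?\<Phi> p z))"
  proof (intro uniform_circle_avoiding_zeros[OF compact_sphere outer]
        holomorphic_on_mult holo_det[OF FW] holo_det[OF holo_pencil])
    fix p :: "real \<times> real" assume "p \<in> sphere 0 1"
    thus "\<exists>z\<in>open_ring \<rho>. ?\<Phi> p z \<noteq> 0"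
      unfolding unit pencil_def by (rule nondegenerate)
  qed
  then obtain \<delta> where \<delta>: "\<delta> > 0" "\<And>p. p \<in> sphere 0 1 \<Longrightarrow> \<exists>r. 1 < r \<and> r < outer \<and>
      ln r \<le> (1 - \<delta>) * ln outer \<and> (\<forall>z. norm z = r \<longrightarrow> \<delta> \<le> norm (?\<Phi> p z))" by blast
  show ?thesis
  proof (rule exI[of _ \<delta>], intro conjI allI impI \<delta>(1))
    fix a b :: real assume "a\<^sup>2 + b\<^sup>2 = 1"
    hence "(a, b) \<in> sphere 0 1" unfolding unit by simp
    from \<delta>(2)[OF this] show "\<exists>r. 1 < r \<and> r < outer \<and> ln r \<le> (1 - \<delta>) * ln outer \<and>
        (\<forall>z. norm z = r \<longrightarrow> \<delta> \<le> norm (det (pencil a b z) * det (FW z)))" by (simp only: fst_conv snd_conv)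
  qed
qed

lemma uniform_entry_bound:
  "\<exists>K\<ge>1. \<forall>z\<in>closed_ring outer. entries_le K (FW z) \<and> entries_le K (FR z) \<and> entries_le K (FD z) \<and>
     entries_le K (adj_mat (FW z)) \<and> norm (det (FW z)) \<le> K \<and>
     (\<forall>a b. a\<^sup>2 + b\<^sup>2 = 1 \<longrightarrow> entries_le K (adj_mat (pencil a b z)) \<and> norm (det (pencil a b z)) \<le> K)"
proof -
  obtain C1 where C1: "1 \<le> C1" "\<forall>z\<in>closed_ring outer. entries_le C1 (FW z)"
    using holo_mat_entries_bounded[OF FW compact_closed_ring closed_ring_subset] by blast
  obtain C2 where C2: "1 \<le> C2" "\<forall>z\<in>closed_ring outer. entries_le C2 (FR z)"
    using holo_mat_entries_bounded[OF FR compact_closed_ring closed_ring_subset] by blast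
  obtain C3 where C3: "1 \<le> C3" "\<forall>z\<in>closed_ring outer. entries_le C3 (FD z)"
    using holo_mat_entries_bounded[OF FD compact_closed_ring closed_ring_subset] by blast
  \<comment> \<open>Doubling the sum leaves room for the entries of the pencil, which are at most
    \<open>C3 + 1\<close>.\<close>
  define C where "C = 2 * (C1 + C2 + C3)"
  have C: "1 \<le> C" using C1 C2 C3 by (simp add: C_def)
  \<comment> \<open>The Leibniz bound for determinants; since \<open>C \<ge> 1\<close>, it also
    dominates adjugates and single entries.\<close>
  define K where "K = fact d * C ^ d"
  have pow: "C ^ (d - 1) \<le> C ^ d" "C ^ 1 \<le> C ^ d"
    using power_increasing[of "d - 1" d C] power_increasing[of 1 d C] C d by simp_all
  have f1: "(1::real) \<le> fact d" by (rule fact_ge_1)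
  have KC: "C \<le> K"
  proof -
    have "1 * C ^ 1 \<le> fact d * C ^ d" by (intro mult_mono f1 pow) (use C in auto)
    thus ?thesis unfolding K_def by (simp only: mult_1 power_one_right)
  qed
  have fd: "(fact (d - 1) :: real) \<le> fact d" by (rule fact_mono) simp
  have Kadj: "fact (d - 1) * C ^ (d - 1) \<le> K"
    unfolding K_def using pow fd C by (intro mult_mono) auto
  show ?thesis
  proof (intro exI[of _ K] conjI ballI allI impI)
    show "1 \<le> K" using C KC by simp
    fix z assume z: "z \<in> closed_ring outer"
    hence zo: "z \<in> open_ring \<rho>" using closed_ring_subset by blast
    have W: "entries_le C (FW z)"
      using C1 C2 C3 by (intro entries_le_mono[OF bspec[OF C1(2) z]]) (simp add: C_def)
    have le: "C1 \<le> C" "C2 \<le> C" "C3 \<le> C" using C1(1) C2(1) C3(1) by (simp_all add: C_def)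
    have "C1 \<le> K" by (rule order_trans[OF le(1) KC])
    thus "entries_le K (FW z)" by (rule entries_le_mono[OF bspec[OF C1(2) z]])
    have "C2 \<le> K" by (rule order_trans[OF le(2) KC])
    thus "entries_le K (FR z)" by (rule entries_le_mono[OF bspec[OF C2(2) z]])
    have "C3 \<le> K" by (rule order_trans[OF le(3) KC])
    thus "entries_le K (FD z)" by (rule entries_le_mono[OF bspec[OF C3(2) z]])
    show "entries_le K (adj_mat (FW z))"
      by (rule entries_le_mono[OF entries_le_adj[OF holo_mat_carrier[OF FW zo] W] Kadj])
    show "norm (det (FW z)) \<le> K"
      unfolding K_def using W holo_mat_carrier[OF FW zo]
      by (intro norm_det_le) (auto simp: entries_le_def)
    fix a b :: real assume ab: "a\<^sup>2 + b\<^sup>2 = 1"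
    have "a\<^sup>2 \<le> 1" "b\<^sup>2 \<le> 1" using ab zero_le_power2[of a] zero_le_power2[of b] by linarith+
    hence ab1: "\<bar>a\<bar> \<le> 1" "\<bar>b\<bar> \<le> 1" unfolding abs_square_le_1 by - assumption+
    have P: "pencil a b z \<in> carrier_mat d d" by (rule holo_mat_carrier[OF holo_pencil zo])
    have Pe: "norm (pencil a b z $$ (i, j)) \<le> C" if ij: "i < d" "j < d" for i j
    proof -
      have "norm (pencil a b z $$ (i, j)) \<le> \<bar>a\<bar> * norm (FD z $$ (i, j)) + \<bar>b\<bar> * 1"
        unfolding pencil_entry[OF zo ij]
        by (rule norm_triangle_le) (auto simp: norm_mult)
      also have "\<dots> \<le> 1 * C3 + 1"
        using ab1 C3 z ij carrier_matD[OF holo_mat_carrier[OF FD zo]]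
        by (intro add_mono mult_mono) (auto simp: entries_le_def)
      also have "\<dots> \<le> C" using C1 C2 C3 by (simp add: C_def)
      finally show ?thesis .
    qed
    hence Pl: "entries_le C (pencil a b z)" using P by (simp add: entries_le_def)
    show "entries_le K (adj_mat (pencil a b z))"
      by (rule entries_le_mono[OF entries_le_adj[OF P Pl] Kadj])
    show "norm (det (pencil a b z)) \<le> K"
      unfolding K_def by (rule norm_det_le[OF P Pe])
  qed
qed

section \<open>Pole-free transfer matrices\<close>

definition energy_block :: "real \<Rightarrow> real \<Rightarrow> complex \<Rightarrow> complex mat" where
  "energy_block lam E z = complex_of_real lam \<cdot>\<^sub>m FD z - FR z - complex_of_real E \<cdot>\<^sub>m 1\<^sub>m d"

text \<open>The cocycle multiplied by \<open>det W(x + \<omega>)\<close>: it has no poles, and \<open>u\<close> stands for the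
  rotation \<open>exp (2 \<pi> i \<omega>)\<close>.\<close>

definition transfer :: "real \<Rightarrow> real \<Rightarrow> complex \<Rightarrow> complex \<Rightarrow> complex mat" where
  "transfer lam E u z = four_block_mat
     (adj_mat (FW (z * u)) * energy_block lam E z) (- (adj_mat (FW (z * u)) * transpose_mat (FW z)))
     (det (FW (z * u)) \<cdot>\<^sub>m 1\<^sub>m d) (0\<^sub>m d d)"

primrec transfer_iterate :: "real \<Rightarrow> real \<Rightarrow> complex \<Rightarrow> nat \<Rightarrow> complex \<Rightarrow> complex mat" where
  "transfer_iterate lam E u 0 z = 1\<^sub>m (d + d)"
| "transfer_iterate lam E u (Suc n) z = transfer lam E u (z * u ^ n) * transfer_iterate lam E u n z"

lemma holo_energy_block: "holo_mat (open_ring \<rho>) d (energy_block lam E)"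
  unfolding energy_block_def
  by (intro holo_mat_minus holo_mat_smult FD FR holo_mat_const holomorphic_on_const) auto

lemma holo_transfer:
  assumes u: "norm u = 1" shows "holo_mat (open_ring \<rho>) (d + d) (transfer lam E u)"
  unfolding transfer_def
  by (intro holo_mat_four_block holo_mat_mult holo_mat_uminus holo_mat_smult holo_mat_transpose
      holo_mat_rotate[OF holo_mat_adj[OF FW] u] holo_energy_block FW holo_mat_const
      holomorphic_on_rotate[OF holo_det[OF FW] u]) auto

lemma holo_transfer_iterate:
  assumes u: "norm u = 1" shows "holo_mat (open_ring \<rho>) (d + d) (transfer_iterate lam E u n)"
proof (induction n)
  case 0
  show ?case by (simp add: holo_mat_const)
next
  case (Suc n)
  have "norm (u ^ n) = 1" using u by (simp add: norm_power)
  from holo_mat_mult[OF holo_mat_rotate[OF holo_transfer[OF u] this] Suc] show ?case by simp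
qed

lemma transfer_iterate_add:
  assumes u: "norm u = 1" and z: "z \<in> open_ring \<rho>"
  shows "transfer_iterate lam E u (m + n) z =
    transfer_iterate lam E u n (z * u ^ m) * transfer_iterate lam E u m z"
proof (induction n)
  case 0
  show ?case using left_mult_one_mat[OF holo_mat_carrier[OF holo_transfer_iterate[OF u] z]] by simp
next
  case (Suc n)
  have um: "norm (u ^ k) = 1" for k using u by (simp add: norm_power)
  have z': "z * u ^ m \<in> open_ring \<rho>" "z * u ^ m * u ^ n \<in> open_ring \<rho>"
    using z open_ring_rotate[OF um] by auto
  have "transfer_iterate lam E u (m + Suc n) z = transfer lam E u (z * u ^ m * u ^ n) *
      (transfer_iterate lam E u n (z * u ^ m) * transfer_iterate lam E u m z)"
    using Suc by (simp add: power_add mult.assoc)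
  also have "\<dots> = transfer lam E u (z * u ^ m * u ^ n) * transfer_iterate lam E u n (z * u ^ m) *
      transfer_iterate lam E u m z"
    by (rule assoc_mult_mat[symmetric, OF holo_mat_carrier[OF holo_transfer[OF u] z'(2)]
          holo_mat_carrier[OF holo_transfer_iterate[OF u] z'(1)]
          holo_mat_carrier[OF holo_transfer_iterate[OF u] z]])
  finally show ?case by simp
qed

end

text \<open>Both the pencil \<open>P\<close> and the adjugate of \<open>W'\<close> shrink vectors by
  at most \<kappa>, which gives the main term \<open>\<kappa>\<^sup>2 * \<Lambda>\<close>. The
  subtracted terms are the influence of \<open>R\<close> and of the lower half \<open>v\<close>,
  controlled by the cone condition.\<close>

lemma transfer_step_expanding:
  fixes W W' R D :: "complex mat" and y v :: "complex Matrix.vec"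
  assumes W: "W \<in> carrier_mat d d" "entries_le K W" and W': "W' \<in> carrier_mat d d" "entries_le K W'"
    and R: "R \<in> carrier_mat d d" "entries_le K R" and P: "P \<in> carrier_mat d d"
    and adj: "entries_le K (adj_mat W')" "entries_le K (adj_mat P)"
    and det: "\<delta> \<le> norm (det W')" "\<delta> \<le> norm (det P)"
    and H: "H = complex_of_real \<Lambda> \<cdot>\<^sub>m P - R"
    and K: "0 < K" and d: "0 < d" and \<delta>: "0 < \<delta>" and \<Lambda>: "0 \<le> \<Lambda>" 
    and \<kappa>: "\<kappa> = \<delta> / (real d * K)"
    and y: "y \<in> carrier_vec d" and v: "v \<in> carrier_vec d" "vnorm v \<le> K * vnorm y"
  shows "(\<kappa>\<^sup>2 * \<Lambda> - \<kappa> * real d * K - (real d)\<^sup>2 * K ^ 3) * vnorm y \<le>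
    vnorm ((adj_mat W' * H) *\<^sub>v y + (- (adj_mat W' * transpose_mat W)) *\<^sub>v v)"
proof -
  have dK: "0 < real d * K" using d K by simp
  have \<kappa>0: "0 < \<kappa>" using \<delta> dK by (simp add: \<kappa>)
  have adjW: "adj_mat W' \<in> carrier_mat d d" by (rule adj_mat(1)[OF W'(1)])
  have Hc: "H \<in> carrier_mat d d" using P R unfolding H by (intro minus_carrier_mat)
  have sP: "complex_of_real \<Lambda> \<cdot>\<^sub>m P \<in> carrier_mat d d" using P by simp
  have lower: "\<kappa> * n1 \<le> n2" if "\<delta> \<le> c" "c * n1 \<le> real d * K * n2" "0 \<le> n1" for c n1 n2
  proof -
    have "\<delta> * n1 \<le> real d * K * n2" using mult_right_mono[OF that(1,3)] that(2) by linarith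
    thus ?thesis using dK by (simp add: \<kappa> field_simps)
  qed
  have Py: "\<kappa> * vnorm y \<le> vnorm (P *\<^sub>v y)"
    by (rule lower[OF det(2) vnorm_mult_mat_vec_ge[OF P adj(2) y] vnorm_nonneg])
  have Hy: "H *\<^sub>v y = complex_of_real \<Lambda> \<cdot>\<^sub>v (P *\<^sub>v y) + - (R *\<^sub>v y)"
  proof (rule eq_vecI)
    fix i assume "i < dim_vec (complex_of_real \<Lambda> \<cdot>\<^sub>v (P *\<^sub>v y) + - (R *\<^sub>v y))"
    hence i: "i < d" using R by simp
    have "(H *\<^sub>v y) $ i = (\<Sum>j = 0..<d. (complex_of_real \<Lambda> * P $$ (i, j) - R $$ (i, j)) * y $ j)"
      using i y P R by (simp add: H scalar_prod_def)
    also have "\<dots> = complex_of_real \<Lambda> * (\<Sum>j = 0..<d. P $$ (i, j) * y $ j) - (\<Sum>j = 0..<d. R $$ (i, j) * y $ j)"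
      by (simp add: sum_distrib_left left_diff_distrib sum_subtractf mult.assoc)
    also have "\<dots> = (complex_of_real \<Lambda> \<cdot>\<^sub>v (P *\<^sub>v y) + - (R *\<^sub>v y)) $ i"
      using i y P R by (simp add: scalar_prod_def)
    finally show "(H *\<^sub>v y) $ i = (complex_of_real \<Lambda> \<cdot>\<^sub>v (P *\<^sub>v y) + - (R *\<^sub>v y)) $ i" .
  qed (use R in \<open>simp add: H\<close>)
  have neg: "vnorm (- w) = vnorm w" for w :: "complex Matrix.vec"
    by (simp add: vnorm_def)
  have Ry: "vnorm (R *\<^sub>v y) \<le> real d * K * vnorm y" by (rule vnorm_mult_mat_vec_le[OF R y])
  have "\<Lambda> * (\<kappa> * vnorm y) - real d * K * vnorm y \<le> \<Lambda> * vnorm (P *\<^sub>v y) - vnorm (R *\<^sub>v y)"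
    using mult_left_mono[OF Py \<Lambda>] Ry by linarith
  also have "\<dots> = vnorm (complex_of_real \<Lambda> \<cdot>\<^sub>v (P *\<^sub>v y)) - vnorm (- (R *\<^sub>v y))"
    using \<Lambda> by (simp add: vnorm_smult neg)
  also have "\<dots> \<le> vnorm (H *\<^sub>v y)" unfolding Hy
    by (rule vnorm_add_ge[of _ d]) (use P R y in \<open>auto intro!: carrier_vecI\<close>)
  finally have Hlow: "(\<Lambda> * \<kappa> - real d * K) * vnorm y \<le> vnorm (H *\<^sub>v y)" by (simp add: algebra_simps)
  have Hyc: "H *\<^sub>v y \<in> carrier_vec d" using Hc y by (auto intro!: carrier_vecI)
  have "\<kappa> * vnorm (H *\<^sub>v y) \<le> vnorm (adj_mat W' *\<^sub>v (H *\<^sub>v y))"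
    by (rule lower[OF det(1) adj_mult_mat_vec_ge[OF W' Hyc] vnorm_nonneg])
  hence A1: "\<kappa> * ((\<Lambda> * \<kappa> - real d * K) * vnorm y) \<le> vnorm ((adj_mat W' * H) *\<^sub>v y)"
    unfolding assoc_mult_mat_vec[OF adjW Hc y]
    using mult_left_mono[OF Hlow, of \<kappa>] \<kappa>0 by linarith
  have WT: "entries_le K (transpose_mat W)" using W by (auto simp: entries_le_def)
  have M2: "entries_le (real d * (K * K)) (- (adj_mat W' * transpose_mat W))"
    using entries_le_mult[OF adjW adj(1) _ WT] W K by (auto simp: entries_le_def)
  have M2c: "- (adj_mat W' * transpose_mat W) \<in> carrier_mat d d" using adjW W by auto
  have "vnorm ((- (adj_mat W' * transpose_mat W)) *\<^sub>v v) \<le> real d * (real d * (K * K)) * vnorm v"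
    by (rule vnorm_mult_mat_vec_le[OF M2c M2 v(1)])
  also have "\<dots> \<le> real d * (real d * (K * K)) * (K * vnorm y)"
    using v(2) K by (intro mult_left_mono) auto
  also have "\<dots> = (real d)\<^sup>2 * K ^ 3 * vnorm y" by (simp add: power2_eq_square power3_eq_cube)
  finally have A2: "vnorm ((- (adj_mat W' * transpose_mat W)) *\<^sub>v v) \<le> (real d)\<^sup>2 * K ^ 3 * vnorm y" .
  have "(\<kappa>\<^sup>2 * \<Lambda> - \<kappa> * real d * K - (real d)\<^sup>2 * K ^ 3) * vnorm y =
      \<kappa> * ((\<Lambda> * \<kappa> - real d * K) * vnorm y) - (real d)\<^sup>2 * K ^ 3 * vnorm y"
    by (simp add: algebra_simps power2_eq_square)
  also have "\<dots> \<le> vnorm ((adj_mat W' * H) *\<^sub>v y) - vnorm ((- (adj_mat W' * transpose_mat W)) *\<^sub>v v)"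
    using A1 A2 by linarith
  also have "\<dots> \<le> vnorm ((adj_mat W' * H) *\<^sub>v y + (- (adj_mat W' * transpose_mat W)) *\<^sub>v v)"
    by (rule vnorm_add_ge[of _ d])
       (use adjW Hc M2c y v W in \<open>auto intro!: carrier_vecI\<close>)
  finally show ?thesis .
qed

section \<open>Growth of the corner determinant\<close>

context schroedinger_extension
begin

text \<open>Its determinant is one d by d minor of the iterate: a single holomorphic function,
  suitable for three circles, and at the same time a lower bound for the d-th compound norm up to a
  factor.\<close>

definition corner :: "real \<Rightarrow> real \<Rightarrow> complex \<Rightarrow> nat \<Rightarrow> complex \<Rightarrow> complex mat" where
  "corner lam E u n z = mat d d (($$) (transfer_iterate lam E u n z))"

lemma corner_mult_vec:
  assumes u: "norm u = 1" and z: "z \<in> open_ring \<rho>" and v: "v \<in> carrier_vec d"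
    and eq: "transfer_iterate lam E u n z *\<^sub>v (v @\<^sub>v 0\<^sub>v d) = y @\<^sub>v w" and y: "y \<in> carrier_vec d"
  shows "corner lam E u n z *\<^sub>v v = y"
proof (rule eq_vecI)
  let ?T = "transfer_iterate lam E u n z"
  have T: "?T \<in> carrier_mat (d + d) (d + d)" by (rule holo_mat_carrier[OF holo_transfer_iterate[OF u] z])
  show "dim_vec (corner lam E u n z *\<^sub>v v) = dim_vec y" using y by (simp add: corner_def)
  fix i assume "i < dim_vec y"
  hence i: "i < d" using y by simp
  have split: "{0..<d + d} = {0..<d} \<union> {d..<d + d}" by auto
  have "(?T *\<^sub>v (v @\<^sub>v 0\<^sub>v d)) $ i = (\<Sum>j = 0..<d + d. ?T $$ (i, j) * (v @\<^sub>v 0\<^sub>v d) $ j)"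
    using T i v by (simp add: scalar_prod_def)
  also have "\<dots> = (\<Sum>j = 0..<d. ?T $$ (i, j) * (v @\<^sub>v 0\<^sub>v d) $ j) + (\<Sum>j = d..<d + d. ?T $$ (i, j) * (v @\<^sub>v 0\<^sub>v d) $ j)"
    unfolding split by (rule sum.union_disjoint) auto
  also have "(\<Sum>j = d..<d + d. ?T $$ (i, j) * (v @\<^sub>v 0\<^sub>v d) $ j) = 0"
    using v by (intro sum.neutral ballI) (auto intro!: disjI2 index_zero_vec(1))
  also have "(\<Sum>j = 0..<d. ?T $$ (i, j) * (v @\<^sub>v 0\<^sub>v d) $ j) = (\<Sum>j = 0..<d. ?T $$ (i, j) * v $ j)"
    using v by (intro sum.cong refl) simp
  also have "\<dots> = (corner lam E u n z *\<^sub>v v) $ i"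
    using i v by (simp add: corner_def scalar_prod_def)
  finally show "(corner lam E u n z *\<^sub>v v) $ i = y $ i" using eq i y by simp
qed

lemma holo_corner_det:
  assumes u: "norm u = 1"
  shows "(\<lambda>z. det (corner lam E u n z)) holomorphic_on open_ring \<rho>"
proof -
  have "(\<lambda>z. minor d (transfer_iterate lam E u n z) id id) holomorphic_on open_ring \<rho>"
    by (rule holo_minor[OF holo_transfer_iterate[OF u]]) auto
  moreover have "minor d (transfer_iterate lam E u n z) id id = det (corner lam E u n z)" for z
    unfolding minor_def corner_def by (intro arg_cong[where f=det] eq_matI) auto
  ultimately show ?thesis by simp
qed

lemma corner_det_le_compound_norm:
  assumes u: "norm u = 1" and z: "z \<in> open_ring \<rho>"
  shows "norm (det (corner lam E u n z)) \<le> fact d * compound_norm d (transfer_iterate lam E u n z)"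
  unfolding corner_def minor_restrict_id[symmetric]
  by (rule minor_le_compound_norm[OF holo_mat_carrier[OF holo_transfer_iterate[OF u] z]])
     (auto intro: idx_restrict_id)

lemma transfer_iterate_entries:
  assumes K: "1 \<le> K" "\<And>z. z \<in> closed_ring outer \<Longrightarrow> entries_le K (FW z) \<and> entries_le K (FR z) \<and>
      entries_le K (FD z) \<and> entries_le K (adj_mat (FW z)) \<and> norm (det (FW z)) \<le> K"
    and u: "norm u = 1" and z: "z \<in> closed_ring outer" and \<Lambda>: "1 \<le> \<Lambda>" "\<bar>lam\<bar> \<le> \<Lambda>" "\<bar>E\<bar> \<le> \<Lambda>"
  shows "entries_le ((real (d + d) * (3 * real d * K\<^sup>2 * \<Lambda>)) ^ n) (transfer_iterate lam E u n z)"
proof -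
  \<comment> \<open>The factor d comes from the matrix product, one \<open>K\<close> from the
    adjugate, and \<open>3 * K * \<Lambda>\<close> from the three terms of the energy block; the
    other blocks are no larger.\<close>
  let ?c = "3 * real d * K\<^sup>2 * \<Lambda>"
  have ring: "z * w \<in> closed_ring outer" if "norm w = 1" "z \<in> closed_ring outer" for z w :: complex
    using that by (simp add: closed_ring_def norm_mult)
  have K2: "K \<le> K\<^sup>2" using K(1) by (simp add: self_le_power)
  have d1: "1 \<le> real d" using d by simp
  have one: "1 \<le> K\<^sup>2 * \<Lambda>" using K(1) \<Lambda>(1) mult_mono[of 1 "K\<^sup>2" 1 \<Lambda>] by simp
  have step: "entries_le ?c (transfer lam E u z)" if z: "z \<in> closed_ring outer" for z
  proof -
    have zo: "z \<in> open_ring \<rho>" and zr: "z * u \<in> closed_ring outer" and zuo: "z * u \<in> open_ring \<rho>"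
      using z closed_ring_subset ring[OF u z] by auto
    note c = holo_mat_carrier[OF FW zo] holo_mat_carrier[OF FR zo] holo_mat_carrier[OF FD zo]
    have adjc: "adj_mat (FW (z * u)) \<in> carrier_mat d d" by (rule adj_mat(1)[OF holo_mat_carrier[OF FW zuo]])
    have "entries_le (3 * K * \<Lambda>) (energy_block lam E z)"
      unfolding entries_le_def
    proof (intro allI impI)
      fix i j assume "i < dim_row (energy_block lam E z)" "j < dim_col (energy_block lam E z)"
      hence ij: "i < d" "j < d" by (auto simp: energy_block_def)
      have "norm (energy_block lam E z $$ (i, j)) =
          norm (complex_of_real lam * FD z $$ (i, j) - FR z $$ (i, j) - complex_of_real E * (if i = j then 1 else 0))"
        using c ij by (simp add: energy_block_def)
      also have "\<dots> \<le> \<bar>lam\<bar> * norm (FD z $$ (i, j)) + norm (FR z $$ (i, j)) + \<bar>E\<bar>"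
        by (intro order_trans[OF norm_triangle_ineq4] add_mono) (auto simp: norm_mult)
      also have "\<dots> \<le> \<Lambda> * K + K * \<Lambda> + K * \<Lambda>"
      proof (intro add_mono mult_mono)
        show "norm (FD z $$ (i, j)) \<le> K" using K(2)[OF z] ij c by (auto simp: entries_le_def)
        have "norm (FR z $$ (i, j)) \<le> K * 1" using K(2)[OF z] ij c by (auto simp: entries_le_def)
        also have "\<dots> \<le> K * \<Lambda>" using K(1) \<Lambda>(1) by (intro mult_left_mono) auto
        finally show "norm (FR z $$ (i, j)) \<le> K * \<Lambda>" .
        have "\<bar>E\<bar> \<le> 1 * \<Lambda>" using \<Lambda> by simp
        also have "\<dots> \<le> K * \<Lambda>" using K(1) \<Lambda>(1) by (intro mult_right_mono) auto
        finally show "\<bar>E\<bar> \<le> K * \<Lambda>" .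
      qed (use \<Lambda> in auto)
      finally show "norm (energy_block lam E z $$ (i, j)) \<le> 3 * K * \<Lambda>" by (simp add: algebra_simps)
    qed
    hence "entries_le (real d * (K * (3 * K * \<Lambda>))) (adj_mat (FW (z * u)) * energy_block lam E z)"
      using K(1) K(2)[OF zr] adjc holo_mat_carrier[OF holo_energy_block zo]
      by (intro entries_le_mult) auto
    hence b1: "entries_le ?c (adj_mat (FW (z * u)) * energy_block lam E z)"
      by (rule entries_le_mono) (simp add: power2_eq_square)
    have "entries_le K (transpose_mat (FW z))" using K(2)[OF z] by (auto simp: entries_le_def)
    hence "entries_le (real d * (K * K)) (adj_mat (FW (z * u)) * transpose_mat (FW z))"
      using K(1) K(2)[OF zr] adjc c by (intro entries_le_mult) auto
    moreover have "real d * (K * K) \<le> ?c"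
    proof -
      have "real d * K\<^sup>2 * 1 \<le> real d * K\<^sup>2 * (3 * \<Lambda>)" using \<Lambda>(1) by (intro mult_left_mono) auto
      thus ?thesis by (simp add: power2_eq_square mult_ac)
    qed
    ultimately have b2: "entries_le ?c (adj_mat (FW (z * u)) * transpose_mat (FW z))" by (rule entries_le_mono)
    have Kc: "K \<le> ?c"
    proof -
      have "K * 1 \<le> K\<^sup>2 * \<Lambda>" using K2 \<Lambda>(1) K(1) by (intro mult_mono) auto
      also have "1 * (K\<^sup>2 * \<Lambda>) \<le> (3 * real d) * (K\<^sup>2 * \<Lambda>)" using d1 one by (intro mult_right_mono) auto
      finally show ?thesis by (simp add: mult_ac)
    qed
    have det: "norm (det (FW (z * u))) \<le> ?c" using K(2)[OF zr] Kc by linarith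
    have c0: "0 \<le> ?c" using K(1) Kc by linarith
    note dims = adjc c holo_mat_carrier[OF holo_energy_block[of lam E] zo]
    show ?thesis unfolding entries_le_def
    proof (intro allI impI)
      fix i j assume "i < dim_row (transfer lam E u z)" "j < dim_col (transfer lam E u z)"
      hence ij: "i < d + d" "j < d + d" using dims by (auto simp: transfer_def)
      show "norm (transfer lam E u z $$ (i, j)) \<le> ?c"
      proof (cases "i < d")
        case i: True
        show ?thesis
        proof (cases "j < d")
          case True
          thus ?thesis using i b1 dims by (simp add: transfer_def entries_le_def)
        next
          case False
          thus ?thesis using i ij b2 dims by (simp add: transfer_def entries_le_def)
        qed
      next
        case i: False
        show ?thesis
        proof (cases "j < d")
          case True
          have "transfer lam E u z $$ (i, j) = det (FW (z * u)) * (if i - d = j then 1 else 0)"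
            using True i ij dims by (simp add: transfer_def)
          thus ?thesis using det c0 by simp
        next
          case False
          have "transfer lam E u z $$ (i, j) = 0" using False i ij dims by (simp add: transfer_def)
          thus ?thesis using c0 by simp
        qed
      qed
    qed
  qed
  have c1: "1 \<le> real (d + d) * ?c"
  proof -
    have "1 * 1 \<le> (real (d + d) * (3 * real d)) * (K\<^sup>2 * \<Lambda>)"
    proof (intro mult_mono)
      have "1 * 1 \<le> real (d + d) * (3 * real d)" using d1 by (intro mult_mono) auto
      thus "1 \<le> real (d + d) * (3 * real d)" by simp
    qed (use one in auto)
    thus ?thesis by (simp add: mult_ac)
  qed
  show ?thesis
  proof (induction n)
    case 0
    show ?case by (auto simp: entries_le_def)
  next
    case (Suc n)
    have un: "norm (u ^ n) = 1" using u by (simp add: norm_power)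
    have zr: "z * u ^ n \<in> closed_ring outer" by (rule ring[OF un z])
    have zo: "z \<in> open_ring \<rho>" "z * u ^ n \<in> open_ring \<rho>" using z zr closed_ring_subset by auto
    have "0 \<le> ?c" using \<Lambda>(1) by simp
    hence "entries_le (real (d + d) * (?c * (real (d + d) * ?c) ^ n)) (transfer_iterate lam E u (Suc n) z)"
      unfolding transfer_iterate.simps
      by (intro entries_le_mult step[OF zr] Suc holo_mat_carrier[OF holo_transfer[OF u] zo(2)]
          holo_mat_carrier[OF holo_transfer_iterate[OF u] zo(1)])
    thus ?case by (simp only: power_Suc mult.assoc)
  qed
qed

text \<open>On the good circle the pairs (y, w) with w at most \<open>K\<close> times y form an
  invariant cone that contains all (v, 0): the new lower half is the old upper half times a
  determinant of modulus at most \<open>K\<close>, and the upper half does not shrink.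
  \<open>K0\<close> may depend on the parameters, being invisible in the rate; \<open>C\<close> and
  \<open>lam0\<close> may not. The entry bound on the unit circle is for the compounds of order d -
  1.\<close>

theorem corner_growth:
  "\<exists>C lam0. 1 \<le> lam0 \<and> 0 \<le> C \<and> (\<forall>u lam E. norm u = 1 \<longrightarrow> lam0 \<le> lam \<longrightarrow>
     (\<exists>K0>0. \<forall>n. \<exists>z. norm z = 1 \<and>
        K0 * exp ((real d * ln (sqrt (lam\<^sup>2 + E\<^sup>2)) - C) * real n) \<le> norm (det (corner lam E u n z))) \<and>
     (\<forall>n z. norm z = 1 \<longrightarrow> entries_le (exp ((ln (sqrt (lam\<^sup>2 + E\<^sup>2)) + C) * real n)) (transfer_iterate lam E u n z)))"
proof -
  obtain \<delta>0 where \<delta>0: "0 < \<delta>0" "\<And>a b. a\<^sup>2 + b\<^sup>2 = 1 \<Longrightarrow> \<exists>r. 1 < r \<and> r < outer \<and> ln r \<le> (1 - \<delta>0) * ln outer \<and>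
     (\<forall>z. norm z = r \<longrightarrow> \<delta>0 \<le> norm (det (pencil a b z) * det (FW z)))"
    using uniform_good_circle by blast
  obtain K where K: "1 \<le> K" and Kb: "\<And>z. z \<in> closed_ring outer \<Longrightarrow> entries_le K (FW z) \<and> entries_le K (FR z) \<and>
     entries_le K (FD z) \<and> entries_le K (adj_mat (FW z)) \<and> norm (det (FW z)) \<le> K"
    and Kp: "\<And>z a b. z \<in> closed_ring outer \<Longrightarrow> a\<^sup>2 + b\<^sup>2 = 1 \<Longrightarrow>
      entries_le K (adj_mat (pencil a b z)) \<and> norm (det (pencil a b z)) \<le> K"
    using uniform_entry_bound by blast
  \<comment> \<open>On the good circle the product of the two determinants is at least
    \<open>\<delta>0\<close> and each is at most \<open>K\<close>, so each is at least this
    quotient.\<close>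
  define \<delta> where "\<delta> = \<delta>0 / K"
  have \<delta>: "0 < \<delta>" using \<delta>0 K by (simp add: \<delta>_def)
  define \<kappa> where "\<kappa> = \<delta> / (real d * K)"
  have d1: "1 \<le> real d" using d by simp
  have \<kappa>: "0 < \<kappa>" using \<delta> d1 K by (simp add: \<kappa>_def)
  \<comment> \<open>\<open>T\<close> exceeds the losses of one expansion step; \<open>lam0\<close>
    is chosen so that half of \<open>\<kappa>\<^sup>2 * \<Lambda>\<close> covers them and
    \<open>q * \<Lambda>\<close> is at least 1.\<close>
  define T where "T = \<kappa> * real d * K + (real d)\<^sup>2 * K ^ 3 + 1"
  have T1: "1 \<le> T" using \<kappa> d1 K by (simp add: T_def)
  define q where "q = min (\<kappa>\<^sup>2 / 2) 1"
  have q: "0 < q" "q \<le> 1" "q \<le> \<kappa>\<^sup>2 / 2" using \<kappa> by (auto simp: q_def)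
  define lam0 where "lam0 = 1 + 2 * T / \<kappa>\<^sup>2 + 1 / q"
  have lam0: "1 \<le> lam0" using T1 \<kappa> q by (simp add: lam0_def)
  define Q where "Q = real (d + d) * (3 * real d * K\<^sup>2)"
  have Q: "1 \<le> Q"
  proof -
    have "1 * 1 * 1 \<le> real (d + d) * (3 * real d) * K\<^sup>2" using d1 K by (intro mult_mono) auto
    thus ?thesis by (simp add: Q_def mult.assoc)
  qed

  have lnq: "ln q \<le> 0" using q by simp
  have lnQ: "0 \<le> ln Q" using Q by simp

  \<comment> \<open>The first summand is the three circles loss (\<beta> - \<alpha>) / \<delta>0 met
    below, which is free of \<Lambda>; the second lets \<open>C\<close> serve in the entry bound as
    well.\<close>
  define C where "C = real d * (ln Q - ln q) / \<delta>0 + ln Q"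
  have C: "0 \<le> C" "real d * (ln Q - ln q) / \<delta>0 - real d * ln Q \<le> C" "ln Q \<le> C"
  proof -
    have "0 \<le> real d * (ln Q - ln q) / \<delta>0" using lnq lnQ \<delta>0 by simp
    thus "0 \<le> C" "ln Q \<le> C" using lnQ unfolding C_def by auto
    have "0 \<le> real d * ln Q" using lnQ by simp
    thus "real d * (ln Q - ln q) / \<delta>0 - real d * ln Q \<le> C" using lnQ unfolding C_def by linarith
  qed
  show ?thesis
  proof (rule exI[of _ C], rule exI[of _ lam0], intro conjI lam0 C(1) allI impI)
    fix u :: complex and lam E :: real assume u: "norm u = 1" and lam: "lam0 \<le> lam"
    define \<Lambda> where "\<Lambda> = sqrt (lam\<^sup>2 + E\<^sup>2)"
    have lam_le: "\<bar>lam\<bar> \<le> \<Lambda>" "\<bar>E\<bar> \<le> \<Lambda>" unfolding \<Lambda>_def by (rule real_le_rsqrt, simp)+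
    have \<Lambda>0: "lam0 \<le> \<Lambda>" using lam_le lam by linarith
    have \<Lambda>1: "1 \<le> \<Lambda>" using \<Lambda>0 lam0 by linarith
    have Q\<Lambda>: "real (d + d) * (3 * real d * K\<^sup>2 * \<Lambda>) = exp (ln Q + ln \<Lambda>)"
      using Q \<Lambda>1 by (simp add: exp_add Q_def mult_ac)
    have entries: "entries_le (exp ((ln \<Lambda> + ln Q) * real n)) (transfer_iterate lam E u n z)"
      if "z \<in> closed_ring outer" for n z
      using transfer_iterate_entries[OF K Kb u that \<Lambda>1 lam_le, of n] unfolding Q\<Lambda>
      by (simp add: exp_of_nat_mult[symmetric] mult.commute add.commute)
    show "entries_le (exp ((ln (sqrt (lam\<^sup>2 + E\<^sup>2)) + C) * real n)) (transfer_iterate lam E u n z)"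
      if "norm z = 1" for n z
    proof (rule entries_le_mono[OF entries])
      show "z \<in> closed_ring outer" using that outer by (simp add: closed_ring_def)
      show "exp ((ln \<Lambda> + ln Q) * real n) \<le> exp ((ln (sqrt (lam\<^sup>2 + E\<^sup>2)) + C) * real n)"
        using C(3) unfolding \<Lambda>_def[symmetric] by (simp add: mult_right_mono)
    qed
    \<comment> \<open>With this direction the energy block is \<Lambda> times the pencil, perturbed
      only by the bounded term \<open>- FR z\<close>.\<close>
    define a b where "a = lam / \<Lambda>" and "b = - E / \<Lambda>"
    have \<Lambda>2: "\<Lambda>\<^sup>2 = lam\<^sup>2 + E\<^sup>2" by (simp add: \<Lambda>_def)
    have "a\<^sup>2 + b\<^sup>2 = (lam\<^sup>2 + E\<^sup>2) / \<Lambda>\<^sup>2" by (simp add: a_def b_def power_divide add_divide_distrib)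
    hence ab: "a\<^sup>2 + b\<^sup>2 = 1" using \<Lambda>1 unfolding \<Lambda>2[symmetric] by simp
    obtain r where r: "1 < r" "r < outer" "ln r \<le> (1 - \<delta>0) * ln outer"
      and good: "\<And>z. norm z = r \<Longrightarrow> \<delta>0 \<le> norm (det (pencil a b z) * det (FW z))"
      using \<delta>0(2)[OF ab] by blast
    have rr: "z \<in> closed_ring outer" "z \<in> open_ring \<rho>" if "norm z = r" for z
    proof -
      show "z \<in> closed_ring outer" using that r by (simp add: closed_ring_def)
      thus "z \<in> open_ring \<rho>" using closed_ring_subset by blast
    qed
    have dets: "\<delta> \<le> norm (det (FW z))" "\<delta> \<le> norm (det (pencil a b z))" if z: "norm z = r" for z
    proof -
      have bounds: "norm (det (FW z)) \<le> K" "norm (det (pencil a b z)) \<le> K"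
        using Kb[OF rr(1)[OF z]] Kp[OF rr(1)[OF z] ab] by auto
      have g: "\<delta>0 \<le> norm (det (pencil a b z)) * norm (det (FW z))" using good[OF z] by (simp add: norm_mult)
      have "\<delta>0 \<le> K * norm (det (FW z))" "\<delta>0 \<le> norm (det (pencil a b z)) * K"
        using g mult_right_mono[OF bounds(2) norm_ge_zero[of "det (FW z)"]]
          mult_left_mono[OF bounds(1) norm_ge_zero[of "det (pencil a b z)"]] by linarith+
      thus "\<delta> \<le> norm (det (FW z))" "\<delta> \<le> norm (det (pencil a b z))"
        using K by (simp_all add: \<delta>_def divide_le_eq mult.commute)
    qed
    define \<sigma> where "\<sigma> = q * \<Lambda>"
    have big: "\<sigma> \<le> \<kappa>\<^sup>2 * \<Lambda> - \<kappa> * real d * K - (real d)\<^sup>2 * K ^ 3" and \<sigma>1: "1 \<le> \<sigma>"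
    proof -
      have "2 * T / \<kappa>\<^sup>2 \<le> \<Lambda>" using \<Lambda>0 q unfolding lam0_def by (smt (verit) divide_pos_pos)
      hence T\<Lambda>: "T \<le> \<kappa>\<^sup>2 / 2 * \<Lambda>" using \<kappa> by (simp add: divide_le_eq mult_ac)
      have "q * \<Lambda> \<le> \<kappa>\<^sup>2 / 2 * \<Lambda>" using q \<Lambda>1 by (intro mult_right_mono) auto
      moreover have "\<kappa>\<^sup>2 * \<Lambda> = \<kappa>\<^sup>2 / 2 * \<Lambda> + \<kappa>\<^sup>2 / 2 * \<Lambda>" by simp
      ultimately show "\<sigma> \<le> \<kappa>\<^sup>2 * \<Lambda> - \<kappa> * real d * K - (real d)\<^sup>2 * K ^ 3"
        using T\<Lambda> unfolding \<sigma>_def T_def by linarith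
      have "0 \<le> 2 * T / \<kappa>\<^sup>2" using T1 by simp
      hence "1 / q \<le> \<Lambda>" using \<Lambda>0 unfolding lam0_def by linarith
      thus "1 \<le> \<sigma>" using q by (simp add: \<sigma>_def divide_le_eq mult.commute)
    qed
    have eb: "energy_block lam E z = complex_of_real \<Lambda> \<cdot>\<^sub>m pencil a b z - FR z" if "z \<in> open_ring \<rho>" for z
    proof -
      have "\<Lambda> \<noteq> 0" using \<Lambda>1 by simp
      hence "complex_of_real \<Lambda> * complex_of_real a = complex_of_real lam"
        "complex_of_real \<Lambda> * complex_of_real b = - complex_of_real E"
        by (simp_all add: a_def b_def)
      thus ?thesis using holo_mat_carrier[OF FR that] holo_mat_carrier[OF FD that]
        by (intro eq_matI) (auto simp: energy_block_def pencil_def distrib_left mult.assoc[symmetric])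
    qed
    have cone: "\<exists>y w. y \<in> carrier_vec d \<and> w \<in> carrier_vec d \<and>
        transfer_iterate lam E u n z *\<^sub>v (v @\<^sub>v 0\<^sub>v d) = y @\<^sub>v w \<and>
        vnorm w \<le> K * vnorm y \<and> \<sigma> ^ n * vnorm v \<le> vnorm y"
      if v: "v \<in> carrier_vec d" and z: "norm z = r" for v n z
    proof (induction n)
      case 0
      have "v @\<^sub>v 0\<^sub>v d \<in> carrier_vec (d + d)" using v by simp
      hence "transfer_iterate lam E u 0 z *\<^sub>v (v @\<^sub>v 0\<^sub>v d) = v @\<^sub>v 0\<^sub>v d" by simp
      moreover have "vnorm (0\<^sub>v d) \<le> K * vnorm v" using K vnorm_nonneg[of v] by (simp add: vnorm_def)
      ultimately show ?case using v by (intro exI[of _ v] exI[of _ "0\<^sub>v d"]) simp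
    next
      case (Suc n)
      then obtain y w where yw: "y \<in> carrier_vec d" "w \<in> carrier_vec d"
        "transfer_iterate lam E u n z *\<^sub>v (v @\<^sub>v 0\<^sub>v d) = y @\<^sub>v w"
        "vnorm w \<le> K * vnorm y" "\<sigma> ^ n * vnorm v \<le> vnorm y" by blast
      define x where "x = z * u ^ n"
      have nx: "norm x = r" "norm (x * u) = r" using z u by (auto simp: x_def norm_mult norm_power)
      note xo = rr(2)[OF nx(1)] and xuo = rr(2)[OF nx(2)] and xr = rr(1)[OF nx(1)] and xur = rr(1)[OF nx(2)]
      have adjc: "adj_mat (FW (x * u)) \<in> carrier_mat d d" by (rule adj_mat(1)[OF holo_mat_carrier[OF FW xuo]])
      have Hc: "energy_block lam E x \<in> carrier_mat d d" by (rule holo_mat_carrier[OF holo_energy_block xo])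
      have A1: "adj_mat (FW (x * u)) * energy_block lam E x \<in> carrier_mat d d" using adjc Hc by simp
      have A2: "- (adj_mat (FW (x * u)) * transpose_mat (FW x)) \<in> carrier_mat d d"
        using adjc holo_mat_carrier[OF FW xo] by simp
      define y' where "y' = (adj_mat (FW (x * u)) * energy_block lam E x) *\<^sub>v y +
        (- (adj_mat (FW (x * u)) * transpose_mat (FW x))) *\<^sub>v w"
      define w' where "w' = (det (FW (x * u)) \<cdot>\<^sub>m 1\<^sub>m d) *\<^sub>v y + 0\<^sub>m d d *\<^sub>v w"
      have w'eq: "w' = det (FW (x * u)) \<cdot>\<^sub>v y"
        unfolding w'_def using yw(1,2) by (intro eq_vecI) auto
      have y'c: "y' \<in> carrier_vec d" unfolding y'_def using A1 A2 yw by (auto intro!: add_carrier_vec mult_mat_vec_carrier)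
      have "transfer_iterate lam E u (Suc n) z *\<^sub>v (v @\<^sub>v 0\<^sub>v d) = transfer lam E u x *\<^sub>v (y @\<^sub>v w)"
        unfolding transfer_iterate.simps x_def[symmetric] yw(3)[symmetric]
        by (rule assoc_mult_mat_vec[OF holo_mat_carrier[OF holo_transfer[OF u] xo]
              holo_mat_carrier[OF holo_transfer_iterate[OF u] rr(2)[OF z]]]) (use v in simp)
      also have "\<dots> = y' @\<^sub>v w'"
        unfolding transfer_def y'_def w'_def
        by (rule four_block_mat_mult_vec[OF A1 A2 _ _ yw(1,2)]) auto
      finally have eq: "transfer_iterate lam E u (Suc n) z *\<^sub>v (v @\<^sub>v 0\<^sub>v d) = y' @\<^sub>v w'" .
      have "(\<kappa>\<^sup>2 * \<Lambda> - \<kappa> * real d * K - (real d)\<^sup>2 * K ^ 3) * vnorm y \<le> vnorm y'"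
        unfolding y'_def
        by (rule transfer_step_expanding[OF holo_mat_carrier[OF FW xo] _ holo_mat_carrier[OF FW xuo] _
              holo_mat_carrier[OF FR xo] _ holo_mat_carrier[OF holo_pencil xo] _ _
              dets(1)[OF nx(2)] dets(2)[OF nx(1)] eb[OF xo] _ _ \<delta> _ \<kappa>_def yw(1,2,4)])
           (use Kb[OF xr] Kb[OF xur] Kp[OF xr ab] K d \<Lambda>1 in auto)
      moreover have "\<sigma> * vnorm y \<le> (\<kappa>\<^sup>2 * \<Lambda> - \<kappa> * real d * K - (real d)\<^sup>2 * K ^ 3) * vnorm y"
        using big vnorm_nonneg by (rule mult_right_mono)
      ultimately have grow: "\<sigma> * vnorm y \<le> vnorm y'" by linarith
      have "1 * vnorm y \<le> \<sigma> * vnorm y" using \<sigma>1 vnorm_nonneg by (rule mult_right_mono)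
      hence grow1: "vnorm y \<le> vnorm y'" using grow by linarith
      have "vnorm w' = norm (det (FW (x * u))) * vnorm y" unfolding w'eq by (rule vnorm_smult)
      also have "\<dots> \<le> K * vnorm y'"
        using Kb[OF xur] grow1 K vnorm_nonneg[of y] by (intro mult_mono) auto
      finally have w'le: "vnorm w' \<le> K * vnorm y'" .
      have "\<sigma> ^ Suc n * vnorm v = \<sigma> * (\<sigma> ^ n * vnorm v)" by simp
      also have "\<dots> \<le> \<sigma> * vnorm y" using yw(5) \<sigma>1 by (intro mult_left_mono) auto
      finally have "\<sigma> ^ Suc n * vnorm v \<le> vnorm y'" using grow by linarith
      moreover have "w' \<in> carrier_vec d" unfolding w'eq using yw(1) by simp
      ultimately show ?case using y'c eq w'le by blast
    qed

    have det_low: "(\<sigma> ^ n) ^ d \<le> norm (det (corner lam E u n z))" if z: "norm z = r" for n z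
    proof (rule det_ge_of_expanding)
      show "corner lam E u n z \<in> carrier_mat d d" by (simp add: corner_def)
      show "0 \<le> \<sigma> ^ n" using \<sigma>1 by simp
      fix v :: "complex Matrix.vec" assume v: "v \<in> carrier_vec d"
      obtain y w where yw: "y \<in> carrier_vec d" "transfer_iterate lam E u n z *\<^sub>v (v @\<^sub>v 0\<^sub>v d) = y @\<^sub>v w"
        "\<sigma> ^ n * vnorm v \<le> vnorm y" using cone[OF v z, of n] by blast
      thus "\<sigma> ^ n * vnorm v \<le> vnorm (corner lam E u n z *\<^sub>v v)"
        using corner_mult_vec[OF u rr(2)[OF z] v yw(2,1)] by simp
    qed
    define \<alpha> \<beta> where "\<alpha> = real d * ln \<sigma>" and "\<beta> = real d * (ln \<Lambda> + ln Q)"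
    have ln\<sigma>: "ln \<sigma> = ln q + ln \<Lambda>" unfolding \<sigma>_def using q \<Lambda>1 by (simp add: ln_mult)
    have \<alpha>\<beta>: "\<alpha> \<le> \<beta>" unfolding \<alpha>_def \<beta>_def ln\<sigma> using lnq lnQ d1 by (intro mult_left_mono) auto
    have hol: "(\<lambda>z. det (corner lam E u n z)) holomorphic_on closed_ring outer" for n
      by (rule holomorphic_on_subset[OF holo_corner_det[OF u] closed_ring_subset])
    have low: "exp (\<alpha> * real n) \<le> norm (det (corner lam E u n (of_real r)))" for n
    proof -
      have "exp (\<alpha> * real n) = exp (real (n * d) * ln \<sigma>)" by (simp add: \<alpha>_def mult_ac)
      also have "\<dots> = (\<sigma> ^ n) ^ d" using \<sigma>1 by (simp add: exp_of_nat_mult power_mult del: of_nat_mult)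
      also have "\<dots> \<le> norm (det (corner lam E u n (of_real r)))" using r by (intro det_low) simp
      finally show ?thesis .
    qed
    have up: "norm (det (corner lam E u n z)) \<le> fact d * exp (\<beta> * real n)" if "norm z = outer" for n z
    proof -
      have z: "z \<in> closed_ring outer" using that outer by (simp add: closed_ring_def)
      hence zo: "z \<in> open_ring \<rho>" using closed_ring_subset by blast
      have "norm (det (corner lam E u n z)) \<le> fact d * exp ((ln \<Lambda> + ln Q) * real n) ^ d"
        using entries[OF z, of n] holo_mat_carrier[OF holo_transfer_iterate[OF u] zo, of lam E n]
        by (intro norm_det_le) (auto simp: corner_def entries_le_def)
      also have "exp ((ln \<Lambda> + ln Q) * real n) ^ d = exp (\<beta> * real n)"
        by (simp add: \<beta>_def exp_of_nat_mult[symmetric] mult_ac)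
      finally show ?thesis .
    qed
    define K0 where "K0 = exp (- ((ln outer + 1 + ln (fact d)) / \<delta>0))"
    have "\<exists>z. norm z = 1 \<and> K0 * exp ((real d * ln \<Lambda> - C) * real n) \<le> norm (det (corner lam E u n z))" for n
    proof -
      have "\<exists>z. norm z = 1 \<and> K0 * exp ((\<beta> - (\<beta> - \<alpha>) / \<delta>0) * real n) \<le> norm (det (corner lam E u n z))"
        unfolding K0_def
        by (rule three_circles_lower_bound[OF hol r(1,2) _ \<delta>0(1) r(3) low up _ \<alpha>\<beta>])
           (use r in \<open>auto simp: fact_ge_1\<close>)
      moreover have "real d * ln \<Lambda> - C \<le> \<beta> - (\<beta> - \<alpha>) / \<delta>0"
      proof -
        have "\<beta> - \<alpha> = real d * (ln Q - ln q)" unfolding \<alpha>_def \<beta>_def ln\<sigma> by (simp add: algebra_simps)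
        hence "\<beta> - (\<beta> - \<alpha>) / \<delta>0 = real d * ln \<Lambda> - (real d * (ln Q - ln q) / \<delta>0 - real d * ln Q)"
          by (simp add: \<beta>_def distrib_left)
        thus ?thesis using C(2) by linarith
      qed
      hence "K0 * exp ((real d * ln \<Lambda> - C) * real n) \<le> K0 * exp ((\<beta> - (\<beta> - \<alpha>) / \<delta>0) * real n)"
        unfolding K0_def by (intro mult_left_mono) (auto intro: mult_right_mono)
      ultimately show ?thesis by (meson order_trans)
    qed
    moreover have "0 < K0" by (simp add: K0_def)
    ultimately show "\<exists>K0>0. \<forall>n. \<exists>z. norm z = 1 \<and>
        K0 * exp ((real d * ln (sqrt (lam\<^sup>2 + E\<^sup>2)) - C) * real n) \<le> norm (det (corner lam E u n z))"
      unfolding \<Lambda>_def by blast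
  qed
qed

text \<open>Three circles for the scalar product along the orbit. The direction (1, 0) merely
  supplies a circle on which det FW is bounded below, because the pencil determinant is at most
  \<open>K\<close> there.\<close>

theorem det_product_growth:
  "\<exists>\<alpha>. \<forall>u. norm u = 1 \<longrightarrow> (\<exists>K0>0. \<forall>n. \<exists>z. norm z = 1 \<and>
     K0 * exp (\<alpha> * real n) \<le> norm (\<Prod>j<n. det (FW (z * u ^ j))))"
proof -
  obtain \<delta>0 where \<delta>0: "0 < \<delta>0" "\<And>a b. a\<^sup>2 + b\<^sup>2 = 1 \<Longrightarrow> \<exists>r. 1 < r \<and> r < outer \<and> ln r \<le> (1 - \<delta>0) * ln outer \<and>
     (\<forall>z. norm z = r \<longrightarrow> \<delta>0 \<le> norm (det (pencil a b z) * det (FW z)))"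
    using uniform_good_circle by blast
  obtain K where K: "1 \<le> K" and Kb: "\<And>z. z \<in> closed_ring outer \<Longrightarrow> norm (det (FW z)) \<le> K"
    and Kp: "\<And>z a b. z \<in> closed_ring outer \<Longrightarrow> a\<^sup>2 + b\<^sup>2 = 1 \<Longrightarrow> norm (det (pencil a b z)) \<le> K"
    using uniform_entry_bound by blast
  have ab: "(1::real)\<^sup>2 + 0\<^sup>2 = 1" by simp
  obtain r where r: "1 < r" "r < outer" "ln r \<le> (1 - \<delta>0) * ln outer"
    and good: "\<And>z. norm z = r \<Longrightarrow> \<delta>0 \<le> norm (det (pencil 1 0 z) * det (FW z))"
    using \<delta>0(2)[OF ab] by blast
  define \<delta> where "\<delta> = min 1 (\<delta>0 / K)"
  have \<delta>: "0 < \<delta>" "\<delta> \<le> 1" using \<delta>0 K by (auto simp: \<delta>_def)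
  have det_low: "\<delta> \<le> norm (det (FW z))" if z: "norm z = r" for z
  proof -
    have zr: "z \<in> closed_ring outer" using z r by (simp add: closed_ring_def)
    have "\<delta>0 \<le> norm (det (pencil 1 0 z)) * norm (det (FW z))" using good[OF z] by (simp add: norm_mult)
    also have "\<dots> \<le> K * norm (det (FW z))" using Kp[OF zr ab] by (intro mult_right_mono) auto
    finally have "\<delta>0 / K \<le> norm (det (FW z))" using K by (simp add: divide_le_eq mult.commute)
    thus ?thesis by (simp add: \<delta>_def)
  qed
  have \<alpha>\<beta>: "ln \<delta> \<le> ln K" using \<delta> K by (subst ln_le_cancel_iff) auto
  show ?thesis
  proof (rule exI[of _ "ln K - (ln K - ln \<delta>) / \<delta>0"], intro allI impI)
    fix u :: complex assume u: "norm u = 1"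
    have un: "norm (u ^ j) = 1" for j using u by (simp add: norm_power)
    have "\<exists>z. norm z = 1 \<and> exp (- ((ln outer + 1 + ln 1) / \<delta>0)) * exp ((ln K - (ln K - ln \<delta>) / \<delta>0) * real n)
        \<le> norm (\<Prod>j<n. det (FW (z * u ^ j)))" for n
    proof (rule three_circles_lower_bound[of _ outer r "of_real r" \<delta>0 "ln \<delta>" "real n" 1 "ln K"])
      show "(\<lambda>z. \<Prod>j<n. det (FW (z * u ^ j))) holomorphic_on closed_ring outer"
        by (rule holomorphic_on_subset[OF _ closed_ring_subset])
           (intro holomorphic_on_prod holomorphic_on_rotate[OF holo_det[OF FW] un])
      have "exp (ln \<delta> * real n) = (\<Prod>j<n. \<delta>)" using \<delta> by (simp add: exp_of_nat2_mult)
      also have "\<dots> \<le> (\<Prod>j<n. norm (det (FW (of_real r * u ^ j))))"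
        using \<delta> r un by (intro prod_mono conjI det_low) (auto simp: norm_mult)
      finally show "exp (ln \<delta> * real n) \<le> norm (\<Prod>j<n. det (FW (of_real r * u ^ j)))" by (simp add: prod_norm)
      fix z :: complex assume z: "norm z = outer"
      have "norm (\<Prod>j<n. det (FW (z * u ^ j))) = (\<Prod>j<n. norm (det (FW (z * u ^ j))))" by (simp add: prod_norm)
      also have "\<dots> \<le> (\<Prod>j<n. K)"
        using z un outer by (intro prod_mono conjI Kb) (auto simp: norm_mult closed_ring_def)
      also have "\<dots> = 1 * exp (ln K * real n)" using K by (simp add: exp_of_nat2_mult)
      finally show "norm (\<Prod>j<n. det (FW (z * u ^ j))) \<le> 1 * exp (ln K * real n)" .
    qed (use r \<delta>0 \<alpha>\<beta> in auto)
    thus "\<exists>K0>0. \<forall>n. \<exists>z. norm z = 1 \<and> K0 * exp ((ln K - (ln K - ln \<delta>) / \<delta>0) * real n)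
        \<le> norm (\<Prod>j<n. det (FW (z * u ^ j)))"
      by (intro exI[of _ "exp (- ((ln outer + 1 + ln 1) / \<delta>0))"] conjI) auto
  qed
qed

end

section \<open>The symplectic structure\<close>

lemma cmat_mult:
  "A \<in> carrier_mat nr n \<Longrightarrow> B \<in> carrier_mat n nc \<Longrightarrow> cmat (A * B) = cmat A * cmat B"
  by (rule of_real_hom.mat_hom_mult)

lemma cmat_one: "cmat (1\<^sub>m n) = 1\<^sub>m n"
  by (intro eq_matI) auto

lemma mult_uminus_square_mat:
  fixes A B :: "'a::comm_ring_1 mat"
  assumes "A \<in> carrier_mat n n" "B \<in> carrier_mat n n"
  shows "A * - B = - (A * B)"
  using assms by (intro eq_matI) auto

locale schroedinger_setup = schroedinger_extension d \<rho> FW FR FD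
  for d :: nat and \<rho> :: real and FW FR FD :: "complex \<Rightarrow> complex mat" +
  fixes W R D :: "real \<Rightarrow> real mat"
  assumes W: "\<And>x. W x \<in> carrier_mat d d" and R: "\<And>x. R x \<in> sym_mats d" and D: "\<And>x. D x \<in> sym_mats d"
    and FW_cis: "\<And>x. FW (cis (2 * pi * x)) = cmat (W x)"
    and FR_cis: "\<And>x. FR (cis (2 * pi * x)) = cmat (R x)"
    and FD_cis: "\<And>x. FD (cis (2 * pi * x)) = cmat (D x)"
begin

lemma cis_ring: "cis t \<in> closed_ring outer" "cis t \<in> open_ring \<rho>"
  using outer \<rho> by (auto simp: closed_ring_def open_ring_def)

lemma R_carrier: "R x \<in> carrier_mat d d" and D_carrier: "D x \<in> carrier_mat d d"
  using R[of x] D[of x] by (auto simp: sym_mats_def)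

lemma det_FW_cis: "det (FW (cis (2 * pi * x))) = complex_of_real (det (W x))"
  by (simp add: FW_cis)

definition energy_mat :: "real \<Rightarrow> real \<Rightarrow> real \<Rightarrow> real mat" where
  "energy_mat lam E x = lam \<cdot>\<^sub>m D x - R x - E \<cdot>\<^sub>m 1\<^sub>m d"

lemma energy_mat_carrier: "energy_mat lam E x \<in> carrier_mat d d"
  unfolding energy_mat_def by (intro minus_carrier_mat) auto

lemma energy_mat_sym: "transpose_mat (energy_mat lam E x) = energy_mat lam E x"
proof (rule eq_matI)
  fix i j assume "i < dim_row (energy_mat lam E x)" "j < dim_col (energy_mat lam E x)"
  hence ij: "i < d" "j < d" using energy_mat_carrier[of lam E x] by auto
  have sym: "A $$ (j, i) = A $$ (i, j)" if "A \<in> sym_mats d" for A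
  proof -
    have "A \<in> carrier_mat d d" "transpose_mat A = A" using that by (auto simp: sym_mats_def)
    thus ?thesis using ij by (metis carrier_matD(1,2) index_transpose_mat(1))
  qed
  show "transpose_mat (energy_mat lam E x) $$ (i, j) = energy_mat lam E x $$ (i, j)"
    using ij R_carrier[of x] D_carrier[of x] sym[OF R] sym[OF D] by (simp add: energy_mat_def)
qed (use energy_mat_carrier[of lam E x] in auto)

lemma energy_block_cis: "energy_block lam E (cis (2 * pi * x)) = cmat (energy_mat lam E x)"
  unfolding energy_block_def energy_mat_def FD_cis FR_cis
  using R_carrier[of x] D_carrier[of x] by (intro eq_matI) auto

lemma W_inverse:
  assumes "det (W x) \<noteq> 0"
  obtains V where "mat_inverse (W x) = Some V" "V \<in> carrier_mat d d" "W x * V = 1\<^sub>m d" "V * W x = 1\<^sub>m d"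
proof -
  have "W x \<in> Units (ring_mat TYPE(real) d ())"
    using assms W by (intro det_non_zero_imp_unit) auto
  then obtain V where V: "mat_inverse (W x) = Some V"
    using mat_inverse(1)[OF W, where b = "()"] by (cases "mat_inverse (W x)") auto
  thus ?thesis using that mat_inverse(2)[OF W V] by auto
qed

text \<open>Evaluated on two solutions of the equation this antisymmetric form is their discrete
  Wronskian.\<close>

definition form :: "real \<Rightarrow> real mat" where
  "form x = four_block_mat (0\<^sub>m d d) (- transpose_mat (W x)) (W x) (0\<^sub>m d d)"

lemma form_carrier: "form x \<in> carrier_mat (d + d) (d + d)"
  unfolding form_def by (intro four_block_carrier_mat) auto

text \<open>Swapping the two block columns makes the matrix block diagonal; the swap
  \<open>S\<close> squares to the identity, so its determinant has modulus 1.\<close>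

lemma det_form: "\<bar>det (form x)\<bar> = (det (W x))\<^sup>2"
proof -
  define S :: "real mat" where "S = four_block_mat (0\<^sub>m d d) (1\<^sub>m d) (1\<^sub>m d) (0\<^sub>m d d)"
  have Sc: "S \<in> carrier_mat (d + d) (d + d)" unfolding S_def by (intro four_block_carrier_mat) auto
  have "S * S = four_block_mat (1\<^sub>m d) (0\<^sub>m d d) (0\<^sub>m d d) (1\<^sub>m d)"
    unfolding S_def by (subst mult_four_block_mat[of _ d d _ d _ d _ _ d _ d]) auto
  also have "\<dots> = 1\<^sub>m (d + d)" by simp
  finally have "det S * det S = 1" using det_mult[OF Sc Sc] by simp
  hence S1: "\<bar>det S\<bar> = 1" by (metis abs_mult abs_one abs_square_eq_1 power2_eq_square)
  have WT: "transpose_mat (W x) \<in> carrier_mat d d" using W[of x] by simp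
  have "form x * S = four_block_mat (- transpose_mat (W x)) (0\<^sub>m d d) (0\<^sub>m d d) (W x)"
    unfolding S_def form_def using W[of x] WT
    by (subst mult_four_block_mat[of _ d d _ d _ d _ _ d _ d]) auto
  hence "det (form x) * det S = det (- transpose_mat (W x)) * det (W x)"
    using det_mult[OF form_carrier[of x] Sc] det_four_block_mat_lower_left_zero[of "- transpose_mat (W x)" d "0\<^sub>m d d" d "0\<^sub>m d d" "W x"] W[of x] WT
    by simp
  also have "- transpose_mat (W x) = (- 1) \<cdot>\<^sub>m transpose_mat (W x)" using WT by (intro eq_matI) auto
  finally have "det (form x) * det S = (- 1) ^ d * (det (W x) * det (W x))"
    using WT W[of x] det_transpose[OF W[of x]] by simp
  hence "\<bar>det (form x)\<bar> * \<bar>det S\<bar> = \<bar>det (W x) * det (W x)\<bar>"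
    by (simp add: abs_mult[symmetric]) (simp add: abs_mult power_abs)
  thus ?thesis using S1 by (simp add: power2_eq_square)
qed

context
  fixes \<omega> lam E :: real
begin

abbreviation cocycle :: "real \<Rightarrow> real mat" where
  "cocycle \<equiv> schroedinger_cocycle d \<omega> W R D lam E"

abbreviation iterate :: "nat \<Rightarrow> real \<Rightarrow> real mat" where
  "iterate \<equiv> cocycle_iterate \<omega> cocycle"

abbreviation rot :: complex where "rot \<equiv> cis (2 * pi * \<omega>)"

lemma cis_rot: "cis (2 * pi * x) * rot ^ n = cis (2 * pi * (x + real n * \<omega>))"
proof -
  have "cis (2 * pi * x) * rot ^ n = cis (2 * pi * x + real n * (2 * pi * \<omega>))"
    by (simp only: Complex.DeMoivre cis_mult)
  also have "2 * pi * x + real n * (2 * pi * \<omega>) = 2 * pi * (x + real n * \<omega>)" by (simp add: algebra_simps)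
  finally show ?thesis .
qed

text \<open>The scaling identity rests on adj W' = det W' times the inverse. In the form identity W'
  cancels the inverse hidden in the cocycle, and the upper left block vanishes because the energy
  matrix is symmetric.\<close>

lemma cocycle_facts:
  assumes det: "det (W (x + \<omega>)) \<noteq> 0"
  shows "cocycle x \<in> carrier_mat (d + d) (d + d)"
    and "transfer lam E rot (cis (2 * pi * x)) = complex_of_real (det (W (x + \<omega>))) \<cdot>\<^sub>m cmat (cocycle x)"
    and "transpose_mat (cocycle x) * (form (x + \<omega>) * cocycle x) = form x"
proof -
  let ?W' = "W (x + \<omega>)" and ?H = "energy_mat lam E x" and ?T = "transpose_mat (W x)"
  let ?w = "complex_of_real (det ?W')"
  obtain V where V: "mat_inverse ?W' = Some V" "V \<in> carrier_mat d d" "?W' * V = 1\<^sub>m d" "V * ?W' = 1\<^sub>m d"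
    using W_inverse[OF det] .
  note W' = W[of "x + \<omega>"] and H = energy_mat_carrier[of lam E x]
  have T: "?T \<in> carrier_mat d d" using W[of x] by simp
  have A: "cocycle x = four_block_mat (V * ?H) (- (V * ?T)) (1\<^sub>m d) (0\<^sub>m d d)"
    by (simp add: schroedinger_cocycle_def V(1) energy_mat_def)
  have VH: "V * ?H \<in> carrier_mat d d" and VT: "V * ?T \<in> carrier_mat d d" using V(2) H T by auto
  show Ac: "cocycle x \<in> carrier_mat (d + d) (d + d)"
    unfolding A using VH VT by (intro four_block_carrier_mat) auto
  have zu: "cis (2 * pi * x) * rot = cis (2 * pi * (x + \<omega>))"
    using cis_rot[of x 1] by simp
  have cW': "cmat ?W' \<in> carrier_mat d d" and cV: "cmat V \<in> carrier_mat d d" using W' V by auto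
  have "adj_mat (cmat ?W') = adj_mat (cmat ?W') * (cmat ?W' * cmat V)"
  proof -
    have "cmat ?W' * cmat V = cmat (?W' * V)" by (rule cmat_mult[OF W' V(2), symmetric])
    also have "\<dots> = 1\<^sub>m d" unfolding V(3) by (rule cmat_one)
    finally show ?thesis using adj_mat(1)[OF cW'] by simp
  qed
  also have "\<dots> = (adj_mat (cmat ?W') * cmat ?W') * cmat V"
    by (rule assoc_mult_mat[symmetric, OF adj_mat(1)[OF cW'] cW' cV])
  also have "\<dots> = ?w \<cdot>\<^sub>m cmat V"
    unfolding adj_mat(3)[OF cW'] using cV by (simp add: mult_smult_assoc_mat[of _ d d _ d])
  finally have adj: "adj_mat (cmat ?W') = ?w \<cdot>\<^sub>m cmat V" .
  have b1: "adj_mat (cmat ?W') * cmat ?H = ?w \<cdot>\<^sub>m cmat (V * ?H)"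
    unfolding adj cmat_mult[OF V(2) H]
    using cV H by (intro mult_smult_assoc_mat[of _ d d _ d]) auto
  have "transpose_mat (cmat (W x)) = cmat ?T" using W[of x] by (intro eq_matI) auto
  hence b2: "adj_mat (cmat ?W') * transpose_mat (cmat (W x)) = ?w \<cdot>\<^sub>m cmat (V * ?T)"
    unfolding adj cmat_mult[OF V(2) T]
    using cV T by (simp add: mult_smult_assoc_mat[of _ d d _ d])
  show "transfer lam E rot (cis (2 * pi * x)) = ?w \<cdot>\<^sub>m cmat (cocycle x)"
    unfolding transfer_def zu FW_cis energy_block_cis b1 b2 A
  proof (rule eq_matI)
    let ?L = "four_block_mat (?w \<cdot>\<^sub>m cmat (V * ?H)) (- (?w \<cdot>\<^sub>m cmat (V * ?T))) (det (cmat ?W') \<cdot>\<^sub>m 1\<^sub>m d) (0\<^sub>m d d)"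
    let ?R = "?w \<cdot>\<^sub>m cmat (four_block_mat (V * ?H) (- (V * ?T)) (1\<^sub>m d) (0\<^sub>m d d))"
    fix i j assume "i < dim_row ?R" "j < dim_col ?R"
    hence ij: "i < d + d" "j < d + d" using VH by auto
    show "?L $$ (i, j) = ?R $$ (i, j)"
    proof (cases "i < d")
      case i: True
      show ?thesis
      proof (cases "j < d")
        case True
        thus ?thesis using i ij carrier_matD[OF VH] carrier_matD[OF VT] by (simp del: index_mult_mat)
      next
        case False
        thus ?thesis using i ij carrier_matD[OF VH] carrier_matD[OF VT] by (simp del: index_mult_mat)
      qed
    next
      case False
      thus ?thesis using ij carrier_matD[OF VH] carrier_matD[OF VT] by (simp del: index_mult_mat)
    qed
  qed (use VH VT in auto)
  let ?T' = "transpose_mat ?W'"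
  have T': "?T' \<in> carrier_mat d d" using W' by simp
  have W'VH: "?W' * (V * ?H) = ?H"
    using assoc_mult_mat[OF W' V(2) H] H unfolding V(3) by simp
  have W'VT: "?W' * (V * ?T) = ?T"
    using assoc_mult_mat[OF W' V(2) T] T unfolding V(3) by simp
  have JA: "form (x + \<omega>) * cocycle x = four_block_mat (- ?T') (0\<^sub>m d d) ?H (- ?T)"
    unfolding form_def A
  proof (subst mult_four_block_mat[of _ d d _ d _ d _ _ d _ d])
    have e1: "0\<^sub>m d d * (V * ?H) + - ?T' * 1\<^sub>m d = - ?T'"
      using left_mult_zero_mat[OF VH, of d] T' by simp
    have e2: "0\<^sub>m d d * - (V * ?T) + - ?T' * 0\<^sub>m d d = 0\<^sub>m d d"
      using left_mult_zero_mat[of "- (V * ?T)" d d d] right_mult_zero_mat[of "- ?T'" d d d] VT T' by simp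
    have e3: "?W' * (V * ?H) + 0\<^sub>m d d * 1\<^sub>m d = ?H" unfolding W'VH using H by simp
    have e4: "?W' * - (V * ?T) + 0\<^sub>m d d * 0\<^sub>m d d = - ?T"
    proof -
      have "?W' * - (V * ?T) = - (?W' * (V * ?T))" by (rule mult_uminus_square_mat[OF W' VT])
      thus ?thesis unfolding W'VT using T by simp
    qed
    show "four_block_mat (0\<^sub>m d d * (V * ?H) + - ?T' * 1\<^sub>m d) (0\<^sub>m d d * - (V * ?T) + - ?T' * 0\<^sub>m d d)
       (?W' * (V * ?H) + 0\<^sub>m d d * 1\<^sub>m d) (?W' * - (V * ?T) + 0\<^sub>m d d * 0\<^sub>m d d) =
       four_block_mat (- ?T') (0\<^sub>m d d) ?H (- ?T)" unfolding e1 e2 e3 e4 ..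
  qed (use VH VT T' W' in auto)
  have VHt: "transpose_mat (V * ?H) \<in> carrier_mat d d" "transpose_mat (V * ?T) \<in> carrier_mat d d" using VH VT by auto
  have At: "transpose_mat (cocycle x) =
      four_block_mat (transpose_mat (V * ?H)) (1\<^sub>m d) (- transpose_mat (V * ?T)) (0\<^sub>m d d)"
    unfolding A by (subst transpose_four_block_mat[of _ d d _ d _ d]) (use VH VT in \<open>auto simp: transpose_uminus\<close>)
  show "transpose_mat (cocycle x) * (form (x + \<omega>) * cocycle x) = form x"
    unfolding JA At
  proof (subst mult_four_block_mat[of _ d d _ d _ d _ _ d _ d])
    have h: "transpose_mat (V * ?H) * ?T' = ?H"
      using transpose_mult[OF W' VH] unfolding W'VH energy_mat_sym by simp
    have t: "transpose_mat (V * ?T) * ?T' = W x"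
      using transpose_mult[OF W' VT] unfolding W'VT by simp
    have e1: "transpose_mat (V * ?H) * - ?T' + 1\<^sub>m d * ?H = 0\<^sub>m d d"
    proof -
      have "transpose_mat (V * ?H) * - ?T' = - ?H"
        using mult_uminus_square_mat[OF VHt(1) T'] unfolding h .
      thus ?thesis using H by (intro eq_matI) auto
    qed
    have e2: "transpose_mat (V * ?H) * 0\<^sub>m d d + 1\<^sub>m d * - ?T = - ?T"
      using right_mult_zero_mat[OF VHt(1), of d] T by simp
    have e3: "- transpose_mat (V * ?T) * - ?T' + 0\<^sub>m d d * ?H = W x"
    proof -
      have "- transpose_mat (V * ?T) * - ?T' = - (transpose_mat (V * ?T) * - ?T')"
        using VHt T' by (intro uminus_mult_left_mat) auto
      also have "transpose_mat (V * ?T) * - ?T' = - W x"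
        using mult_uminus_square_mat[OF VHt(2) T'] unfolding t .
      finally have "- transpose_mat (V * ?T) * - ?T' = W x" using W[of x] by (simp add: uminus_uminus_mat)
      thus ?thesis using H W[of x] by simp
    qed
    have e4: "- transpose_mat (V * ?T) * 0\<^sub>m d d + 0\<^sub>m d d * - ?T = 0\<^sub>m d d"
      using right_mult_zero_mat[of "- transpose_mat (V * ?T)" d d d] left_mult_zero_mat[of "- ?T" d d d] VHt T by simp
    show "four_block_mat (transpose_mat (V * ?H) * - ?T' + 1\<^sub>m d * ?H) (transpose_mat (V * ?H) * 0\<^sub>m d d + 1\<^sub>m d * - ?T)
       (- transpose_mat (V * ?T) * - ?T' + 0\<^sub>m d d * ?H) (- transpose_mat (V * ?T) * 0\<^sub>m d d + 0\<^sub>m d d * - ?T) = form x"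
      unfolding e1 e2 e3 e4 form_def ..
  qed (use VHt H T T' in auto)
qed

text \<open>The scalar factors are taken at x + (j + 1) \<omega> because the cocycle inverts W one
  step ahead. The form identities of single steps telescope.\<close>

lemma iterate_facts:
  assumes good: "\<And>j. det (W (x + real j * \<omega>)) \<noteq> 0"
  shows "iterate n x \<in> carrier_mat (d + d) (d + d) \<and>
    transfer_iterate lam E rot n (cis (2 * pi * x)) =
      complex_of_real (\<Prod>j<n. det (W (x + real (Suc j) * \<omega>))) \<cdot>\<^sub>m cmat (iterate n x) \<and>
    transpose_mat (iterate n x) * (form (x + real n * \<omega>) * iterate n x) = form x"
proof (induction n)
  case 0
  \<comment> \<open>The zeroth iterate takes its size from \<open>cocycle x\<close>, so even here W
    must be invertible at x + \<omega>.\<close>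
  have "cocycle x \<in> carrier_mat (d + d) (d + d)"
    using cocycle_facts(1)[of x] good[of 1] by simp
  hence i0: "iterate 0 x = 1\<^sub>m (d + d)" by simp
  have "transpose_mat (1\<^sub>m (d + d)) * (form x * 1\<^sub>m (d + d)) = form x"
    using form_carrier[of x] by simp
  thus ?case unfolding i0 by (auto intro!: eq_matI)
next
  case (Suc n)
  let ?y = "x + real n * \<omega>" and ?M = "iterate n x"
  let ?p = "complex_of_real (\<Prod>j<n. det (W (x + real (Suc j) * \<omega>)))"
  have y': "?y + \<omega> = x + real (Suc n) * \<omega>" by (simp add: algebra_simps)
  have dety: "det (W (?y + \<omega>)) \<noteq> 0" unfolding y' by (rule good)
  note cf = cocycle_facts[OF dety]
  have M: "?M \<in> carrier_mat (d + d) (d + d)" using Suc by blast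
  have AM: "cocycle ?y * ?M \<in> carrier_mat (d + d) (d + d)" using cf(1) M by simp
  have "transfer_iterate lam E rot (Suc n) (cis (2 * pi * x)) =
      (complex_of_real (det (W (?y + \<omega>))) \<cdot>\<^sub>m cmat (cocycle ?y)) * (?p \<cdot>\<^sub>m cmat ?M)"
    using Suc unfolding transfer_iterate.simps cis_rot cf(2) by simp
  also have "\<dots> = (complex_of_real (det (W (?y + \<omega>))) * ?p) \<cdot>\<^sub>m (cmat (cocycle ?y) * cmat ?M)"
  proof -
    have c: "cmat (cocycle ?y) \<in> carrier_mat (d + d) (d + d)" "cmat ?M \<in> carrier_mat (d + d) (d + d)"
      using cf(1) M by auto
    have smult: "(a \<cdot>\<^sub>m A) * (b \<cdot>\<^sub>m B) = (a * b) \<cdot>\<^sub>m (A * B)"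
      if "A \<in> carrier_mat (d + d) (d + d)" "B \<in> carrier_mat (d + d) (d + d)" for a b :: complex and A B
      using mult_smult_assoc_mat[OF that(1) smult_carrier_mat[OF that(2)], of a b]
        mult_smult_distrib[OF that, of b] by (auto simp: mult.assoc intro!: eq_matI)
    show ?thesis by (rule smult[OF c])
  qed
  also have "cmat (cocycle ?y) * cmat ?M = cmat (iterate (Suc n) x)"
    using cmat_mult[OF cf(1) M] by simp
  also have "complex_of_real (det (W (?y + \<omega>))) * ?p = complex_of_real (\<Prod>j<Suc n. det (W (x + real (Suc j) * \<omega>)))"
    unfolding y' by simp
  finally have "transfer_iterate lam E rot (Suc n) (cis (2 * pi * x)) =
     complex_of_real (\<Prod>j<Suc n. det (W (x + real (Suc j) * \<omega>))) \<cdot>\<^sub>m cmat (iterate (Suc n) x)" .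
  moreover have "transpose_mat (iterate (Suc n) x) * (form (x + real (Suc n) * \<omega>) * iterate (Suc n) x) = form x"
  proof -
    let ?A = "cocycle ?y" and ?J = "form (?y + \<omega>)"
    note J = form_carrier[of "?y + \<omega>"] and A = cf(1)
    have At: "transpose_mat ?A \<in> carrier_mat (d + d) (d + d)" and Mt: "transpose_mat ?M \<in> carrier_mat (d + d) (d + d)"
      using A M by auto
    have JA: "?J * ?A \<in> carrier_mat (d + d) (d + d)" using J A by simp
    have "transpose_mat (?A * ?M) * (?J * (?A * ?M)) = (transpose_mat ?M * transpose_mat ?A) * ((?J * ?A) * ?M)"
      using transpose_mult[OF A M] assoc_mult_mat[OF J A M] by simp
    also have "\<dots> = transpose_mat ?M * (transpose_mat ?A * ((?J * ?A) * ?M))"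
      by (rule assoc_mult_mat[OF Mt At mult_carrier_mat[OF JA M]])
    also have "transpose_mat ?A * ((?J * ?A) * ?M) = (transpose_mat ?A * (?J * ?A)) * ?M"
      by (rule assoc_mult_mat[symmetric, OF At JA M])
    also have "transpose_mat ?A * (?J * ?A) = form ?y" by (rule cf(3))
    also have "transpose_mat ?M * (form ?y * ?M) = form x" using Suc by blast
    finally show ?thesis unfolding y'[symmetric] by simp
  qed
  ultimately show ?case using AM by simp
qed

end

end

section \<open>Lyapunov exponents\<close>

lemma (in rotation_process) growth_le_of_bound:
  assumes "\<And>n x. 1 \<le> n \<Longrightarrow> g n x \<le> F * exp (l * real n)" "0 < F"
  shows "growth \<le> l"
proof (rule field_le_epsilon)
  fix e :: real assume e: "0 < e"
  have "filterlim (\<lambda>n. e * real n) at_top sequentially"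
    using e by (intro filterlim_tendsto_pos_mult_at_top[OF tendsto_const] filterlim_real_sequentially)
  hence "\<forall>\<^sub>F n in sequentially. ln F \<le> e * real n" by (simp add: filterlim_at_top)
  hence "\<forall>\<^sub>F n in sequentially. \<forall>x. g n x \<le> exp ((l + e) * real n)"
    using eventually_ge_at_top[of 1]
  proof eventually_elim
    case (elim n)
    have "F = exp (ln F)" using assms(2) by simp
    also have "\<dots> \<le> exp (e * real n)" using elim by simp
    finally have "F * exp (l * real n) \<le> exp (e * real n) * exp (l * real n)" by (rule mult_right_mono) simp
    also have "\<dots> = exp ((l + e) * real n)" by (simp add: exp_add[symmetric] algebra_simps)
    finally show ?case using assms(1)[OF elim(2)] by (meson order_trans)
  qed
  thus "growth \<le> l + e" by (intro growth_le) (simp add: rates_def)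
qed

lemma tendsto_div_nat_bounded_diff:
  fixes a b :: "nat \<Rightarrow> real"
  assumes a: "(\<lambda>n. a n / real n) \<longlonglongrightarrow> L" and C: "\<forall>\<^sub>F n in sequentially. \<bar>b n - a n\<bar> \<le> C"
  shows "(\<lambda>n. b n / real n) \<longlonglongrightarrow> L"
proof -
  have "(\<lambda>n. C / real n) \<longlonglongrightarrow> 0" by (rule tendsto_divide_0[OF tendsto_const filterlim_real_at_infinity_sequentially])
  moreover have "\<forall>\<^sub>F n in sequentially. norm (b n / real n - a n / real n) \<le> C / real n"
    using C
  proof eventually_elim
    case (elim n)
    have "b n / real n - a n / real n = (b n - a n) / real n" by (simp add: diff_divide_distrib)
    thus ?case using elim by (simp add: abs_divide divide_right_mono)
  qed
  ultimately have "(\<lambda>n. b n / real n - a n / real n) \<longlonglongrightarrow> 0" by (rule Lim_null_comparison[rotated])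
  from tendsto_add[OF this a] show ?thesis by simp
qed

text \<open>Serves the index shift between the two products of det W.\<close>

lemma tendsto_div_nat_Suc:
  fixes a :: "nat \<Rightarrow> real"
  assumes a: "(\<lambda>n. a n / real n) \<longlonglongrightarrow> L"
  shows "(\<lambda>n. a (Suc n) / real n) \<longlonglongrightarrow> L"
proof -
  have "(\<lambda>n. a (Suc n) / real (Suc n) * (1 + 1 / real n)) \<longlonglongrightarrow> L * (1 + 0)"
    by (intro tendsto_mult tendsto_add tendsto_const LIMSEQ_Suc[OF a] lim_1_over_n)
  moreover have "\<forall>\<^sub>F n in sequentially. a (Suc n) / real (Suc n) * (1 + 1 / real n) = a (Suc n) / real n"
    using eventually_gt_at_top[of 0]
  proof eventually_elim
    case (elim n)
    hence "1 + 1 / real n = real (Suc n) / real n" by (simp add: field_simps)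
    thus ?case by simp
  qed
  ultimately have "(\<lambda>n. a (Suc n) / real n) \<longlonglongrightarrow> L * (1 + 0)" by (rule Lim_transform_eventually)
  thus ?thesis by simp
qed

lemma AE_circle_exists:
  assumes "AE x in lebesgue_on {0..<1::real}. P x"
  shows "\<exists>x. P x"
proof (rule ccontr)
  assume "\<not> ?thesis"
  hence "AE x in lebesgue_on {0..<1::real}. False" using assms by simp
  hence "emeasure (lebesgue_on {0..<1::real}) (space (lebesgue_on {0..<1})) = 0"
    using ae_filter_eq_bot_iff[of "lebesgue_on {0..<1::real}"] by (simp add: trivial_limit_def)
  thus False by (simp add: emeasure_restrict_space)
qed

lemma mat_inverse_exists:
  fixes A :: "real mat"
  assumes A: "A \<in> carrier_mat n n" and det: "det A \<noteq> 0"
  shows "\<exists>B\<in>carrier_mat n n. B * A = 1\<^sub>m n"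
proof
  show "inverse (det A) \<cdot>\<^sub>m adj_mat A \<in> carrier_mat n n" using adj_mat(1)[OF A] by simp
  have "(inverse (det A) \<cdot>\<^sub>m adj_mat A) * A = inverse (det A) \<cdot>\<^sub>m (adj_mat A * A)"
    by (rule mult_smult_assoc_mat[OF adj_mat(1)[OF A] A])
  also have "\<dots> = 1\<^sub>m n" unfolding adj_mat(3)[OF A] using det by (intro eq_matI) auto
  finally show "(inverse (det A) \<cdot>\<^sub>m adj_mat A) * A = 1\<^sub>m n" .
qed

lemma unit_complex_cis:
  assumes "norm z = 1" shows "\<exists>x. z = cis (2 * pi * x)"
proof -
  have "z \<noteq> 0" using assms by auto
  hence "cis (Arg z) = z" using cis_Arg[of z] assms by (simp add: sgn_eq)
  thus ?thesis by (intro exI[of _ "Arg z / (2 * pi)"]) simp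
qed

section \<open>Determinant and compound processes of the cocycle\<close>

context schroedinger_setup
begin

lemma abs_det_W: "\<bar>det (W x)\<bar> = norm (det (FW (cis (2 * pi * x))))"
  unfolding det_FW_cis by simp

lemma cis_periodic: "cis (2 * pi * (x + 1)) = cis (2 * pi * x)"
  by (simp add: cis.ctr distrib_left)

lemma continuous_on_comp_cis:
  assumes "f holomorphic_on open_ring \<rho>"
  shows "continuous_on UNIV (\<lambda>x :: real. f (cis (2 * pi * x)))"
  by (rule continuous_on_compose2[OF holomorphic_on_imp_continuous_on[OF assms]])
     (use cis_ring in \<open>auto intro!: continuous_intros\<close>)

lemma form_compound_bound: "\<exists>C>0. \<forall>y. compound_norm k (form y) \<le> C"
proof -
  obtain K where K: "1 \<le> K" "\<And>z. z \<in> closed_ring outer \<Longrightarrow> entries_le K (FW z)"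
    using uniform_entry_bound by blast
  have We: "\<bar>W y $$ (i, j)\<bar> \<le> K" if "i < d" "j < d" for y i j
  proof -
    have "entries_le K (cmat (W y))" using K(2)[OF cis_ring(1), of "2 * pi * y"] by (simp add: FW_cis)
    hence "norm (cmat (W y) $$ (i, j)) \<le> K" using that W[of y] by (auto simp: entries_le_def)
    thus ?thesis using that W[of y] by simp
  qed
  have "norm (form y $$ (i, j)) \<le> K" if ij: "i < d + d" "j < d + d" for y i j
  proof (cases "i < d")
    case True
    thus ?thesis using ij W[of y] K(1) We[of "j - d" i y] by (cases "j < d") (simp_all add: form_def)
  next
    case False
    thus ?thesis using ij W[of y] K(1) We[of "i - d" j y] by (cases "j < d") (simp_all add: form_def)
  qed
  hence "compound_norm k (form y) \<le> real (d + d) ^ k * K ^ k" for y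
    using K(1) by (intro compound_norm_le[OF form_carrier]) auto
  moreover have "0 < real (d + d) ^ k * K ^ k" using d K(1) by simp
  ultimately show ?thesis by blast
qed

context
  fixes \<omega> lam E :: real
begin

abbreviation cocycle_it :: "nat \<Rightarrow> real \<Rightarrow> real mat" where
  "cocycle_it \<equiv> cocycle_iterate \<omega> (schroedinger_cocycle d \<omega> W R D lam E)"

text \<open>The case j = 0 is included, although the iterates begin with W at x + \<omega>, because
  the form at \<open>x\<close> has to be inverted.\<close>

definition good_point :: "real \<Rightarrow> bool" where
  "good_point x \<longleftrightarrow> (\<forall>j::nat. det (W (x + real j * \<omega>)) \<noteq> 0)"

lemma good_iterate:
  assumes "good_point x"
  shows "cocycle_it n x \<in> carrier_mat (d + d) (d + d)"
    and "transfer_iterate lam E (cis (2 * pi * \<omega>)) n (cis (2 * pi * x)) =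
      complex_of_real (\<Prod>j<n. det (W (x + real (Suc j) * \<omega>))) \<cdot>\<^sub>m cmat (cocycle_it n x)"
    and "transpose_mat (cocycle_it n x) * (form (x + real n * \<omega>) * cocycle_it n x) = form x"
  using iterate_facts[of x \<omega> lam E n] assms unfolding good_point_def by blast+

text \<open>Determinants of the form identity: the form contributes the square of det W at either
  end and the iterate enters twice, so a square root can be taken.\<close>

lemma abs_det_cocycle_it:
  assumes g: "good_point x"
  shows "\<bar>det (cocycle_it n x)\<bar> * \<bar>det (W (x + real n * \<omega>))\<bar> = \<bar>det (W x)\<bar>"
proof -
  let ?M = "cocycle_it n x" and ?J = "form (x + real n * \<omega>)"
  note M = good_iterate(1)[OF g, of n] and J = form_carrier[of "x + real n * \<omega>"]
  have "det (form x) = det (transpose_mat ?M) * (det ?J * det ?M)"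
    unfolding good_iterate(3)[OF g, of n, symmetric]
    using det_mult[OF _ mult_carrier_mat[OF J M], of "transpose_mat ?M"] det_mult[OF J M] M by simp
  hence "\<bar>det (form x)\<bar> = \<bar>det ?M\<bar> * (\<bar>det ?J\<bar> * \<bar>det ?M\<bar>)"
    unfolding det_transpose[OF M] by (simp add: abs_mult)
  hence "(\<bar>det ?M\<bar> * \<bar>det (W (x + real n * \<omega>))\<bar>)\<^sup>2 = \<bar>det (W x)\<bar>\<^sup>2"
    unfolding det_form by (simp add: power2_eq_square)
  thus ?thesis by (rule power2_eq_imp_eq) simp_all
qed

text \<open>The symplectic form turns \<open>M\<^sup>-\<^sup>1\<close> into a bounded multiple of \<open>M\<^sup>T\<close>.\<close>

lemma compound_norm_duality:
  assumes g: "good_point x" and k: "k \<le> d + d"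
  shows "\<exists>C>0. \<forall>n. compound_norm k (1\<^sub>m (d + d) :: real mat) \<le> C * (compound_norm k (cocycle_it n x))\<^sup>2 \<and>
    sv_prod (d + d - k) (cocycle_it n x) \<le> C * compound_norm k (cocycle_it n x) * \<bar>det (cocycle_it n x)\<bar>"
proof -
  obtain CJ where CJ: "0 < CJ" "\<And>y. compound_norm k (form y) \<le> CJ" using form_compound_bound by blast
  have "det (W x) \<noteq> 0" using g unfolding good_point_def by (metis add.right_neutral mult_zero_left of_nat_0)
  hence "det (form x) \<noteq> 0" using det_form[of x] by auto
  then obtain J' where J': "J' \<in> carrier_mat (d + d) (d + d)" "J' * form x = 1\<^sub>m (d + d)"
    using mat_inverse_exists[OF form_carrier] by blast
  define C0 where "C0 = compound_norm k J' * CJ + 1"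
  have C0: "1 \<le> C0" using CJ(1) compound_norm_nonneg[of k J'] by (simp add: C0_def)
  have main: "compound_norm k (1\<^sub>m (d + d) :: real mat) \<le> C0 * (compound_norm k (cocycle_it n x))\<^sup>2 \<and>
    sv_prod (d + d - k) (cocycle_it n x) \<le> fact k * C0 * compound_norm k (cocycle_it n x) * \<bar>det (cocycle_it n x)\<bar>" for n
  proof -
    let ?M = "cocycle_it n x" and ?J = "form (x + real n * \<omega>)"
    note M = good_iterate(1)[OF g, of n] and J = form_carrier[of "x + real n * \<omega>"]
    have Mt: "transpose_mat ?M \<in> carrier_mat (d + d) (d + d)" using M by simp
    have MtJ: "transpose_mat ?M * ?J \<in> carrier_mat (d + d) (d + d)" using Mt J by simp
    define M' where "M' = J' * (transpose_mat ?M * ?J)"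
    have M'c: "M' \<in> carrier_mat (d + d) (d + d)" unfolding M'_def using J'(1) MtJ by simp
    have "M' * ?M = J' * ((transpose_mat ?M * ?J) * ?M)"
      unfolding M'_def by (rule assoc_mult_mat[OF J'(1) MtJ M])
    also have "(transpose_mat ?M * ?J) * ?M = form x"
      using assoc_mult_mat[OF Mt J M] good_iterate(3)[OF g, of n] by simp
    finally have inv: "M' * ?M = 1\<^sub>m (d + d)" using J'(2) by simp
    have c0: "0 \<le> compound_norm k ?M" by (rule compound_norm_nonneg)
    have "compound_norm k M' \<le> compound_norm k J' * (compound_norm k ?M * compound_norm k ?J)"
      unfolding M'_def
      using compound_norm_mult[OF J'(1) MtJ, of k] compound_norm_mult[OF Mt J, of k]
        mult_left_mono[OF compound_norm_mult[OF Mt J, of k] compound_norm_nonneg[of k J']]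
      unfolding compound_norm_transpose[OF M] by linarith
    also have "\<dots> \<le> compound_norm k J' * (compound_norm k ?M * CJ)"
      using CJ(2) c0 compound_norm_nonneg[of k J'] by (intro mult_left_mono) auto
    also have "\<dots> = (compound_norm k J' * CJ) * compound_norm k ?M" by simp
    also have "\<dots> \<le> C0 * compound_norm k ?M" using c0 by (intro mult_right_mono) (auto simp: C0_def)
    finally have M'le: "compound_norm k M' \<le> C0 * compound_norm k ?M" .
    have "compound_norm k (1\<^sub>m (d + d) :: real mat) \<le> compound_norm k M' * compound_norm k ?M"
      unfolding inv[symmetric] by (rule compound_norm_mult[OF M'c M])
    also have "\<dots> \<le> C0 * compound_norm k ?M * compound_norm k ?M" by (rule mult_right_mono[OF M'le c0])
    finally have 1: "compound_norm k (1\<^sub>m (d + d) :: real mat) \<le> C0 * (compound_norm k ?M)\<^sup>2"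
      by (simp add: power2_eq_square mult.assoc)
    have "sv_prod (d + d - k) ?M \<le> fact k * compound_norm k M' * sv_prod (d + d) ?M"
      by (rule sv_prod_inverse[OF M M'c inv k])
    also have "\<dots> \<le> fact k * (C0 * compound_norm k ?M) * \<bar>det ?M\<bar>"
      unfolding sv_prod_eq_abs_det[OF M] using M'le by (intro mult_right_mono mult_left_mono) auto
    finally show ?thesis using 1 by (simp add: mult.assoc)
  qed
  show ?thesis
  proof (rule exI[of _ "fact k * C0"], intro conjI allI)
    have f1: "(1::real) \<le> fact k" by (rule fact_ge_1)
    have "1 * C0 \<le> fact k * C0" using f1 C0 by (intro mult_right_mono) auto
    hence CC: "C0 \<le> fact k * C0" by simp
    show "0 < fact k * C0" using C0 CC by linarith
    fix n
    have "C0 * (compound_norm k (cocycle_it n x))\<^sup>2 \<le> fact k * C0 * (compound_norm k (cocycle_it n x))\<^sup>2"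
      using CC by (rule mult_right_mono) simp
    thus "compound_norm k (1\<^sub>m (d + d) :: real mat) \<le> fact k * C0 * (compound_norm k (cocycle_it n x))\<^sup>2"
      using main[of n] by linarith
    show "sv_prod (d + d - k) (cocycle_it n x) \<le> fact k * C0 * compound_norm k (cocycle_it n x) * \<bar>det (cocycle_it n x)\<bar>"
      using main[of n] by blast
  qed
qed

text \<open>The identity is the inverse times the iterate, and the inverse is bounded by a multiple
  of the iterate; so the squared norm cannot be small. This keeps the compound processes from
  decaying superexponentially.\<close>

lemma compound_norm_lower:
  assumes g: "good_point x" and k: "k \<le> d + d"
  shows "\<exists>c>0. \<forall>n. c \<le> compound_norm k (cocycle_it n x)"
proof -
  obtain C where C: "0 < C" "\<And>n. compound_norm k (1\<^sub>m (d + d) :: real mat) \<le> C * (compound_norm k (cocycle_it n x))\<^sup>2"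
    using compound_norm_duality[OF g k] by blast
  define c where "c = compound_norm k (1\<^sub>m (d + d) :: real mat) / C"
  have c: "0 < c" using compound_norm_one[OF k, where ?'a = real] C by (simp add: c_def)
  have "sqrt c \<le> compound_norm k (cocycle_it n x)" for n
  proof (rule real_le_lsqrt)
    show "c \<le> (compound_norm k (cocycle_it n x))\<^sup>2"
      using C(2)[of n] C(1) by (simp add: c_def divide_le_eq mult.commute)
  qed (use c compound_norm_nonneg in auto)
  thus ?thesis using c by (intro exI[of _ "sqrt c"]) auto
qed

text \<open>Starts at j = 0, whereas the scalar in front of the iterate starts at j = 1;
  \<open>abs_prod_det_W\<close> converts between the two.\<close>

definition det_prod :: "nat \<Rightarrow> real \<Rightarrow> real" where
  "det_prod n x = (\<Prod>j<n. \<bar>det (W (x + real j * \<omega>))\<bar>)"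

lemma det_prod_process:
  assumes irr: "\<omega> \<notin> \<rat>"
  shows "rotation_process \<omega> det_prod"
proof
  show "\<omega> \<notin> \<rat>" by (rule irr)
  have c1: "continuous_on UNIV (\<lambda>x. \<bar>det (W x)\<bar>)"
    unfolding abs_det_W by (intro continuous_on_norm continuous_on_comp_cis holo_det[OF FW])
  show "continuous_on UNIV (det_prod n)" for n
    unfolding det_prod_def
    by (intro continuous_on_prod continuous_on_compose2[OF c1]) (auto intro!: continuous_intros)
  have per: "\<bar>det (W (y + 1))\<bar> = \<bar>det (W y)\<bar>" for y unfolding abs_det_W cis_periodic ..
  show "det_prod n (x + 1) = det_prod n x" for n x
    unfolding det_prod_def
  proof (rule prod.cong)
    fix j
    have "x + 1 + real j * \<omega> = (x + real j * \<omega>) + 1" by simp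
    thus "\<bar>det (W (x + 1 + real j * \<omega>))\<bar> = \<bar>det (W (x + real j * \<omega>))\<bar>" using per by metis
  qed simp
  show "0 \<le> det_prod n x" for n x unfolding det_prod_def by (intro prod_nonneg) auto
  show "det_prod 0 x = 1" for x by (simp add: det_prod_def)
  have "det_prod (m + n) x = det_prod n (x + real m * \<omega>) * det_prod m x" for m n x
  proof (induction n)
    case (Suc n)
    have e: "x + real (m + n) * \<omega> = x + real m * \<omega> + real n * \<omega>" by (simp add: algebra_simps)
    have "det_prod (m + Suc n) x = det_prod (m + n) x * \<bar>det (W (x + real (m + n) * \<omega>))\<bar>"
      by (simp add: det_prod_def)
    thus ?case unfolding Suc e by (simp add: det_prod_def mult_ac)
  qed (simp add: det_prod_def)
  thus "det_prod (m + n) x \<le> det_prod n (x + real m * \<omega>) * det_prod m x" for m n x by simp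
  obtain \<alpha> K0 where K0: "0 < K0" "\<And>n. \<exists>z. norm z = 1 \<and>
     K0 * exp (\<alpha> * real n) \<le> norm (\<Prod>j<n. det (FW (z * (cis (2 * pi * \<omega>)) ^ j)))"
    using det_product_growth norm_cis by metis
  have "\<exists>x. K0 * exp (\<alpha> * real n) \<le> det_prod n x" for n
  proof -
    obtain z where z: "norm z = 1" "K0 * exp (\<alpha> * real n) \<le> norm (\<Prod>j<n. det (FW (z * (cis (2 * pi * \<omega>)) ^ j)))"
      using K0(2) by blast
    obtain x where x: "z = cis (2 * pi * x)" using unit_complex_cis[OF z(1)] by blast
    have "norm (\<Prod>j<n. det (FW (z * (cis (2 * pi * \<omega>)) ^ j))) = det_prod n x"
      unfolding x cis_rot det_prod_def abs_det_W by (simp add: prod_norm)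
    thus ?thesis using z(2) by auto
  qed
  thus "\<exists>c K. 0 < K \<and> (\<exists>\<^sub>F n in sequentially. \<exists>x. K * exp (c * real n) \<le> det_prod n x)"
    using K0(1) by (intro exI[of _ \<alpha>] exI[of _ K0] conjI eventually_frequently always_eventually) auto
qed

text \<open>A zero of det W on the forward orbit makes all later products vanish.\<close>

lemma good_point_of_det_prod:
  assumes "\<forall>\<^sub>F n in sequentially. 0 < det_prod n x"
  shows "good_point x"
  unfolding good_point_def
proof (intro allI notI)
  fix j assume z: "det (W (x + real j * \<omega>)) = 0"
  have "\<forall>\<^sub>F n in sequentially. 0 < det_prod n x \<and> j < n"
    using assms eventually_gt_at_top by (rule eventually_conj)
  then obtain n where n: "0 < det_prod n x" "j < n" by (auto dest: eventually_happens)
  have "det_prod n x = 0" unfolding det_prod_def using z n(2) by (intro prod_zero) auto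
  thus False using n(1) by simp
qed

lemma abs_prod_det_W:
  "\<bar>\<Prod>j<n. det (W (x + real (Suc j) * \<omega>))\<bar> * \<bar>det (W x)\<bar> = det_prod (Suc n) x"
  unfolding det_prod_def prod.lessThan_Suc_shift by (simp add: abs_prod mult.commute)

text \<open>Time 0 is set to 1 by hand: the Hilbert-Schmidt norm of the compound of the identity is
  in general larger, while a process has to start at 1.\<close>

definition compound_process :: "nat \<Rightarrow> nat \<Rightarrow> real \<Rightarrow> real" where
  "compound_process k n x = (if n = 0 then 1
     else compound_norm k (transfer_iterate lam E (cis (2 * pi * \<omega>)) n (cis (2 * pi * x))))"

lemma transfer_carrier:
  "transfer_iterate lam E (cis (2 * pi * \<omega>)) n (cis t) \<in> carrier_mat (d + d) (d + d)"
  by (rule holo_mat_carrier[OF holo_transfer_iterate cis_ring(2)]) simp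

lemma compound_norm_transfer:
  assumes g: "good_point x"
  shows "compound_norm k (transfer_iterate lam E (cis (2 * pi * \<omega>)) n (cis (2 * pi * x))) =
    \<bar>\<Prod>j<n. det (W (x + real (Suc j) * \<omega>))\<bar> ^ k * compound_norm k (cocycle_it n x)"
proof -
  have c: "cmat (cocycle_it n x) \<in> carrier_mat (d + d) (d + d)" using good_iterate(1)[OF g, of n] by simp
  show ?thesis
    unfolding good_iterate(2)[OF g] compound_norm_smult[OF c]
      compound_norm_cmat[OF good_iterate(1)[OF g]] norm_of_real ..
qed

lemma compound_process_process:
  assumes irr: "\<omega> \<notin> \<rat>" and k: "k \<le> d + d"
  shows "rotation_process \<omega> (compound_process k)"
proof
  let ?u = "cis (2 * pi * \<omega>)"
  let ?T = "transfer_iterate lam E ?u"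
  show "\<omega> \<notin> \<rat>" by (rule irr)
  show "continuous_on UNIV (compound_process k n)" for n
  proof (cases "n = 0")
    case False
    have "continuous_on UNIV (\<lambda>x. minor k (?T n (cis (2 * pi * x))) f h)"
      if "f \<in> idx k (d + d)" "h \<in> idx k (d + d)" for f h
      by (intro continuous_on_comp_cis holo_minor[OF holo_transfer_iterate])
         (use idx_less[OF that(1)] idx_less[OF that(2)] in auto)
    hence "continuous_on UNIV (\<lambda>x. sqrt (\<Sum>f\<in>idx k (d + d). \<Sum>h\<in>idx k (d + d).
        (norm (minor k (?T n (cis (2 * pi * x))) f h))\<^sup>2) / fact k)"
      by (intro continuous_on_divide continuous_on_real_sqrt continuous_on_sum continuous_on_power
          continuous_on_norm continuous_on_const) auto
    thus ?thesis
      using False carrier_matD(1)[OF transfer_carrier]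
      by (simp add: compound_process_def[abs_def] compound_norm_def minor_ssq_def)
  qed (simp add: compound_process_def[abs_def])
  show "compound_process k n (x + 1) = compound_process k n x" for n x
    unfolding compound_process_def cis_periodic ..
  show "0 \<le> compound_process k n x" for n x
    unfolding compound_process_def by (simp add: compound_norm_nonneg)
  show "compound_process k 0 x = 1" for x by (simp add: compound_process_def)
  show "compound_process k (m + n) x \<le> compound_process k n (x + real m * \<omega>) * compound_process k m x" for m n x
  proof (cases "m = 0 \<or> n = 0")
    case False
    have "?T (m + n) (cis (2 * pi * x)) = ?T n (cis (2 * pi * (x + real m * \<omega>))) * ?T m (cis (2 * pi * x))"
      using transfer_iterate_add[OF _ cis_ring(2), of ?u lam E m n "2 * pi * x"] unfolding cis_rot by simp
    thus ?thesis using False compound_norm_mult[OF transfer_carrier transfer_carrier]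
      by (simp add: compound_process_def)
  qed (auto simp: compound_process_def)
  \<comment> \<open>For the lower bound pick one point where the products of det W attain their
    rate. There the compound norm of the iterate stays above a positive constant and the scalar in
    front decays at most exponentially.\<close>
  interpret w: rotation_process \<omega> det_prod by (rule det_prod_process[OF irr])
  obtain x where x: "\<forall>\<^sub>F n in sequentially. 0 < det_prod n x" "(\<lambda>n. ln (det_prod n x) / real n) \<longlonglongrightarrow> w.growth"
    using AE_circle_exists[OF w.AE_growth] by blast
  have g: "good_point x" by (rule good_point_of_det_prod[OF x(1)])
  have Wx: "0 < \<bar>det (W x)\<bar>" using g unfolding good_point_def by (metis add.right_neutral mult_zero_left of_nat_0 zero_less_abs_iff)
  obtain c where c: "0 < c" "\<And>n. c \<le> compound_norm k (cocycle_it n x)"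
    using compound_norm_lower[OF g k] by blast
  define l where "l = w.growth - 1"
  define K where "K = c * (exp l / \<bar>det (W x)\<bar>) ^ k"
  have "\<forall>\<^sub>F n in sequentially. l < ln (det_prod n x) / real n"
    using x(2) by (rule order_tendstoD) (simp add: l_def)
  with x(1) eventually_gt_at_top[of 0] have "\<forall>\<^sub>F n in sequentially. exp (l * real n) \<le> det_prod n x"
  proof eventually_elim
    case (elim n)
    hence "l * real n \<le> ln (det_prod n x)" by (simp add: field_simps)
    thus ?case using elim(1) by (subst (asm) ln_ge_iff) auto
  qed
  hence "\<forall>\<^sub>F n in sequentially. exp (l * real (Suc n)) \<le> det_prod (Suc n) x"
    by (subst eventually_sequentially_Suc)
  hence "\<forall>\<^sub>F n in sequentially. K * exp (real k * l * real n) \<le> compound_process k n x"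
    using eventually_gt_at_top[of 0]
  proof eventually_elim
    case (elim n)
    let ?p = "\<bar>\<Prod>j<n. det (W (x + real (Suc j) * \<omega>))\<bar>"
    have "?p = det_prod (Suc n) x / \<bar>det (W x)\<bar>" using abs_prod_det_W[of x n] Wx by (metis less_irrefl nonzero_mult_div_cancel_right)
    hence p: "exp (l * real (Suc n)) / \<bar>det (W x)\<bar> \<le> ?p" using elim(1) Wx by (simp add: divide_right_mono)
    have "K * exp (real k * l * real n) = c * (exp (l * real (Suc n)) / \<bar>det (W x)\<bar>) ^ k"
    proof -
      have "exp (real k * l * real n) = exp (l * real n) ^ k" by (simp add: exp_of_nat_mult[symmetric] mult_ac)
      moreover have "exp (l * real (Suc n)) = exp l * exp (l * real n)" by (simp add: exp_add[symmetric] algebra_simps)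
      ultimately show ?thesis by (simp add: K_def power_mult_distrib power_divide)
    qed
    also have "\<dots> \<le> compound_norm k (cocycle_it n x) * ?p ^ k"
      using c p Wx by (intro mult_mono power_mono) (auto simp: compound_norm_nonneg)
    also have "\<dots> = compound_process k n x"
    proof -
      have "compound_process k n x = ?p ^ k * compound_norm k (cocycle_it n x)"
        using elim(2) unfolding compound_process_def compound_norm_transfer[OF g] by simp
      thus ?thesis by (simp only: mult.commute)
    qed
    finally show ?case .
  qed
  hence "\<exists>\<^sub>F n in sequentially. \<exists>x. K * exp (real k * l * real n) \<le> compound_process k n x"
    by (intro eventually_frequently) (auto elim: eventually_mono)
  moreover have "0 < K" using c Wx by (simp add: K_def)
  ultimately show "\<exists>c K. 0 < K \<and> (\<exists>\<^sub>F n in sequentially. \<exists>x. K * exp (c * real n) \<le> compound_process k n x)"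
    by blast
qed

text \<open>The sum of the first k exponents: scaling the cocycle by det W multiplies its k-th
  compound by the k-th power, whose rate is subtracted again.\<close>

definition sv_rate :: "nat \<Rightarrow> real" where
  "sv_rate k = rotation_process.growth (compound_process k) - real k * rotation_process.growth det_prod"

definition regular_point :: "real \<Rightarrow> bool" where
  "regular_point x \<longleftrightarrow> good_point x \<and> (\<forall>\<^sub>F n in sequentially. 0 < det_prod n x) \<and>
     (\<lambda>n. ln (det_prod n x) / real n) \<longlonglongrightarrow> rotation_process.growth det_prod \<and>
     (\<forall>k\<in>{..d + d}. (\<lambda>n. ln (compound_process k n x) / real n) \<longlonglongrightarrow> rotation_process.growth (compound_process k))"

lemma AE_regular_point:
  assumes irr: "\<omega> \<notin> \<rat>"
  shows "AE x in lebesgue_on {0..<1}. regular_point x"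
proof -
  have "AE x in lebesgue_on {0..<1}. \<forall>k\<in>{..d + d}.
      (\<lambda>n. ln (compound_process k n x) / real n) \<longlonglongrightarrow> rotation_process.growth (compound_process k)"
  proof (rule AE_finite_allI)
    fix k assume "k \<in> {..d + d}"
    hence "k \<le> d + d" by simp
    from rotation_process.AE_growth[OF compound_process_process[OF irr this]]
    show "AE x in lebesgue_on {0..<1}.
      (\<lambda>n. ln (compound_process k n x) / real n) \<longlonglongrightarrow> rotation_process.growth (compound_process k)"
      by eventually_elim blast
  qed simp
  with rotation_process.AE_growth[OF det_prod_process[OF irr]] show ?thesis
    by eventually_elim (auto simp: regular_point_def intro: good_point_of_det_prod)
qed

lemma sv_prod_pos:
  assumes g: "good_point x" and k: "k \<le> d + d"
  shows "0 < sv_prod k (cocycle_it n x)"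
proof -
  obtain c where c: "0 < c" "\<And>n. c \<le> compound_norm k (cocycle_it n x)"
    using compound_norm_lower[OF g k] by blast
  have "0 < real (d + d) ^ k * sv_prod k (cocycle_it n x)"
    using c(1) c(2)[of n] compound_norm_le_sv_prod[OF good_iterate(1)[OF g, of n] k] by linarith
  moreover have "0 < real (d + d) ^ k" using d by simp
  ultimately show ?thesis by (rule zero_less_mult_pos)
qed

lemma ln_compound_norm_sv_prod:
  assumes g: "good_point x" and k: "k \<le> d + d"
  shows "\<bar>ln (sv_prod k (cocycle_it n x)) - ln (compound_norm k (cocycle_it n x))\<bar> \<le> ln (fact k) + real k * ln (real (d + d))"
proof -
  let ?s = "sv_prod k (cocycle_it n x)" and ?c = "compound_norm k (cocycle_it n x)"
  obtain c where "0 < c" "\<And>n. c \<le> compound_norm k (cocycle_it n x)"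
    using compound_norm_lower[OF g k] by blast
  hence c: "0 < ?c" using order_less_le_trans by blast
  have s: "0 < ?s" by (rule sv_prod_pos[OF g k])
  have dd: "1 \<le> real (d + d)" using d by simp
  have f: "0 \<le> ln (fact k :: real)" by (simp add: fact_ge_1)
  have l: "0 \<le> real k * ln (real (d + d))" using dd by simp
  have "ln ?s \<le> ln (fact k * ?c)"
    using sv_prod_le_compound_norm[OF good_iterate(1)[OF g, of n] k] s c by (subst ln_le_cancel_iff) auto
  also have "\<dots> = ln (fact k) + ln ?c" using c by (subst ln_mult) auto
  finally have 1: "ln ?s \<le> ln (fact k) + ln ?c" .
  have "ln ?c \<le> ln (real (d + d) ^ k * ?s)"
    using compound_norm_le_sv_prod[OF good_iterate(1)[OF g, of n] k] s c by (subst ln_le_cancel_iff) auto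
  also have "\<dots> = real k * ln (real (d + d)) + ln ?s"
  proof -
    have D: "0 < real (d + d)" using dd by linarith
    show ?thesis unfolding ln_mult_pos[OF zero_less_power[OF D] s] ln_realpow ..
  qed
  finally show ?thesis using 1 f l by linarith
qed

text \<open>Up to a bounded error, ln of \<open>sv_prod\<close> is ln of the scaled compound norm
  minus k times ln of the determinant product up to \<open>Suc n\<close>; the shift and the missing
  factor at \<open>x\<close> do not affect the rate.\<close>

lemma sv_prod_limit:
  assumes r: "regular_point x" and k: "k \<le> d + d"
  shows "(\<lambda>n. ln (sv_prod k (cocycle_it n x)) / real n) \<longlonglongrightarrow> sv_rate k"
proof -
  have g: "good_point x" and dp: "\<forall>\<^sub>F n in sequentially. 0 < det_prod n x"
    and w: "(\<lambda>n. ln (det_prod n x) / real n) \<longlonglongrightarrow> rotation_process.growth det_prod"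
    and c: "(\<lambda>n. ln (compound_process k n x) / real n) \<longlonglongrightarrow> rotation_process.growth (compound_process k)"
    using r k by (auto simp: regular_point_def)
  have Wx: "0 < \<bar>det (W x)\<bar>" using g unfolding good_point_def by (metis add.right_neutral mult_zero_left of_nat_0 zero_less_abs_iff)
  obtain c0 where c0: "0 < c0" "\<And>n. c0 \<le> compound_norm k (cocycle_it n x)"
    using compound_norm_lower[OF g k] by blast
  define a where "a n = ln (compound_process k n x) - real k * ln (det_prod (Suc n) x)" for n
  have "(\<lambda>n. ln (compound_process k n x) / real n - real k * (ln (det_prod (Suc n) x) / real n)) \<longlonglongrightarrow> sv_rate k"
    unfolding sv_rate_def by (intro tendsto_diff tendsto_mult tendsto_const c tendsto_div_nat_Suc[OF w])
  hence a: "(\<lambda>n. a n / real n) \<longlonglongrightarrow> sv_rate k" unfolding a_def by (simp add: diff_divide_distrib)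
  define C where "C = \<bar>real k * ln \<bar>det (W x)\<bar>\<bar> + (ln (fact k) + real k * ln (real (d + d)))"
  show ?thesis
  proof (rule tendsto_div_nat_bounded_diff[OF a])
    have "\<forall>\<^sub>F n in sequentially. 0 < det_prod (Suc n) x" using dp by (subst eventually_sequentially_Suc)
    with eventually_gt_at_top[of 0]
    show "\<forall>\<^sub>F n in sequentially. \<bar>ln (sv_prod k (cocycle_it n x)) - a n\<bar> \<le> C"
    proof eventually_elim
      case (elim n)
      let ?p = "\<bar>\<Prod>j<n. det (W (x + real (Suc j) * \<omega>))\<bar>"
      have cn: "0 < compound_norm k (cocycle_it n x)" using c0(1) c0(2)[of n] by linarith
      have p: "0 < ?p" using abs_prod_det_W[of x n] elim(2) Wx by (metis zero_less_mult_pos2)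
      have "ln (det_prod (Suc n) x) = ln ?p + ln \<bar>det (W x)\<bar>"
        unfolding abs_prod_det_W[symmetric] using p Wx by (rule ln_mult_pos)
      moreover have "compound_process k n x = ?p ^ k * compound_norm k (cocycle_it n x)"
        using elim(1) unfolding compound_process_def compound_norm_transfer[OF g] by simp
      hence "ln (compound_process k n x) = real k * ln ?p + ln (compound_norm k (cocycle_it n x))"
        using p cn by (simp only: ln_mult_pos zero_less_power ln_realpow)
      ultimately have "a n = ln (compound_norm k (cocycle_it n x)) - real k * ln \<bar>det (W x)\<bar>"
        unfolding a_def by (simp add: algebra_simps)
      thus ?case using ln_compound_norm_sv_prod[OF g k, of n] unfolding C_def by linarith
    qed
  qed
qed

text \<open>Besides the compound norm, duality brings in det of the iterate, which is a quotient of
  values of det W at the ends of the orbit. It need not be bounded, but it is a constant times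
  \<open>det_prod n x / det_prod (Suc n) x\<close>, and both products have the same rate.\<close>

lemma sv_rate_duality:
  assumes irr: "\<omega> \<notin> \<rat>" and k: "k \<le> d + d"
  shows "sv_rate (d + d - k) \<le> sv_rate k"
proof -
  obtain x where r: "regular_point x" using AE_circle_exists[OF AE_regular_point[OF irr]] by blast
  have g: "good_point x" and dp: "\<forall>\<^sub>F n in sequentially. 0 < det_prod n x"
    and w: "(\<lambda>n. ln (det_prod n x) / real n) \<longlonglongrightarrow> rotation_process.growth det_prod"
    using r by (auto simp: regular_point_def)
  have Wn: "0 < \<bar>det (W (x + real n * \<omega>))\<bar>" for n using g unfolding good_point_def by simp
  obtain C where C: "0 < C" "\<And>n. sv_prod (d + d - k) (cocycle_it n x) \<le>
      C * compound_norm k (cocycle_it n x) * \<bar>det (cocycle_it n x)\<bar>"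
    using compound_norm_duality[OF g k] by blast
  define B where "B = ln C + (ln (fact k) + real k * ln (real (d + d))) + ln \<bar>det (W x)\<bar>"
  define b where "b n = ln (sv_prod k (cocycle_it n x)) + (ln (det_prod n x) - ln (det_prod (Suc n) x))" for n
  have "(\<lambda>n. ln (sv_prod k (cocycle_it n x)) / real n + (ln (det_prod n x) / real n - ln (det_prod (Suc n) x) / real n))
      \<longlonglongrightarrow> sv_rate k + (rotation_process.growth det_prod - rotation_process.growth det_prod)"
    by (intro tendsto_add tendsto_diff sv_prod_limit[OF r k] w tendsto_div_nat_Suc[OF w])
  hence "(\<lambda>n. b n / real n) \<longlonglongrightarrow> sv_rate k"
    unfolding b_def by (simp add: add_divide_distrib diff_divide_distrib)
  hence lim: "(\<lambda>n. (b n + B) / real n) \<longlonglongrightarrow> sv_rate k"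
    by (rule tendsto_div_nat_bounded_diff[of _ _ _ "\<bar>B\<bar>"]) simp
  have kk: "d + d - k \<le> d + d" by simp
  have "\<forall>\<^sub>F n in sequentially. 0 < det_prod (Suc n) x" using dp by (subst eventually_sequentially_Suc)
  with dp have "\<forall>\<^sub>F n in sequentially. ln (sv_prod (d + d - k) (cocycle_it n x)) / real n \<le> (b n + B) / real n"
  proof eventually_elim
    case (elim n)
    let ?M = "cocycle_it n x"
    obtain c0 where "0 < c0" "\<And>n. c0 \<le> compound_norm k (cocycle_it n x)"
      using compound_norm_lower[OF g k] by blast
    hence c: "0 < compound_norm k ?M" using order_less_le_trans by blast
    have d0: "\<bar>det ?M\<bar> * \<bar>det (W (x + real n * \<omega>))\<bar> = \<bar>det (W x)\<bar>" by (rule abs_det_cocycle_it[OF g])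
    have Wx: "0 < \<bar>det (W x)\<bar>" using Wn[of 0] by simp
    have dM: "0 < \<bar>det ?M\<bar>" using d0 Wx by (metis abs_ge_zero less_le mult_zero_left)
    have "det_prod (Suc n) x = det_prod n x * \<bar>det (W (x + real n * \<omega>))\<bar>" by (simp add: det_prod_def)
    hence "ln (det_prod (Suc n) x) = ln (det_prod n x) + ln \<bar>det (W (x + real n * \<omega>))\<bar>"
      using elim(1) Wn[of n] by (simp only: ln_mult_pos)
    moreover have "ln \<bar>det (W x)\<bar> = ln \<bar>det ?M\<bar> + ln \<bar>det (W (x + real n * \<omega>))\<bar>"
      unfolding d0[symmetric] using dM Wn[of n] by (rule ln_mult_pos)
    ultimately have lndet: "ln \<bar>det ?M\<bar> = ln \<bar>det (W x)\<bar> + (ln (det_prod n x) - ln (det_prod (Suc n) x))" by simp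
    have "ln (sv_prod (d + d - k) ?M) \<le> ln (C * compound_norm k ?M * \<bar>det ?M\<bar>)"
      using C(2)[of n] sv_prod_pos[OF g kk, of n] by (subst ln_le_cancel_iff) auto
    also have "\<dots> = ln C + ln (compound_norm k ?M) + ln \<bar>det ?M\<bar>"
      using C(1) c dM by (simp only: ln_mult_pos mult_pos_pos)
    also have "\<dots> \<le> b n + B"
      using ln_compound_norm_sv_prod[OF g k, of n] unfolding lndet b_def B_def by linarith
    finally show ?case by (rule divide_right_mono) simp
  qed
  thus ?thesis
    by (intro tendsto_le[OF sequentially_bot lim sv_prod_limit[OF r kk]])
qed

text \<open>Apply the inequality to k and to its complement.\<close>

lemma sv_rate_symmetric:
  assumes "\<omega> \<notin> \<rat>" "k \<le> d + d"
  shows "sv_rate (d + d - k) = sv_rate k"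
  using sv_rate_duality[OF assms] sv_rate_duality[OF assms(1), of "d + d - k"] assms(2) by simp

lemma singular_value_eq_quotient:
  assumes g: "good_point x" and i: "1 \<le> i" "i \<le> d + d"
  shows "singular_value i (cocycle_it n x) = sv_prod i (cocycle_it n x) / sv_prod (i - 1) (cocycle_it n x)"
proof -
  obtain j where j: "i = Suc j" using i by (cases i) auto
  have "0 < sv_prod j (cocycle_it n x)" using i j by (intro sv_prod_pos[OF g]) simp
  moreover have "sv_prod (Suc j) (cocycle_it n x) = sv_prod j (cocycle_it n x) * singular_values (cocycle_it n x) ! j"
    by (simp add: sv_prod_def)
  ultimately show ?thesis unfolding j singular_value_def by simp
qed

lemma singular_value_limit:
  assumes r: "regular_point x" and i: "1 \<le> i" "i \<le> d + d"
  shows "(\<lambda>n. 1 / real n * ln (singular_value i (cocycle_it n x))) \<longlonglongrightarrow> sv_rate i - sv_rate (i - 1)"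
proof -
  have g: "good_point x" using r by (simp add: regular_point_def)
  have i1: "i - 1 \<le> d + d" using i by simp
  have "(\<lambda>n. ln (sv_prod i (cocycle_it n x)) / real n - ln (sv_prod (i - 1) (cocycle_it n x)) / real n)
      \<longlonglongrightarrow> sv_rate i - sv_rate (i - 1)"
    by (intro tendsto_diff sv_prod_limit[OF r] i i1)
  moreover have "ln (sv_prod i (cocycle_it n x)) / real n - ln (sv_prod (i - 1) (cocycle_it n x)) / real n =
      1 / real n * ln (singular_value i (cocycle_it n x))" for n
    unfolding singular_value_eq_quotient[OF g i]
    using sv_prod_pos[OF g i(2), of n] sv_prod_pos[OF g i1, of n]
    by (simp add: ln_div diff_divide_distrib)
  ultimately show ?thesis by simp
qed

lemma has_lyapunov_exponent_sv_rate:
  assumes irr: "\<omega> \<notin> \<rat>" and i: "1 \<le> i" "i \<le> d + d"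
  shows "has_lyapunov_exponent \<omega> (schroedinger_cocycle d \<omega> W R D lam E) i (sv_rate i - sv_rate (i - 1))"
  unfolding has_lyapunov_exponent_def
  using AE_regular_point[OF irr] by eventually_elim (rule singular_value_limit[OF _ i])

text \<open>The exponents inherit the order of the singular values; one regular point is enough to
  see it.\<close>

lemma sv_rate_concave:
  assumes irr: "\<omega> \<notin> \<rat>" and i: "1 \<le> i" "i \<le> j" "j \<le> d + d"
  shows "sv_rate j - sv_rate (j - 1) \<le> sv_rate i - sv_rate (i - 1)"
proof -
  obtain x where r: "regular_point x" using AE_circle_exists[OF AE_regular_point[OF irr]] by blast
  have g: "good_point x" using r by (simp add: regular_point_def)
  have ij: "1 \<le> j" "i \<le> d + d" using i by auto
  have "1 / real n * ln (singular_value j (cocycle_it n x)) \<le> 1 / real n * ln (singular_value i (cocycle_it n x))" for n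
  proof (rule mult_left_mono)
    have j1: "j - 1 \<le> d + d" using i by simp
    have "0 < singular_value j (cocycle_it n x)"
      unfolding singular_value_eq_quotient[OF g ij(1) i(3)]
      using sv_prod_pos[OF g i(3), of n] sv_prod_pos[OF g j1, of n] by simp
    moreover have "singular_value j (cocycle_it n x) \<le> singular_value i (cocycle_it n x)"
      unfolding singular_value_def using i
      by (intro singular_values_antimono[OF good_iterate(1)[OF g]]) auto
    ultimately show "ln (singular_value j (cocycle_it n x)) \<le> ln (singular_value i (cocycle_it n x))"
      by (subst ln_le_cancel_iff) auto
  qed simp
  thus ?thesis
    by (intro LIMSEQ_le[OF singular_value_limit[OF r ij(1) i(3)] singular_value_limit[OF r i(1) ij(2)]]) auto
qed

end

section \<open>Lower bound and symmetry of the exponents\<close>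

theorem lyapunov_exponents:
  "\<exists>lam0 c :: real. 0 < lam0 \<and> (\<forall>\<omega> lam E :: real. \<omega> \<notin> \<rat> \<longrightarrow> lam > lam0 \<longrightarrow>
     (\<exists>L :: nat \<Rightarrow> real.
        (\<forall>i\<in>{1..2*d}. has_lyapunov_exponent \<omega> (schroedinger_cocycle d \<omega> W R D lam E) i (L i)) \<and>
        (\<forall>k\<in>{1..d}. L k \<ge> ln lam - c) \<and>
        (\<forall>k\<in>{1..d}. L (2*d + 1 - k) = - L k)))"
proof -
  obtain C lam0 where C: "1 \<le> lam0" "0 \<le> C" and CG: "\<And>u lam E. norm u = 1 \<Longrightarrow> lam0 \<le> lam \<Longrightarrow>
     (\<exists>K0>0. \<forall>n. \<exists>z. norm z = 1 \<and>
        K0 * exp ((real d * ln (sqrt (lam\<^sup>2 + E\<^sup>2)) - C) * real n) \<le> norm (det (corner lam E u n z))) \<and>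
     (\<forall>n z. norm z = 1 \<longrightarrow> entries_le (exp ((ln (sqrt (lam\<^sup>2 + E\<^sup>2)) + C) * real n)) (transfer_iterate lam E u n z))"
    using corner_growth by blast
  obtain K where K: "1 \<le> K" "\<And>z. z \<in> closed_ring outer \<Longrightarrow> norm (det (FW z)) \<le> K"
    using uniform_entry_bound by blast
  \<comment> \<open>One \<open>C\<close> from the lower bound of order d, d - 1 more from the upper
    bound of order d - 1, and \<open>ln K\<close> from the rate of the determinant products.\<close>
  define c where "c = real d * C + ln K"
  show ?thesis
  proof (rule exI[of _ lam0], rule exI[of _ c], intro conjI allI impI)
    show "0 < lam0" using C(1) by simp
    fix \<omega> lam E :: real assume irr: "\<omega> \<notin> \<rat>" and lam: "lam0 < lam"
    let ?u = "cis (2 * pi * \<omega>)"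
    define s where "s k = sv_rate \<omega> lam E k" for k
    define L where "L i = s i - s (i - 1)" for i
    define \<Lambda> where "\<Lambda> = sqrt (lam\<^sup>2 + E\<^sup>2)"
    have lam1: "1 < lam" using C(1) lam by linarith
    have lam\<Lambda>: "lam \<le> \<Lambda>" unfolding \<Lambda>_def by (rule real_le_rsqrt) simp
    have CG': "\<exists>K0>0. \<forall>n. \<exists>z. norm z = 1 \<and>
        K0 * exp ((real d * ln \<Lambda> - C) * real n) \<le> norm (det (corner lam E ?u n z))"
      "\<And>n z. norm z = 1 \<Longrightarrow> entries_le (exp ((ln \<Lambda> + C) * real n)) (transfer_iterate lam E ?u n z)"
      using CG[of ?u lam E] lam unfolding \<Lambda>_def by auto
    have dd: "d \<le> d + d" "d - 1 \<le> d + d" by auto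
    interpret w: rotation_process \<omega> "det_prod \<omega>" by (rule det_prod_process[OF irr])
    interpret P: rotation_process \<omega> "compound_process \<omega> lam E d"
      by (rule compound_process_process[OF irr dd(1)])
    interpret Q: rotation_process \<omega> "compound_process \<omega> lam E (d - 1)"
      by (rule compound_process_process[OF irr dd(2)])
    have wg: "w.growth \<le> ln K"
    proof (rule w.growth_le_of_bound[of 1])
      fix n x
      have "det_prod \<omega> n x \<le> (\<Prod>j<n. K)"
        unfolding det_prod_def abs_det_W by (intro prod_mono conjI K(2) cis_ring(1)) auto
      also have "\<dots> = 1 * exp (ln K * real n)" using K(1) by (simp add: exp_of_nat2_mult)
      finally show "det_prod \<omega> n x \<le> 1 * exp (ln K * real n)" .
    qed simp
    have Pg: "real d * ln \<Lambda> - C \<le> P.growth"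
    proof -
      obtain K0 where K0: "0 < K0" "\<And>n. \<exists>z. norm z = 1 \<and>
        K0 * exp ((real d * ln \<Lambda> - C) * real n) \<le> norm (det (corner lam E ?u n z))" using CG'(1) by blast
      have "\<exists>x. K0 / fact d * exp ((real d * ln \<Lambda> - C) * real n) \<le> compound_process \<omega> lam E d n x" if n: "0 < n" for n
      proof -
        obtain z where z: "norm z = 1"
          "K0 * exp ((real d * ln \<Lambda> - C) * real n) \<le> norm (det (corner lam E ?u n z))" using K0(2) by blast
        obtain x where x: "z = cis (2 * pi * x)" using unit_complex_cis[OF z(1)] by blast
        have "norm (det (corner lam E ?u n z)) \<le> fact d * compound_process \<omega> lam E d n x"
          using corner_det_le_compound_norm[OF _ cis_ring(2), of ?u lam E n "2 * pi * x"] n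
          unfolding x compound_process_def by simp
        hence "K0 * exp ((real d * ln \<Lambda> - C) * real n) \<le> fact d * compound_process \<omega> lam E d n x"
          using z(2) by linarith
        thus ?thesis by (intro exI[of _ x]) (simp add: divide_le_eq mult.commute)
      qed
      hence "\<exists>\<^sub>F n in sequentially. \<exists>x. K0 / fact d * exp ((real d * ln \<Lambda> - C) * real n) \<le> compound_process \<omega> lam E d n x"
        by (intro eventually_frequently) (auto intro: eventually_mono[OF eventually_gt_at_top[of 0]])
      moreover have "0 < K0 / fact d" using K0(1) by simp
      ultimately show ?thesis by (intro P.growth_ge)
    qed
    have Qg: "Q.growth \<le> real (d - 1) * (ln \<Lambda> + C)"
    proof (rule Q.growth_le_of_bound[of "real (d + d) ^ (d - 1)"])
      fix n :: nat and x assume n: "1 \<le> n"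
      let ?T = "transfer_iterate lam E ?u n (cis (2 * pi * x))"
      have T: "?T \<in> carrier_mat (d + d) (d + d)" by (rule transfer_carrier)
      have "entries_le (exp ((ln \<Lambda> + C) * real n)) ?T" by (rule CG'(2)) simp
      hence "compound_norm (d - 1) ?T \<le> real (d + d) ^ (d - 1) * exp ((ln \<Lambda> + C) * real n) ^ (d - 1)"
        using T by (intro compound_norm_le[OF T]) (auto simp: entries_le_def)
      also have "exp ((ln \<Lambda> + C) * real n) ^ (d - 1) = exp (real (d - 1) * (ln \<Lambda> + C) * real n)"
        by (simp add: exp_of_nat_mult[symmetric] mult.assoc)
      finally show "compound_process \<omega> lam E (d - 1) n x \<le>
          real (d + d) ^ (d - 1) * exp (real (d - 1) * (ln \<Lambda> + C) * real n)"
        using n by (simp add: compound_process_def)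
    qed (use d in simp)
    \<comment> \<open>The determinant rate is subtracted d times in \<open>s d\<close> and d - 1
      times in \<open>s (d - 1)\<close>, so one copy remains.\<close>
    have Ld: "L d = P.growth - Q.growth - w.growth"
      using d by (simp add: L_def s_def sv_rate_def of_nat_diff algebra_simps)
    have "ln lam - c \<le> L d"
    proof -
      have "ln lam \<le> ln \<Lambda>" using lam\<Lambda> lam1 by (subst ln_le_cancel_iff) auto
      moreover have "real d * ln \<Lambda> - C - real (d - 1) * (ln \<Lambda> + C) - ln K = ln \<Lambda> - c"
        using d by (simp add: c_def of_nat_diff algebra_simps)
      ultimately show ?thesis using Pg Qg wg unfolding Ld by linarith
    qed
    moreover have "L d \<le> L k" if "k \<in> {1..d}" for k
      using sv_rate_concave[OF irr, of k d lam E] that unfolding L_def s_def by simp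
    ultimately have low: "\<forall>k\<in>{1..d}. ln lam - c \<le> L k" by (meson order_trans)
    \<comment> \<open>The increment of \<open>s\<close> ending at 2 d + 1 - k reflects to the one
      from k to k - 1, which has the opposite sign.\<close>
    have sym: "\<forall>k\<in>{1..d}. L (2 * d + 1 - k) = - L k"
    proof
      fix k assume k: "k \<in> {1..d}"
      have "2 * d + 1 - k = d + d - (k - 1)" "2 * d + 1 - k - 1 = d + d - k" using k by auto
      moreover have "k - 1 \<le> d + d" "k \<le> d + d" using k by auto
      ultimately show "L (2 * d + 1 - k) = - L k"
        using sv_rate_symmetric[OF irr, of "k - 1" lam E] sv_rate_symmetric[OF irr, of k lam E]
        unfolding L_def s_def by simp
    qed
    show "\<exists>L :: nat \<Rightarrow> real.
        (\<forall>i\<in>{1..2*d}. has_lyapunov_exponent \<omega> (schroedinger_cocycle d \<omega> W R D lam E) i (L i)) \<and>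
        (\<forall>k\<in>{1..d}. L k \<ge> ln lam - c) \<and>
        (\<forall>k\<in>{1..d}. L (2*d + 1 - k) = - L k)"
    proof (rule exI[of _ L], intro conjI low sym ballI)
      fix i assume "i \<in> {1..2 * d}"
      thus "has_lyapunov_exponent \<omega> (schroedinger_cocycle d \<omega> W R D lam E) i (L i)"
        unfolding L_def s_def by (intro has_lyapunov_exponent_sv_rate[OF irr]) auto
    qed
  qed
qed

end

section \<open>From the real analytic data to the extension on the annulus\<close>

lemma C_omega_extension:
  assumes V: "V \<in> C_omega d \<rho> M" and M: "M \<subseteq> carrier_mat d d" and \<rho>: "0 < \<rho>"
  obtains F where "holo_mat (open_ring \<rho>) d F" "\<And>x. F (cis (2 * pi * x)) = cmat (V x)" "\<And>x. V x \<in> M"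
proof -
  obtain F where F: "\<forall>z \<in> annulus \<rho>. F z \<in> complexification M"
      "\<forall>i<d. \<forall>j<d. (\<lambda>z. F z $$ (i, j)) holomorphic_on interior (annulus \<rho>)"
      "\<forall>x. F (cis (2 * pi * x)) = cmat (V x)" and VM: "\<And>x. V x \<in> M"
    using V unfolding C_omega_def by blast
  have "holo_mat (open_ring \<rho>) d F"
    unfolding holo_mat_def
  proof (intro conjI ballI allI impI)
    fix z assume "z \<in> open_ring \<rho>"
    hence "z \<in> annulus \<rho>" using open_ring_subset_interior[of \<rho>] interior_subset by blast
    hence "F z \<in> complexification M" using F(1) by blast
    thus "F z \<in> carrier_mat d d" using M by (auto simp: complexification_def)
  next
    fix i j assume "i < d" "j < d"
    hence "(\<lambda>z. F z $$ (i, j)) holomorphic_on interior (annulus \<rho>)" using F(2) by blast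
    thus "(\<lambda>z. F z $$ (i, j)) holomorphic_on open_ring \<rho>"
      by (rule holomorphic_on_subset[OF _ open_ring_subset_interior])
  qed
  thus ?thesis using that F(3) VM by blast
qed

text \<open>Holomorphic functions on a connected open set have no zero divisors: where
  \<open>f\<close> is nonzero, an open set, \<open>g\<close> would vanish, hence everywhere.\<close>

lemma holomorphic_product_nonzero:
  assumes f: "f holomorphic_on open_ring \<rho>" and g: "g holomorphic_on open_ring \<rho>"
    and z: "z \<in> open_ring \<rho>" "f z \<noteq> 0" and w: "w \<in> open_ring \<rho>" "g w \<noteq> 0"
  shows "\<exists>x\<in>open_ring \<rho>. f x * g x \<noteq> 0"
proof (rule ccontr)
  assume contra: "\<not> ?thesis"
  define S where "S = {x \<in> open_ring \<rho>. f x \<noteq> 0}"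
  have "open S"
  proof -
    have "open (open_ring \<rho> \<inter> f -` (- {0}))"
      by (rule continuous_open_preimage[OF holomorphic_on_imp_continuous_on[OF f] open_open_ring])
         (simp add: open_Compl)
    moreover have "open_ring \<rho> \<inter> f -` (- {0}) = S" by (auto simp: S_def)
    ultimately show ?thesis by simp
  qed
  moreover have "S \<noteq> {}" using z by (auto simp: S_def)
  ultimately have "g w = (\<lambda>_. 0) w"
  proof (rule analytic_continuation_open[OF _ open_open_ring _ connected_open_ring _ g])
    show "S \<subseteq> open_ring \<rho>" by (auto simp: S_def)
    show "\<And>x. x \<in> S \<Longrightarrow> g x = 0" using contra by (auto simp: S_def)
  qed (use w in auto)
  thus False using w by simp
qed

theorem theorem2p3:
  fixes d :: nat and \<rho> :: real and W R D :: "real \<Rightarrow> real mat"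
  assumes "1 \<le> d" and "0 < \<rho>" and "\<rho> < 1"
    and "W \<in> C_omega d \<rho> (carrier_mat d d)"
    and "R \<in> C_omega d \<rho> (sym_mats d)"
    and "D \<in> C_omega d \<rho> (sym_mats d)"
    and "\<not> (\<forall>x. det (W x) = 0)"
    and "no_constant_eigenvalues D"
  shows "\<exists>lam\<^sub>0 c :: real. 0 < lam\<^sub>0 \<and>
    (\<forall>\<omega> lam E :: real. \<omega> \<notin> \<rat> \<longrightarrow> lam > lam\<^sub>0 \<longrightarrow>
      (\<exists>L :: nat \<Rightarrow> real.
         (\<forall>i\<in>{1..2*d}. has_lyapunov_exponent \<omega> (schroedinger_cocycle d \<omega> W R D lam E) i (L i)) \<and>
         (\<forall>k\<in>{1..d}. L k \<ge> ln lam - c) \<and>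
         (\<forall>k\<in>{1..d}. L (2*d + 1 - k) = - L k)))"
proof -
  have sub: "sym_mats d \<subseteq> carrier_mat d d" by (auto simp: sym_mats_def)
  obtain FW where FW: "holo_mat (open_ring \<rho>) d FW" "\<And>x. FW (cis (2 * pi * x)) = cmat (W x)"
      "\<And>x. W x \<in> carrier_mat d d"
    using C_omega_extension[OF assms(4) subset_refl assms(2)] by metis
  obtain FR where FR: "holo_mat (open_ring \<rho>) d FR" "\<And>x. FR (cis (2 * pi * x)) = cmat (R x)"
      "\<And>x. R x \<in> sym_mats d"
    using C_omega_extension[OF assms(5) sub assms(2)] by metis
  obtain FD where FD: "holo_mat (open_ring \<rho>) d FD" "\<And>x. FD (cis (2 * pi * x)) = cmat (D x)"
      "\<And>x. D x \<in> sym_mats d"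
    using C_omega_extension[OF assms(6) sub assms(2)] by metis
  have cis: "cis t \<in> open_ring \<rho>" for t using assms(2) by (simp add: open_ring_def)
  have Dc: "cmat (D x) \<in> carrier_mat d d" for x using FD(3)[of x] by (auto simp: sym_mats_def)
  obtain x0 where "det (W x0) \<noteq> 0" using assms(7) by blast
  hence detW: "det (FW (cis (2 * pi * x0))) \<noteq> 0" by (simp add: FW(2))
  \<comment> \<open>Only \<open>nondegenerate\<close> needs an argument; the other assumptions are
    properties of the extensions.\<close>
  interpret schroedinger_setup d \<rho> FW FR FD W R D
  proof
    fix a b :: real assume ab: "a\<^sup>2 + b\<^sup>2 = 1"
    let ?P = "\<lambda>z. complex_of_real a \<cdot>\<^sub>m FD z + complex_of_real b \<cdot>\<^sub>m 1\<^sub>m d"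
    have "holo_mat (open_ring \<rho>) d ?P"
      by (intro holo_mat_add holo_mat_smult FD(1) holo_mat_const holomorphic_on_const) simp
    hence hol: "(\<lambda>z. det (?P z)) holomorphic_on open_ring \<rho>" by (rule holo_det)
    have "\<exists>x. det (?P (cis (2 * pi * x))) \<noteq> 0"
    proof (cases "a = 0")
      case True
      hence "b \<noteq> 0" using ab by auto
      have "?P (cis (2 * pi * x)) = complex_of_real b \<cdot>\<^sub>m 1\<^sub>m d" for x
        unfolding FD(2) True using Dc[of x] by (intro eq_matI) auto
      thus ?thesis using \<open>b \<noteq> 0\<close> by simp
    next
      case False
      \<comment> \<open>For nonzero a the pencil is a times D - e, and some x makes it invertible
        because e is not an eigenvalue of every D(x). In the case a = 0 above, it was a nonzero
        multiple of the identity.\<close>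
      define e where "e = - complex_of_real b / complex_of_real a"
      obtain x where "\<not> eigenvalue (cmat (D x)) e" using assms(8) unfolding no_constant_eigenvalues_def by blast
      hence ne: "det (char_matrix (cmat (D x)) e) \<noteq> 0" using eigenvalue_det[OF Dc] by simp
      have "?P (cis (2 * pi * x)) = complex_of_real a \<cdot>\<^sub>m char_matrix (cmat (D x)) e"
        unfolding FD(2) char_matrix_def using Dc[of x] False
        by (intro eq_matI) (auto simp: e_def distrib_left)
      thus ?thesis using ne False by (intro exI[of _ x]) simp
    qed
    then obtain x where "det (?P (cis (2 * pi * x))) \<noteq> 0" by blast
    from holomorphic_product_nonzero[OF hol holo_det[OF FW(1)] cis this cis detW]
    show "\<exists>z\<in>open_ring \<rho>. det (?P z) * det (FW z) \<noteq> 0" .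
  qed (use assms(1,2) FW FR FD in auto)
  show ?thesis by (rule lyapunov_exponents)
qed

end
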